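(* Let $p\in(0,1)$ and let $(G_N)$ be a sequence of configuration models $\mathrm{CM}_N(\mathbf 1,\mathbf 2)$. Then, for all $\beta>0$ and $B\in\mathbb R$, the total spin satisfies $$\frac{S_N-\widetilde P_N(S_N)}{\sqrt N}\ \xrightarrow{\ \mathcal D\ }\ \mathcal N(0,\sigma_2^2)\qquad\text{w.r.t. }\widetilde P_N,\quad\text{as }N\to\infty,$$ where $$\sigma_2^2=\frac{\partial^2}{\partial t^2}\log\lambda_+(\beta,B+t)\Big|_{t=0}+\frac{1-p}2\,\frac{\partial^2}{\partial t^2}\log A_+(\beta,B+t)\Big|_{t=0}+\frac{\partial^2}{\partial t^2}I(B+t)\Big|_{t=0}.$$
   Context: Configuration model: given degrees $(d_i)_{i\in[N]}$ with even sum, attach $d_i$ half-edges to vertex $i\in[N]=\{1,\dots,N\}$ and pair all half-edges uniformly at random; each pair forms an edge, giving a random multigraph (self-loops and multiple edges allowed). $\mathrm{CM}_N(\mathbf 1,\mathbf 2)$ has $n_2=\lfloor pN\rfloor$ vertices of degree 2 and $n_1=N-\lfloor pN\rfloor$ vertices of degree 1; the total degree $N+\lfloor pN\rfloor$ is assumed even (equivalently $n_1$ even), and $N\to\infty$ along such $N$. Annealed Ising model: let $Q_N$ denote the law of the random multigraph $G_N=([N],E_N)$ and also the corresponding expectation; $E_N$ is counted with multiplicity, and a self-loop at $i$ contributes a term $\sigma_i\sigma_i=1$ once. For $\beta\ge0$, $B\in\mathbb R$ the annealed measure on $\sigma\in\{-1,1\}^N$ is $$\widetilde P_N(\sigma)=\frac{Q_N\big(\exp[\beta\sum_{(i,j)\in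 E_N}\sigma_i\sigma_j+B\sum_{i\in[N]}\sigma_i]\big)}{Q_N(Z_N(\beta,B))},\qquad Z_N(\beta,B)=\sum_{\sigma\in\{-1,1\}^N}\exp\Big[\beta\sum_{(i,j)\in E_N}\sigma_i\sigma_j+B\sum_{i\in[N]}\sigma_i\Big].$$ $\widetilde P_N(\cdot)$ also denotes expectation; $S_N=\sum_{i\in[N]}\sigma_i$; $\mathcal N(0,\sigma^2)$ is a centered normal variable with variance $\sigma^2$. Functions: $\lambda_\pm=\lambda_\pm(\beta,B)=e^{\beta}\big[\cosh(B)\pm\sqrt{\sinh^2(B)+e^{-4\beta}}\big]$, $r=r(\beta,B)=\lambda_-/\lambda_+$, $$A_\pm=A_\pm(\beta,B)=\frac{e^{-2\beta}e^{\pm B}+(\lambda_+-e^{\beta+B})^2e^{\mp B}\pm2e^{-\beta}(\lambda_+-e^{\beta+B})}{[e^{-2\beta}+(\lambda_+-e^{\beta+B})^2]\lambda_\pm},\qquad a=a(\beta,B)=\frac{A_-}{A_+},$$ $$\begin{aligned}H(s,t)=\;&(1-p)\log\tfrac{1-p}2-2s\log s-2\big(\tfrac{1-p}2-s\big)\log\big(\tfrac{1-p}2-s\big)+s\log(ar^2)+t\log r\\&+(s+t)\log(s+t)-t\log t+\big(\tfrac{1+p}2-s-t\big)\log\big(\tfrac{1+p}2-s-t\big)\\&-(p-t)\log(p-t)-\tfrac{1+p}2\log\tfrac{1+p}2+p\log p,\end{aligned}$$ with $0\log0=0$; $H$ depends on $(\beta,B)$ through $a,r$. For $B\ne0$, $I(B)=\max_{(s,t)\in[0,\frac{1-p}2]\times[0,p]}H(s,t)$;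 for $B=0$ (where $a=0$), $I(0)=0$. *)

theory Defs
  imports "HOL-Probability.Probability"
begin

section \<open>The configuration model\<close>

text \<open>Vertices are \<open>{1..N}\<close>; the half-edge \<open>(i, k)\<close> is the \<open>k\<close>-th one attached to vertex \<open>i\<close>.\<close>

definition half_edges :: "nat \<Rightarrow> (nat \<Rightarrow> nat) \<Rightarrow> (nat \<times> nat) set" where
  "half_edges N d = (SIGMA i:{1..N}. {..<d i})"

definition pairings :: "'a set \<Rightarrow> 'a set set set" where
  "pairings X = {M. partition_on X M \<and> (\<forall>e\<in>M. card e = 2)}"

text \<open>An edge is the two-element multiset of its end points, so a self-loop at \<open>i\<close> is
  \<open>{#i, i#}\<close>; a multigraph is the multiset of its edges.\<close>

type_synonym edge = "nat multiset"

definition multigraph_of :: "(nat \<times> nat) set set \<Rightarrow> edge multiset" where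
  "multigraph_of M = image_mset (\<lambda>e. image_mset fst (mset_set e)) (mset_set M)"

definition config_model :: "nat \<Rightarrow> (nat \<Rightarrow> nat) \<Rightarrow> edge multiset pmf" where
  "config_model N d = map_pmf multigraph_of (pmf_of_set (pairings (half_edges N d)))"

text \<open>The degree sequences of \<open>CM\<^sub>N(1,2)\<close>: which vertices have degree 2 is left arbitrary.\<close>

definition CM12_degrees :: "real \<Rightarrow> nat \<Rightarrow> (nat \<Rightarrow> nat) \<Rightarrow> bool" where
  "CM12_degrees p N d \<longleftrightarrow>
     (\<forall>i\<in>{1..N}. d i = 1 \<or> d i = 2) \<and>
     card {i\<in>{1..N}. d i = 2} = nat \<lfloor>p * real N\<rfloor> \<and>
     even (\<Sum>i\<in>{1..N}. d i)"


section \<open>The annealed Ising model\<close>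

definition spin_configs :: "nat \<Rightarrow> (nat \<Rightarrow> real) set" where
  "spin_configs N = {1..N} \<rightarrow>\<^sub>E {-1, 1}"

definition total_spin :: "nat \<Rightarrow> (nat \<Rightarrow> real) \<Rightarrow> real" where
  "total_spin N \<sigma> = (\<Sum>i\<in>{1..N}. \<sigma> i)"

definition boltzmann_weight ::
    "real \<Rightarrow> real \<Rightarrow> nat \<Rightarrow> (nat \<Rightarrow> real) \<Rightarrow> edge multiset \<Rightarrow> real" where
  "boltzmann_weight \<beta> B N \<sigma> E =
     exp (\<beta> * (\<Sum>e\<in>#E. \<Prod>i\<in>#e. \<sigma> i) + B * (\<Sum>i\<in>{1..N}. \<sigma> i))"

definition partition_function :: "real \<Rightarrow> real \<Rightarrow> nat \<Rightarrow> edge multiset \<Rightarrow> real" where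
  "partition_function \<beta> B N E = (\<Sum>\<sigma>\<in>spin_configs N. boltzmann_weight \<beta> B N \<sigma> E)"

definition annealed_prob ::
    "real \<Rightarrow> real \<Rightarrow> nat \<Rightarrow> (nat \<Rightarrow> nat) \<Rightarrow> (nat \<Rightarrow> real) \<Rightarrow> real" where
  "annealed_prob \<beta> B N d \<sigma> =
     measure_pmf.expectation (config_model N d) (boltzmann_weight \<beta> B N \<sigma>) /
     measure_pmf.expectation (config_model N d) (partition_function \<beta> B N)"

definition annealed_measure ::
    "real \<Rightarrow> real \<Rightarrow> nat \<Rightarrow> (nat \<Rightarrow> nat) \<Rightarrow> (nat \<Rightarrow> real) measure" where
  "annealed_measure \<beta> B N d =
     point_measure (spin_configs N) (\<lambda>\<sigma>. ennreal (annealed_prob \<beta> B N d \<sigma>))"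

definition rescaled_spin ::
    "real \<Rightarrow> real \<Rightarrow> nat \<Rightarrow> (nat \<Rightarrow> nat) \<Rightarrow> (nat \<Rightarrow> real) \<Rightarrow> real" where
  "rescaled_spin \<beta> B N d \<sigma> =
     (total_spin N \<sigma> - (\<integral>\<tau>. total_spin N \<tau> \<partial>annealed_measure \<beta> B N d)) / sqrt (real N)"


section \<open>The limiting variance\<close>

definition lambda_plus :: "real \<Rightarrow> real \<Rightarrow> real" where
  "lambda_plus \<beta> B = exp \<beta> * (cosh B + sqrt ((sinh B)\<^sup>2 + exp (-4 * \<beta>)))"

definition lambda_minus :: "real \<Rightarrow> real \<Rightarrow> real" where
  "lambda_minus \<beta> B = exp \<beta> * (cosh B - sqrt ((sinh B)\<^sup>2 + exp (-4 * \<beta>)))"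

definition r_ratio :: "real \<Rightarrow> real \<Rightarrow> real" where
  "r_ratio \<beta> B = lambda_minus \<beta> B / lambda_plus \<beta> B"

definition A_plus :: "real \<Rightarrow> real \<Rightarrow> real" where
  "A_plus \<beta> B =
     (exp (-2 * \<beta>) * exp B + (lambda_plus \<beta> B - exp (\<beta> + B))\<^sup>2 * exp (- B)
        + 2 * exp (- \<beta>) * (lambda_plus \<beta> B - exp (\<beta> + B))) /
     ((exp (-2 * \<beta>) + (lambda_plus \<beta> B - exp (\<beta> + B))\<^sup>2) * lambda_plus \<beta> B)"

definition A_minus :: "real \<Rightarrow> real \<Rightarrow> real" where
  "A_minus \<beta> B =
     (exp (-2 * \<beta>) * exp (- B) + (lambda_plus \<beta> B - exp (\<beta> + B))\<^sup>2 * exp B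
        - 2 * exp (- \<beta>) * (lambda_plus \<beta> B - exp (\<beta> + B))) /
     ((exp (-2 * \<beta>) + (lambda_plus \<beta> B - exp (\<beta> + B))\<^sup>2) * lambda_minus \<beta> B)"

definition a_ratio :: "real \<Rightarrow> real \<Rightarrow> real" where
  "a_ratio \<beta> B = A_minus \<beta> B / A_plus \<beta> B"

text \<open>The convention \<open>0 log 0 = 0\<close> holds automatically.\<close>

definition H_fun :: "real \<Rightarrow> real \<Rightarrow> real \<Rightarrow> real \<Rightarrow> real \<Rightarrow> real" where
  "H_fun p \<beta> B s t =
     (1 - p) * ln ((1 - p) / 2) - 2 * s * ln s
     - 2 * ((1 - p) / 2 - s) * ln ((1 - p) / 2 - s)
     + s * ln (a_ratio \<beta> B * (r_ratio \<beta> B)\<^sup>2) + t * ln (r_ratio \<beta> B)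
     + (s + t) * ln (s + t) - t * ln t
     + ((1 + p) / 2 - s - t) * ln ((1 + p) / 2 - s - t)
     - (p - t) * ln (p - t) - (1 + p) / 2 * ln ((1 + p) / 2) + p * ln p"

text \<open>At \<open>B = 0\<close> the coefficient \<open>a\<close> vanishes and \<open>log (a r\<^sup>2)\<close> is meaningless, hence the
  separate clause. For \<open>B \<noteq> 0\<close> the supremum is a maximum, as \<open>H\<close> is continuous on the
  compact rectangle.\<close>

definition I_fun :: "real \<Rightarrow> real \<Rightarrow> real \<Rightarrow> real" where
  "I_fun p \<beta> B =
     (if B = 0 then 0
      else SUP (s, t)\<in>{0..(1 - p) / 2} \<times> {0..p}. H_fun p \<beta> B s t)"

definition twice_differentiable_at :: "(real \<Rightarrow> real) \<Rightarrow> real \<Rightarrow> bool" where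
  "twice_differentiable_at f x \<longleftrightarrow>
     (\<forall>\<^sub>F y in nhds x. f field_differentiable at y) \<and> deriv f field_differentiable at x"

definition sigma2_sq :: "real \<Rightarrow> real \<Rightarrow> real \<Rightarrow> real" where
  "sigma2_sq p \<beta> B =
     (deriv ^^ 2) (\<lambda>t. ln (lambda_plus \<beta> (B + t))) 0
     + (1 - p) / 2 * (deriv ^^ 2) (\<lambda>t. ln (A_plus \<beta> (B + t))) 0
     + (deriv ^^ 2) (\<lambda>t. I_fun p \<beta> (B + t)) 0"

text \<open>The parameter is the variance; \<open>normal_density\<close> takes the standard deviation and does
  not cover the degenerate case, in which the law is the point mass at 0.\<close>

definition centered_normal :: "real \<Rightarrow> real measure" where
  "centered_normal v =
     (if v = 0 then return borel 0
      else density lborel (\<lambda>x. ennreal (normal_density 0 (sqrt v) x)))"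

end

theory Submission
  imports Defs
begin

text \<open>
  The averaging over the pairing can be carried out exactly, and it turns the annealed measure into
  a mixture of product measures with a one-dimensional mixing variable; the theorem is then Laplace's
  method in that variable.

  Write \<open>k = tanh \<beta>\<close>. Since \<open>exp (\<beta> x) = cosh \<beta> * (1 + k x)\<close> for \<open>x = \<plusminus>1\<close>, the average of the edge
  weight over all pairings of \<open>2n\<close> half-edges with spins \<open>\<tau>\<^sub>a\<close> is, up to a constant, the sum over the
  pairings of \<open>\<Prod> (1 + k \<tau>\<^sub>a \<tau>\<^sub>b)\<close>. By Wick's formula this is a moment of a two-dimensional Gaussian vector,
  and as the integrand is homogeneous of degree \<open>2n\<close> only the angular integral matters:
  it equals \<open>c\<^sub>n \<integral> \<Prod>\<^sub>a (1 + \<tau>\<^sub>a w) / (k + w\<^sup>2)\<^sup>n\<^sup>+\<^sup>1 dw\<close> (\<open>sum_pairings_eq_integral\<close>). For fixed \<open>w\<close> the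
  integrand factorises over the vertices, so given \<open>w\<close> the spins are independent, with positive weights
  if \<open>|w| < 1\<close> and signed ones otherwise.

  For \<open>w = tanh h\<close> the integrand is \<open>exp (N \<Psi>\<^sub>B(h))\<close> up to bounded factors, where
  \<open>\<Psi>\<^sub>B(h) = (1 - p) ln cosh (B + h) + p ln cosh (B + 2h) - (1 + p)/2 ln (cosh 2h - exp (- 2\<beta>))\<close>. At each
  zero of \<open>\<partial>\<^sub>h\<Psi>\<^sub>B\<close> the second derivative is negative (\<open>stiffness_pos\<close>), so there is a single critical point
  \<open>h\<^sup>*(B)\<close>, a nondegenerate maximum, and the region \<open>|w| \<ge> 1\<close> is exponentially negligible
  (\<open>exponent_gap\<close>). Hence \<open>w\<close> has Gaussian fluctuations of order \<open>N\<^sup>-\<^sup>1\<^sup>/\<^sup>2\<close> around \<open>tanh h\<^sup>*\<close>, the spins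
  given \<open>w\<close> obey the usual central limit theorem, and the two contributions add up
  (\<open>annealed_central_limit\<close>) to the variance
  \<open>\<partial>\<^sub>B\<^sub>B\<Psi> + (\<partial>\<^sub>B\<^sub>h\<Psi>)\<^sup>2 / (- \<partial>\<^sub>h\<^sub>h\<Psi>)\<close> at \<open>h\<^sup>*\<close>. By the implicit function theorem that number is the
  second derivative in \<open>B\<close> of \<open>max\<^sub>h \<Psi>\<^sub>B(h)\<close> (\<open>pressure_deriv\<close>, \<open>pressure_deriv2\<close>).

  What remains is to recognise this maximum in the stated variance. The function \<open>H\<close> is the exponential
  rate of a convolution of binomial coefficients, so by Gibbs' inequality its maximum equals
  \<open>min\<^sub>z (q ln f(z) - p ln z)\<close> up to a constant, for the generating function
  \<open>f(z) = 1 / (1 - z) + a r\<^sup>2 / (1 - r z)\<close> of a path of degree-2 vertices between two leaves, with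
  \<open>q = (1 - p) / 2\<close>. The spectral decomposition of the transfer matrix identifies \<open>A\<^sub>+ \<lambda>\<^sub>+\<^sup>2 f(\<lambda>\<^sub>+ y)\<close> with
  a resolvent of that matrix, and the critical point \<open>h\<^sup>*\<close> produces an explicit \<open>y\<close> at which the saddle
  point equation of \<open>f\<close> holds. This gives
  \<open>ln \<lambda>\<^sub>+ + q ln A\<^sub>+ + I(B) = max\<^sub>h \<Psi>\<^sub>B(h) + const\<close> for all \<open>B\<close>, including \<open>B = 0\<close>
  (\<open>I_fun_eq_pressure\<close>).
\<close>

section \<open>Sums over pairings as one-dimensional integrals\<close>

lemma pairings_empty: "pairings {} = {{}}"
  by (auto simp: pairings_def partition_on_def)

lemma finite_pairings: "finite X \<Longrightarrow> finite (pairings X)"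
  by (rule finite_subset[of _ "Pow (Pow X)"]) (auto simp: pairings_def partition_on_def)

text \<open>Condition on the partner \<open>b\<close> of a fixed point \<open>a\<close>: this is the recursion behind Wick's formula.\<close>

lemma pairings_insert:
  assumes "a \<notin> Y"
  shows "pairings (insert a Y) = (\<Union>b\<in>Y. insert {a, b} ` pairings (Y - {b}))"
proof (intro equalityI subsetI)
  fix M assume M: "M \<in> pairings (insert a Y)"
  then have part: "partition_on (insert a Y) M" and two: "\<And>e. e \<in> M \<Longrightarrow> card e = 2"
    by (auto simp: pairings_def)
  obtain e where e: "e \<in> M" "a \<in> e"
    using part by (auto simp: partition_on_def)
  obtain b where b: "e = {a, b}" "a \<noteq> b"
    using two[OF e(1)] e(2) by (metis card_2_iff doubleton_eq_iff insertE singletonD)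
  have bY: "b \<in> Y" using part e b by (auto simp: partition_on_def)
  have "partition_on (insert a Y - e) (M - {e})"
    using part e(1) unfolding partition_on_def disjoint_def by auto
  moreover have "insert a Y - e = Y - {b}" using assms b by auto
  ultimately have "M - {e} \<in> pairings (Y - {b})" using two by (auto simp: pairings_def)
  moreover have "M = insert {a, b} (M - {e})" using e b by auto
  ultimately show "M \<in> (\<Union>b\<in>Y. insert {a, b} ` pairings (Y - {b}))" using bY by blast
next
  fix M assume "M \<in> (\<Union>b\<in>Y. insert {a, b} ` pairings (Y - {b}))"
  then obtain b M' where b: "b \<in> Y" and M': "M' \<in> pairings (Y - {b})" and M: "M = insert {a, b} M'"
    by auto
  have ab: "a \<noteq> b" using assms b by auto
  have "\<Union>M' = Y - {b}" "{} \<notin> M'" "disjoint M'" and two: "\<forall>e\<in>M'. card e = 2"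
    using M' by (auto simp: pairings_def partition_on_def)
  then have "partition_on (insert a Y) M"
    using b assms unfolding M partition_on_def disjoint_def by (auto; blast)
  then show "M \<in> pairings (insert a Y)" using two ab by (auto simp: pairings_def M)
qed

lemma sum_pairings_insert:
  fixes g :: "'a set \<Rightarrow> real"
  assumes fin: "finite Y" and a: "a \<notin> Y"
  shows "(\<Sum>M\<in>pairings (insert a Y). \<Prod>e\<in>M. g e) =
    (\<Sum>b\<in>Y. g {a, b} * (\<Sum>M\<in>pairings (Y - {b}). \<Prod>e\<in>M. g e))"
proof -
  have sub: "M \<subseteq> Pow (Y - {b})" if "M \<in> pairings (Y - {b})" for M b
    using that by (auto simp: pairings_def partition_on_def)
  have notin: "{a, c} \<notin> M" if "M \<in> pairings (Y - {b})" for M b c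
    using sub[OF that] a by auto
  have disj: "insert {a, b} ` pairings (Y - {b}) \<inter> insert {a, c} ` pairings (Y - {c}) = {}"
    if "b \<in> Y" "c \<in> Y" "b \<noteq> c" for b c
  proof (rule ccontr)
    assume "\<not> ?thesis"
    then obtain M M' where M: "M \<in> pairings (Y - {b})" "M' \<in> pairings (Y - {c})"
      "insert {a, b} M = insert {a, c} M'" by auto
    then have "{a, b} \<in> insert {a, c} M'" by auto
    with notin[OF M(2), of b] have "{a, b} = {a, c}" by auto
    with that a show False by (auto simp: doubleton_eq_iff)
  qed
  have "(\<Sum>M\<in>pairings (insert a Y). \<Prod>e\<in>M. g e) =
      (\<Sum>b\<in>Y. \<Sum>M\<in>insert {a, b} ` pairings (Y - {b}). \<Prod>e\<in>M. g e)"
    unfolding pairings_insert[OF a]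
    by (rule sum.UNION_disjoint) (use fin disj finite_pairings in \<open>auto intro!: finite_imageI finite_pairings\<close>)
  also have "\<dots> = (\<Sum>b\<in>Y. \<Sum>M\<in>pairings (Y - {b}). \<Prod>e\<in>insert {a, b} M. g e)"
  proof (rule sum.cong[OF refl])
    fix b assume "b \<in> Y"
    have "inj_on (insert {a, b}) (pairings (Y - {b}))"
      using notin by (intro inj_onI) (metis insert_ident)
    then show "(\<Sum>M\<in>insert {a, b} ` pairings (Y - {b}). \<Prod>e\<in>M. g e) =
       (\<Sum>M\<in>pairings (Y - {b}). \<Prod>e\<in>insert {a, b} M. g e)"
      by (simp add: sum.reindex o_def)
  qed
  also have "\<dots> = (\<Sum>b\<in>Y. g {a, b} * (\<Sum>M\<in>pairings (Y - {b}). \<Prod>e\<in>M. g e))"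
    unfolding sum_distrib_left
  proof (intro sum.cong refl)
    fix b M assume "b \<in> Y" and M: "M \<in> pairings (Y - {b})"
    have "finite M" using sub[OF M] fin by (meson finite_Diff finite_Pow_iff finite_subset)
    then show "(\<Prod>e\<in>insert {a, b} M. g e) = g {a, b} * (\<Prod>e\<in>M. g e)"
      using notin[OF M] by simp
  qed
  finally show ?thesis .
qed

lemma pairings_nonempty:
  assumes "finite X" "card X = 2 * n" shows "pairings X \<noteq> {}"
  using assms
proof (induction n arbitrary: X)
  case 0
  then show ?case by (simp add: pairings_empty)
next
  case (Suc n)
  then obtain a where a: "a \<in> X" by fastforce
  define Y where "Y = X - {a}"
  have Y: "X = insert a Y" "a \<notin> Y" "finite Y" "card Y = Suc (2 * n)"
    using a Suc.prems by (auto simp: Y_def)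
  then obtain b where b: "b \<in> Y" by fastforce
  have "pairings (Y - {b}) \<noteq> {}" using Suc.IH[of "Y - {b}"] Y b by auto
  then show ?case using b unfolding Y(1) pairings_insert[OF Y(2)] by blast
qed

lemma integrable_Cauchy_weight:
  assumes "k > 0" shows "integrable lborel (\<lambda>w::real. 1 / (k + w\<^sup>2))"
proof -
  have "integrable lborel (\<lambda>x::real. inverse (1 + x\<^sup>2))"
    using integrable_inverse_1_plus_square by (simp add: set_integrable_def)
  then have "integrable lborel (\<lambda>x::real. inverse (1 + (0 + (1 / sqrt k) * x)\<^sup>2))"
    by (rule lborel_integrable_real_affine) (use assms in auto)
  then have "integrable lborel (\<lambda>x::real. (1 / k) * inverse (1 + (0 + (1 / sqrt k) * x)\<^sup>2))"
    by (rule integrable_mult_right)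
  then show ?thesis
    by (rule Bochner_Integration.integrable_cong[THEN iffD1, rotated -1])
       (use assms in \<open>auto simp: field_simps power_mult_distrib\<close>)
qed

text \<open>The boundary terms at \<open>+\<infinity>\<close> and \<open>-\<infinity>\<close> cancel, as they have the common value \<open>c\<close>.\<close>

lemma integral_derivative_vanishes:
  fixes F f :: "real \<Rightarrow> real"
  assumes F: "\<And>x. (F has_real_derivative f x) (at x)" and cont: "\<And>x. isCont f x"
    and int: "integrable lborel f" and top: "(F \<longlongrightarrow> c) at_top" and bot: "(F \<longlongrightarrow> c) at_bot"
  shows "(\<integral>x. f x \<partial>lborel) = 0"
proof -
  have "(LBINT x=-\<infinity>..\<infinity>. f x) = c - c"
  proof (rule interval_integral_FTC_integrable)
    show "set_integrable lborel (einterval (-\<infinity>) \<infinity>) f" using int by (simp add: set_integrable_def)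
    show "((F \<circ> real_of_ereal) \<longlongrightarrow> c) (at_right (-\<infinity>))"
      using bot by (simp add: ereal_tendsto_simps1)
    show "((F \<circ> real_of_ereal) \<longlongrightarrow> c) (at_left \<infinity>)"
      using top by (simp add: ereal_tendsto_simps1)
  qed (use F cont in \<open>auto simp: has_real_derivative_iff_has_vector_derivative\<close>)
  then show ?thesis
    by (simp add: interval_lebesgue_integral_def set_lebesgue_integral_def)
qed

lemma abs_prod_affine_le:
  fixes \<tau> :: "'a \<Rightarrow> real"
  assumes "finite X" "k > 0"
  shows "\<exists>C\<ge>0. \<forall>w. \<bar>\<Prod>a\<in>X. (1 + \<tau> a * w)\<bar> \<le> C * sqrt (k + w\<^sup>2) ^ card X"
  using assms(1)
proof (induction X)
  case empty
  then show ?case by (intro exI[of _ 1]) auto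
next
  case (insert a X)
  then obtain C where C: "C \<ge> 0" "\<And>w. \<bar>\<Prod>a\<in>X. (1 + \<tau> a * w)\<bar> \<le> C * sqrt (k + w\<^sup>2) ^ card X" by auto
  define D where "D = 1 / sqrt k + \<bar>\<tau> a\<bar>"
  have D: "\<bar>1 + \<tau> a * w\<bar> \<le> D * sqrt (k + w\<^sup>2)" for w
  proof -
    have "\<bar>1 + \<tau> a * w\<bar> \<le> 1 + \<bar>\<tau> a\<bar> * \<bar>w\<bar>" by (metis abs_mult abs_one abs_triangle_ineq)
    also have "1 \<le> (1 / sqrt k) * sqrt (k + w\<^sup>2)" using assms(2) by (simp add: real_sqrt_divide[symmetric] divide_simps)
    also have "\<bar>w\<bar> \<le> sqrt (k + w\<^sup>2)" using assms(2) by (simp add: real_le_rsqrt)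
    finally show ?thesis by (simp add: D_def distrib_right mult_left_mono)
  qed
  have "\<bar>\<Prod>a\<in>insert a X. (1 + \<tau> a * w)\<bar> \<le> (D * C) * sqrt (k + w\<^sup>2) ^ card (insert a X)" for w
  proof -
    have "\<bar>\<Prod>a\<in>insert a X. (1 + \<tau> a * w)\<bar> = \<bar>1 + \<tau> a * w\<bar> * \<bar>\<Prod>a\<in>X. (1 + \<tau> a * w)\<bar>"
      using insert by (simp add: abs_mult)
    also have "\<dots> \<le> (D * sqrt (k + w\<^sup>2)) * (C * sqrt (k + w\<^sup>2) ^ card X)"
      by (intro mult_mono D C) (use assms(2) in \<open>auto simp: D_def\<close>)
    finally show ?thesis using insert by (simp add: mult_ac)
  qed
  moreover have "D * C \<ge> 0" using C assms(2) by (auto simp: D_def)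
  ultimately show ?case by blast
qed

lemma integrable_prod_affine:
  fixes \<tau> :: "'a \<Rightarrow> real"
  assumes "finite X" "k > 0" "card X = 2 * n"
  shows "integrable lborel (\<lambda>w. (\<Prod>a\<in>X. (1 + \<tau> a * w)) / (k + w\<^sup>2) ^ Suc n)"
proof -
  obtain C where C: "C \<ge> 0" "\<And>w. \<bar>\<Prod>a\<in>X. (1 + \<tau> a * w)\<bar> \<le> C * sqrt (k + w\<^sup>2) ^ card X"
    using abs_prod_affine_le[OF assms(1,2)] by blast
  have pos: "k + w\<^sup>2 > 0" for w using assms(2) by (simp add: add_pos_nonneg)
  show ?thesis
  proof (rule Bochner_Integration.integrable_bound)
    show "integrable lborel (\<lambda>w. C * (1 / (k + w\<^sup>2)))"
      by (intro integrable_mult_right integrable_Cauchy_weight assms)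
    show "AE w in lborel. norm ((\<Prod>a\<in>X. 1 + \<tau> a * w) / (k + w\<^sup>2) ^ Suc n) \<le> norm (C * (1 / (k + w\<^sup>2)))"
    proof (intro AE_I2)
      fix w
      have "sqrt (k + w\<^sup>2) ^ card X = (k + w\<^sup>2) ^ n"
        using pos[of w] by (simp add: assms(3) power_mult)
      with C(2)[of w] have "\<bar>\<Prod>a\<in>X. (1 + \<tau> a * w)\<bar> \<le> C * (k + w\<^sup>2) ^ n" by simp
      then have "\<bar>\<Prod>a\<in>X. (1 + \<tau> a * w)\<bar> / (k + w\<^sup>2) ^ Suc n \<le> C * (k + w\<^sup>2) ^ n / (k + w\<^sup>2) ^ Suc n"
        by (rule divide_right_mono) (use pos[of w] in auto)
      also have "\<dots> = C * (1 / (k + w\<^sup>2))" using pos[of w] by simp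
      finally show "norm ((\<Prod>a\<in>X. 1 + \<tau> a * w) / (k + w\<^sup>2) ^ Suc n) \<le> norm (C * (1 / (k + w\<^sup>2)))"
        using pos[of w] C(1) by (simp add: abs_divide power_abs del: power_Suc)
    qed
  qed measurable
qed

text \<open>The analytic counterpart of \<open>sum_pairings_insert\<close>, with \<open>a\<close> of weight \<open>s\<close> singled out. Writing
  \<open>Q = \<Prod>\<^sub>c (1 + \<tau>\<^sub>c w)\<close>, it is the integral over the real line of the derivative of
  \<open>Q * (k s - w) / (k + w\<^sup>2)\<^sup>n\<^sup>+\<^sup>1\<close>. Numerator and denominator have the same even degree, so this function has
  the same limit at \<open>+\<infinity>\<close> and \<open>-\<infinity>\<close>.\<close>

lemma integration_by_parts_prod_affine:
  fixes \<tau> :: "'a \<Rightarrow> real"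
  assumes Y: "finite Y" "card Y = Suc (2 * n)" and k: "k > 0"
  shows "(\<Sum>b\<in>Y. (1 + k * (s * \<tau> b)) *
            (\<integral>w. (\<Prod>c\<in>Y - {b}. (1 + \<tau> c * w)) / (k + w\<^sup>2) ^ Suc n \<partial>lborel)) =
         2 * real (Suc n) * k *
           (\<integral>w. (1 + s * w) * (\<Prod>c\<in>Y. (1 + \<tau> c * w)) / (k + w\<^sup>2) ^ Suc (Suc n) \<partial>lborel)"
proof -
  define Q where "Q w = (\<Prod>c\<in>Y. (1 + \<tau> c * w))" for w
  define R where "R b w = (\<Prod>c\<in>Y - {b}. (1 + \<tau> c * w))" for b w
  define G where "G w = (1 + s * w) * Q w / (k + w\<^sup>2) ^ Suc (Suc n)" for w
  have pos: "k + w\<^sup>2 > 0" for w using k by (simp add: add_pos_nonneg)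
  have nz: "k + w\<^sup>2 \<noteq> 0" for w using pos[of w] by simp
  have QR: "Q w = (1 + \<tau> b * w) * R b w" if "b \<in> Y" for b w
    unfolding Q_def R_def using Y(1) that by (simp add: prod.remove)
  have dQ: "(Q has_real_derivative (\<Sum>b\<in>Y. \<tau> b * R b w)) (at w)" for w
  proof -
    have "((\<lambda>w. \<Prod>c\<in>Y. (1 + \<tau> c * w)) has_real_derivative
          (\<Sum>b\<in>Y. \<tau> b * (\<Prod>c\<in>Y - {b}. (1 + \<tau> c * w)))) (at w)"
      by (rule has_field_derivative_prod) (auto intro!: derivative_eq_intros)
    then show ?thesis unfolding Q_def[abs_def] R_def .
  qed
  have sumR: "(\<Sum>b\<in>Y. R b w) = real (Suc (2 * n)) * Q w - w * (\<Sum>b\<in>Y. \<tau> b * R b w)" for w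
  proof -
    have "(\<Sum>b\<in>Y. R b w) + w * (\<Sum>b\<in>Y. \<tau> b * R b w) = (\<Sum>b\<in>Y. Q w)"
      unfolding sum_distrib_left sum.distrib[symmetric]
      by (intro sum.cong refl) (simp add: QR algebra_simps)
    then show ?thesis using Y by (simp add: algebra_simps)
  qed
  have intR: "integrable lborel (\<lambda>w. R b w / (k + w\<^sup>2) ^ Suc n)" if "b \<in> Y" for b
    unfolding R_def using integrable_prod_affine[of "Y - {b}" k n \<tau>] Y k that by simp
  \<comment> \<open>The factor \<open>1 + s w\<close> is adjoined as one more point, represented by \<open>None\<close>.\<close>
  have intG: "integrable lborel G"
  proof -
    define X where "X = insert None (Some ` Y)"
    define \<tau>' where "\<tau>' = case_option s \<tau>"
    have "card X = 2 * Suc n" "finite X" using Y by (auto simp: X_def card_image)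
    then have "integrable lborel (\<lambda>w. (\<Prod>a\<in>X. (1 + \<tau>' a * w)) / (k + w\<^sup>2) ^ Suc (Suc n))"
      by (intro integrable_prod_affine k)
    moreover have "(\<Prod>a\<in>X. (1 + \<tau>' a * w)) = (1 + s * w) * Q w" for w
      using Y by (simp add: X_def \<tau>'_def Q_def prod.reindex)
    ultimately show ?thesis by (simp add: G_def[abs_def])
  qed
  define f where "f w = 2 * real (Suc n) * k * G w - (\<Sum>b\<in>Y. (1 + k * (s * \<tau> b)) * (R b w / (k + w\<^sup>2) ^ Suc n))" for w
  define F where "F w = - (Q w * (k * s - w) / (k + w\<^sup>2) ^ Suc n)" for w
  have dF: "(F has_real_derivative f w) (at w)" for w
  proof -
    define Q' where "Q' = (\<Sum>b\<in>Y. \<tau> b * R b w)"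
    have "(F has_real_derivative - (((Q' * (k * s - w) - Q w) * (k + w\<^sup>2) ^ Suc n
        - Q w * (k * s - w) * (real (Suc n) * (k + w\<^sup>2) ^ n * (2 * w)))
        / ((k + w\<^sup>2) ^ Suc n * (k + w\<^sup>2) ^ Suc n))) (at w)"
      unfolding F_def[abs_def]
      apply (rule derivative_eq_intros refl dQ[of w] | simp add: nz del: power_Suc)+
      apply (simp add: Q'_def nz algebra_simps power2_eq_square)
      done
    moreover have "(\<Sum>b\<in>Y. (1 + k * (s * \<tau> b)) * (R b w / (k + w\<^sup>2) ^ Suc n)) =
        (real (Suc (2 * n)) * Q w - w * Q' + k * s * Q') / (k + w\<^sup>2) ^ Suc n"
    proof -
      have "(\<Sum>b\<in>Y. (1 + k * (s * \<tau> b)) * (R b w / (k + w\<^sup>2) ^ Suc n)) =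
         ((\<Sum>b\<in>Y. R b w) + k * s * (\<Sum>b\<in>Y. \<tau> b * R b w)) / (k + w\<^sup>2) ^ Suc n"
        unfolding sum_distrib_left sum.distrib[symmetric] sum_divide_distrib
        by (intro sum.cong refl) (simp add: algebra_simps add_divide_distrib)
      then show ?thesis by (simp add: sumR Q'_def)
    qed
    moreover have "- (((Q' * (k * s - w) - Q w) * (k + w\<^sup>2) ^ Suc n
        - Q w * (k * s - w) * (real (Suc n) * (k + w\<^sup>2) ^ n * (2 * w)))
        / ((k + w\<^sup>2) ^ Suc n * (k + w\<^sup>2) ^ Suc n)) =
      2 * real (Suc n) * k * G w - (real (Suc (2 * n)) * Q w - w * Q' + k * s * Q') / (k + w\<^sup>2) ^ Suc n"
    proof -
      define u where "u = k + w\<^sup>2"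
      have u: "u > 0" using pos by (simp add: u_def)
      have k': "k = u - w * w" by (simp add: u_def power2_eq_square)
      show ?thesis unfolding G_def u_def[symmetric] using u
        by (simp add: divide_simps) (simp add: k' algebra_simps)
    qed
    ultimately show ?thesis by (simp add: f_def)
  qed
  have contQ: "isCont (\<lambda>w. \<Prod>c\<in>Z. (1 + \<tau> c * w)) x" for Z x
    by (intro continuous_intros)
  have contf: "isCont f x" for x
    unfolding f_def[abs_def] G_def Q_def R_def
    by (intro continuous_intros) (use nz in auto)
  have intf: "integrable lborel f"
    unfolding f_def[abs_def]
    by (intro Bochner_Integration.integrable_diff integrable_mult_right intG Bochner_Integration.integrable_sum intR)
  have lim: "(F \<longlongrightarrow> (\<Prod>c\<in>Y. \<tau> c)) at_infinity"
  proof -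
    have inv: "((\<lambda>w::real. 1 / w) \<longlongrightarrow> 0) at_infinity"
      using tendsto_inverse_0[where 'a=real] unfolding inverse_eq_divide .
    have "((\<lambda>w. - ((\<Prod>c\<in>Y. (1 / w + \<tau> c)) * (k * s * (1 / w) - 1) / (k * (1 / w)\<^sup>2 + 1) ^ Suc n))
       \<longlongrightarrow> - ((\<Prod>c\<in>Y. (0 + \<tau> c)) * (k * s * 0 - 1) / (k * 0\<^sup>2 + 1) ^ Suc n)) at_infinity"
      by (intro tendsto_intros inv) auto
    moreover have "\<forall>\<^sub>F w in at_infinity. - ((\<Prod>c\<in>Y. (1 / w + \<tau> c)) * (k * s * (1 / w) - 1) / (k * (1 / w)\<^sup>2 + 1) ^ Suc n) = F w"
    proof (rule eventually_at_infinityI[of 1])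
      fix w :: real assume w: "1 \<le> norm w"
      then have w0: "w \<noteq> 0" by auto
      have 1: "(\<Prod>c\<in>Y. (1 / w + \<tau> c)) = Q w / w ^ Suc (2 * n)"
      proof -
        have "(\<Prod>c\<in>Y. (1 / w + \<tau> c)) = (\<Prod>c\<in>Y. (1 + \<tau> c * w) / w)"
          using w0 by (intro prod.cong refl) (simp add: field_simps)
        also have "\<dots> = Q w / w ^ Suc (2 * n)" using Y by (simp add: prod_dividef Q_def)
        finally show ?thesis .
      qed
      have 2: "k * s * (1 / w) - 1 = (k * s - w) / w" using w0 by (simp add: field_simps)
      have 3: "(k * (1 / w)\<^sup>2 + 1) ^ Suc n = (k + w\<^sup>2) ^ Suc n / w ^ (2 * Suc n)"
      proof -
        have "k * (1 / w)\<^sup>2 + 1 = (k + w\<^sup>2) / w\<^sup>2" using w0 by (simp add: field_simps)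
        then show ?thesis by (simp only: power_divide power_mult)
      qed
      show "- ((\<Prod>c\<in>Y. (1 / w + \<tau> c)) * (k * s * (1 / w) - 1) / (k * (1 / w)\<^sup>2 + 1) ^ Suc n) = F w"
        unfolding 1 2 3 F_def using w0 by (simp add: divide_simps)
    qed
    ultimately show ?thesis by (simp add: tendsto_cong)
  qed
  have "(\<integral>w. f w \<partial>lborel) = 0"
    by (rule integral_derivative_vanishes[OF dF contf intf])
       (use lim in \<open>auto simp: at_infinity_eq_at_top_bot filterlim_def le_sup_iff filtermap_sup\<close>)
  then have "2 * real (Suc n) * k * (\<integral>w. G w \<partial>lborel) =
     (\<Sum>b\<in>Y. (1 + k * (s * \<tau> b)) * (\<integral>w. R b w / (k + w\<^sup>2) ^ Suc n \<partial>lborel))"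
  proof -
    have "integrable lborel (\<lambda>w. \<Sum>b\<in>Y. (1 + k * (s * \<tau> b)) * (R b w / (k + w\<^sup>2) ^ Suc n))"
      by (intro Bochner_Integration.integrable_sum integrable_mult_right intR)
    then have "(\<integral>w. f w \<partial>lborel) = (\<integral>w. 2 * real (Suc n) * k * G w \<partial>lborel) -
        (\<integral>w. (\<Sum>b\<in>Y. (1 + k * (s * \<tau> b)) * (R b w / (k + w\<^sup>2) ^ Suc n)) \<partial>lborel)"
      unfolding f_def by (intro Bochner_Integration.integral_diff integrable_mult_right intG)
    also have "(\<integral>w. (\<Sum>b\<in>Y. (1 + k * (s * \<tau> b)) * (R b w / (k + w\<^sup>2) ^ Suc n)) \<partial>lborel) =
        (\<Sum>b\<in>Y. \<integral>w. (1 + k * (s * \<tau> b)) * (R b w / (k + w\<^sup>2) ^ Suc n) \<partial>lborel)"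
      by (intro Bochner_Integration.integral_sum integrable_mult_right intR)
    finally show ?thesis using \<open>(\<integral>w. f w \<partial>lborel) = 0\<close>
      by (simp only: integral_mult_right_zero)
  qed
  then show ?thesis unfolding G_def R_def Q_def by simp
qed

lemma Cauchy_weight_integral_pos:
  fixes k :: real
  assumes "k > 0" shows "(\<integral>w. 1 / (k + w\<^sup>2) \<partial>lborel) > 0"
proof -
  have pos: "k + w\<^sup>2 > 0" for w using assms by (simp add: add_pos_nonneg)
  have "(\<integral>w. 1 / (k + w\<^sup>2) \<partial>lborel) \<noteq> 0"
  proof
    assume "(\<integral>w. 1 / (k + w\<^sup>2) \<partial>lborel) = 0"
    then have "AE w in lborel. 1 / (k + w\<^sup>2) = 0"
      using integrable_Cauchy_weight[OF assms] pos
      by (subst (asm) integral_nonneg_eq_0_iff_AE) (auto intro!: AE_I2 less_imp_le)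
    then have "AE w in (lborel :: real measure). False"
    proof eventually_elim
      case (elim w)
      then show ?case using pos[of w] by simp
    qed
    then show False by (auto simp: AE_iff_null emeasure_lborel_UNIV dest: null_setsD1)
  qed
  moreover have "(\<integral>w. 1 / (k + w\<^sup>2) \<partial>lborel) \<ge> 0"
    by (intro integral_nonneg_AE AE_I2) (use pos in \<open>auto intro: less_imp_le\<close>)
  ultimately show ?thesis by linarith
qed

text \<open>Wick's formula in angular form: both sides satisfy the same recursion when one point is removed
  together with its partner.\<close>

lemma sum_pairings_eq_integral:
  assumes k: "k > 0"
  shows "\<exists>c>0. \<forall>(X::'a set) (\<tau>::'a \<Rightarrow> real). finite X \<longrightarrow> card X = 2 * n \<longrightarrow>
     (\<Sum>M\<in>pairings X. \<Prod>e\<in>M. (1 + k * (\<Prod>a\<in>e. \<tau> a))) =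
     c * (\<integral>w. (\<Prod>a\<in>X. (1 + \<tau> a * w)) / (k + w\<^sup>2) ^ Suc n \<partial>lborel)"
proof (induction n)
  case 0
  then show ?case using Cauchy_weight_integral_pos[OF k]
    by (intro exI[of _ "1 / (\<integral>w. 1 / (k + w\<^sup>2) \<partial>lborel)"]) (auto simp: pairings_empty)
next
  case (Suc n)
  then obtain c where c: "c > 0" and IH: "\<And>(X::'a set) (\<tau>::'a \<Rightarrow> real). finite X \<Longrightarrow> card X = 2 * n \<Longrightarrow>
     (\<Sum>M\<in>pairings X. \<Prod>e\<in>M. (1 + k * (\<Prod>a\<in>e. \<tau> a))) =
     c * (\<integral>w. (\<Prod>a\<in>X. (1 + \<tau> a * w)) / (k + w\<^sup>2) ^ Suc n \<partial>lborel)" by blast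
  have "(\<Sum>M\<in>pairings X. \<Prod>e\<in>M. (1 + k * (\<Prod>a\<in>e. \<tau> a))) =
     (c * (2 * real (Suc n) * k)) * (\<integral>w. (\<Prod>a\<in>X. (1 + \<tau> a * w)) / (k + w\<^sup>2) ^ Suc (Suc n) \<partial>lborel)"
    if X: "finite X" "card X = 2 * Suc n" for X :: "'a set" and \<tau> :: "'a \<Rightarrow> real"
  proof -
    obtain a where a: "a \<in> X" using X by fastforce
    define Y where "Y = X - {a}"
    have Y: "X = insert a Y" "a \<notin> Y" "finite Y" "card Y = Suc (2 * n)"
      using a X by (auto simp: Y_def)
    have "(\<Sum>M\<in>pairings X. \<Prod>e\<in>M. (1 + k * (\<Prod>a\<in>e. \<tau> a))) =
      (\<Sum>b\<in>Y. (1 + k * (\<Prod>a\<in>{a, b}. \<tau> a)) * (\<Sum>M\<in>pairings (Y - {b}). \<Prod>e\<in>M. (1 + k * (\<Prod>a\<in>e. \<tau> a))))"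
      unfolding Y(1) by (rule sum_pairings_insert) (use Y in auto)
    also have "\<dots> = (\<Sum>b\<in>Y. (1 + k * (\<tau> a * \<tau> b)) *
       (c * (\<integral>w. (\<Prod>a\<in>Y - {b}. (1 + \<tau> a * w)) / (k + w\<^sup>2) ^ Suc n \<partial>lborel)))"
    proof (intro sum.cong refl arg_cong2[where f="(*)"])
      fix b assume b: "b \<in> Y"
      then show "1 + k * (\<Prod>a\<in>{a, b}. \<tau> a) = 1 + k * (\<tau> a * \<tau> b)"
        using Y by (cases "a = b") auto
      show "(\<Sum>M\<in>pairings (Y - {b}). \<Prod>e\<in>M. (1 + k * (\<Prod>a\<in>e. \<tau> a))) =
         c * (\<integral>w. (\<Prod>a\<in>Y - {b}. (1 + \<tau> a * w)) / (k + w\<^sup>2) ^ Suc n \<partial>lborel)"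
        by (rule IH) (use Y b in auto)
    qed
    also have "\<dots> = c * (\<Sum>b\<in>Y. (1 + k * (\<tau> a * \<tau> b)) *
       (\<integral>w. (\<Prod>a\<in>Y - {b}. (1 + \<tau> a * w)) / (k + w\<^sup>2) ^ Suc n \<partial>lborel))"
      by (simp add: sum_distrib_left mult_ac)
    also have "\<dots> = c * (2 * real (Suc n) * k *
       (\<integral>w. (1 + \<tau> a * w) * (\<Prod>c\<in>Y. (1 + \<tau> c * w)) / (k + w\<^sup>2) ^ Suc (Suc n) \<partial>lborel))"
      by (subst integration_by_parts_prod_affine[OF Y(3,4) k]) simp
    finally show ?thesis using Y by simp
  qed
  moreover have "c * (2 * real (Suc n) * k) > 0" using c k by simp
  ultimately show ?case by blast
qed

section \<open>The annealed measure as a mixture of product measures\<close>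

lemma exp_eq_cosh_tanh:
  fixes x \<beta> :: real
  assumes "x = 1 \<or> x = - 1"
  shows "exp (\<beta> * x) = cosh \<beta> * (1 + tanh \<beta> * x)"
proof -
  have "cosh \<beta> * (1 + tanh \<beta> * x) = cosh \<beta> + x * sinh \<beta>"
    by (simp add: tanh_def algebra_simps)
  then show ?thesis using assms by (auto simp: cosh_plus_sinh cosh_minus_sinh)
qed

lemma finite_half_edges: "finite (half_edges N d)"
  by (simp add: half_edges_def)

lemma card_half_edges: "card (half_edges N d) = (\<Sum>i\<in>{1..N}. d i)"
  by (simp add: half_edges_def)

lemma prod_half_edges:
  "(\<Prod>a\<in>half_edges N d. f (fst a)) = (\<Prod>i\<in>{1..N}. f i ^ d i)"
proof -
  have "(\<Prod>i\<in>{1..N}. f i ^ d i) = (\<Prod>i\<in>{1..N}. \<Prod>j\<in>{..<d i}. f i)" by simp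
  also have "\<dots> = (\<Prod>a\<in>half_edges N d. f (fst a))"
    unfolding half_edges_def by (subst prod.Sigma) (auto simp: split_def)
  finally show ?thesis by simp
qed

lemma edge_sum_multigraph_of:
  fixes \<sigma> :: "nat \<Rightarrow> real"
  assumes "finite X" "M \<in> pairings X"
  shows "(\<Sum>e\<in>#multigraph_of M. \<Prod>i\<in>#e. \<sigma> i) = (\<Sum>e\<in>M. \<Prod>a\<in>e. \<sigma> (fst a))"
  unfolding multigraph_of_def
  by (simp add: image_mset.compositionality o_def sum_unfold_sum_mset prod_unfold_prod_mset)

lemma expectation_config_model:
  assumes "card (half_edges N d) = 2 * n"
  shows "measure_pmf.expectation (config_model N d) g =
    (\<Sum>M\<in>pairings (half_edges N d). g (multigraph_of M)) / card (pairings (half_edges N d))"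
  unfolding config_model_def integral_map_pmf
  by (rule integral_pmf_of_set)
     (intro pairings_nonempty[OF finite_half_edges assms] finite_pairings finite_half_edges)+

text \<open>The constant \<open>C\<close> depends on the graph model only, so it cancels when the annealed probabilities are
  formed.\<close>

lemma expectation_boltzmann_weight:
  assumes "\<beta> > 0" and n: "card (half_edges N d) = 2 * n"
  shows "\<exists>C>0. \<forall>\<sigma>\<in>spin_configs N.
     measure_pmf.expectation (config_model N d) (boltzmann_weight \<beta> B N \<sigma>) =
     C * (\<integral>w. (\<Prod>i\<in>{1..N}. exp (B * \<sigma> i) * (1 + \<sigma> i * w) ^ d i) / (tanh \<beta> + w\<^sup>2) ^ Suc n \<partial>lborel)"
proof -
  let ?X = "half_edges N d"
  define k where "k = tanh \<beta>"
  have k: "k > 0" using assms by (simp add: k_def)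
  obtain c where c: "c > 0" and W: "\<And>\<tau>::nat \<times> nat \<Rightarrow> real.
     (\<Sum>M\<in>pairings ?X. \<Prod>e\<in>M. (1 + k * (\<Prod>a\<in>e. \<tau> a))) =
     c * (\<integral>w. (\<Prod>a\<in>?X. (1 + \<tau> a * w)) / (k + w\<^sup>2) ^ Suc n \<partial>lborel)"
    using sum_pairings_eq_integral[OF k, of n] n finite_half_edges by blast
  have fin: "finite (pairings ?X)" "pairings ?X \<noteq> {}"
    using finite_pairings finite_half_edges pairings_nonempty n by blast+
  have "measure_pmf.expectation (config_model N d) (boltzmann_weight \<beta> B N \<sigma>) =
     c * cosh \<beta> ^ n / card (pairings ?X) *
     (\<integral>w. (\<Prod>i\<in>{1..N}. exp (B * \<sigma> i) * (1 + \<sigma> i * w) ^ d i) / (k + w\<^sup>2) ^ Suc n \<partial>lborel)"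
    if \<sigma>: "\<sigma> \<in> spin_configs N" for \<sigma>
  proof -
    define E where "E = exp (B * (\<Sum>i\<in>{1..N}. \<sigma> i))"
    have E: "E = (\<Prod>i\<in>{1..N}. exp (B * \<sigma> i))"
      by (simp add: E_def sum_distrib_left exp_sum)
    have pm: "\<sigma> (fst a) = 1 \<or> \<sigma> (fst a) = - 1" if "a \<in> ?X" for a
      using that \<sigma> by (auto simp: half_edges_def spin_configs_def PiE_def Pi_def)
    have *: "boltzmann_weight \<beta> B N \<sigma> (multigraph_of M) =
        E * cosh \<beta> ^ n * (\<Prod>e\<in>M. (1 + k * (\<Prod>a\<in>e. \<sigma> (fst a))))"
      if M: "M \<in> pairings ?X" for M
    proof -
      have part: "partition_on ?X M" and two: "\<And>e. e \<in> M \<Longrightarrow> card e = 2"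
        using M by (auto simp: pairings_def)
      have finM: "finite M" using part finite_elements finite_half_edges by blast
      have sub: "e \<subseteq> ?X" if "e \<in> M" for e using part that by (auto simp: partition_on_def)
      have "card ?X = (\<Sum>e\<in>M. card e)"
        by (rule product_partition[OF part]) (use sub finite_half_edges finite_subset in blast)
      then have cM: "card M = n" using two n by simp
      have pme: "(\<Prod>a\<in>e. \<sigma> (fst a)) = 1 \<or> (\<Prod>a\<in>e. \<sigma> (fst a)) = - 1" if "e \<in> M" for e
      proof -
        have "finite e" using sub[OF that] finite_half_edges finite_subset by blast
        moreover have "\<forall>a\<in>e. \<sigma> (fst a) = 1 \<or> \<sigma> (fst a) = - 1" using sub[OF that] pm by blast
        ultimately show ?thesis by (induction e) auto
      qed
      have "boltzmann_weight \<beta> B N \<sigma> (multigraph_of M) = E * exp (\<beta> * (\<Sum>e\<in>M. \<Prod>a\<in>e. \<sigma> (fst a)))"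
        unfolding boltzmann_weight_def edge_sum_multigraph_of[OF finite_half_edges M] E_def
        by (simp add: exp_add mult.commute)
      also have "exp (\<beta> * (\<Sum>e\<in>M. \<Prod>a\<in>e. \<sigma> (fst a))) = (\<Prod>e\<in>M. cosh \<beta> * (1 + k * (\<Prod>a\<in>e. \<sigma> (fst a))))"
        unfolding sum_distrib_left exp_sum[OF finM] k_def
        by (intro prod.cong refl exp_eq_cosh_tanh pme)
      also have "\<dots> = cosh \<beta> ^ n * (\<Prod>e\<in>M. (1 + k * (\<Prod>a\<in>e. \<sigma> (fst a))))"
        by (simp add: prod.distrib cM)
      finally show ?thesis by (simp add: mult.assoc)
    qed
    have "measure_pmf.expectation (config_model N d) (boltzmann_weight \<beta> B N \<sigma>) =
       (\<Sum>M\<in>pairings ?X. E * cosh \<beta> ^ n * (\<Prod>e\<in>M. (1 + k * (\<Prod>a\<in>e. \<sigma> (fst a))))) / card (pairings ?X)"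
      unfolding expectation_config_model[OF n] by (simp add: *)
    also have "\<dots> = E * cosh \<beta> ^ n * (c * (\<integral>w. (\<Prod>a\<in>?X. (1 + \<sigma> (fst a) * w)) / (k + w\<^sup>2) ^ Suc n \<partial>lborel)) / card (pairings ?X)"
      by (simp only: sum_distrib_left[symmetric] W)
    also have "\<dots> = c * cosh \<beta> ^ n / card (pairings ?X) *
       (\<integral>w. E * ((\<Prod>a\<in>?X. (1 + \<sigma> (fst a) * w)) / (k + w\<^sup>2) ^ Suc n) \<partial>lborel)"
      by (simp only: integral_mult_right_zero) simp
    also have "(\<lambda>w. E * ((\<Prod>a\<in>?X. (1 + \<sigma> (fst a) * w)) / (k + w\<^sup>2) ^ Suc n)) =
       (\<lambda>w. (\<Prod>i\<in>{1..N}. exp (B * \<sigma> i) * (1 + \<sigma> i * w) ^ d i) / (k + w\<^sup>2) ^ Suc n)"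
      by (simp add: E prod.distrib prod_half_edges[of "\<lambda>i. 1 + \<sigma> i * _"])
    finally show ?thesis .
  qed
  moreover have "c * cosh \<beta> ^ n / card (pairings ?X) > 0"
    using c fin by (simp add: card_gt_0_iff)
  ultimately show ?thesis unfolding k_def[symmetric] by blast
qed

lemma finite_spin_configs: "finite (spin_configs N)"
  by (simp add: spin_configs_def finite_PiE)

lemma spin_configs_nonempty: "spin_configs N \<noteq> {}"
  by (auto simp: spin_configs_def PiE_eq_empty_iff)

lemma integrable_spin_weight:
  fixes k B :: real and \<sigma> :: "nat \<Rightarrow> real"
  assumes "k > 0" and n: "card (half_edges N d) = 2 * n"
  shows "integrable lborel (\<lambda>w. (\<Prod>i\<in>{1..N}. exp (B * \<sigma> i) * (1 + \<sigma> i * w) ^ d i) / (k + w\<^sup>2) ^ Suc n)"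
proof -
  have "integrable lborel (\<lambda>w. (\<Prod>i\<in>{1..N}. exp (B * \<sigma> i)) * ((\<Prod>a\<in>half_edges N d. (1 + \<sigma> (fst a) * w)) / (k + w\<^sup>2) ^ Suc n))"
    using integrable_prod_affine[OF finite_half_edges assms, of "\<lambda>a. \<sigma> (fst a)"]
    by (intro integrable_mult_right)
  also have "(\<lambda>w. (\<Prod>i\<in>{1..N}. exp (B * \<sigma> i)) * ((\<Prod>a\<in>half_edges N d. (1 + \<sigma> (fst a) * w)) / (k + w\<^sup>2) ^ Suc n)) =
     (\<lambda>w. (\<Prod>i\<in>{1..N}. exp (B * \<sigma> i) * (1 + \<sigma> i * w) ^ d i) / (k + w\<^sup>2) ^ Suc n)"
    by (simp add: prod.distrib prod_half_edges[of "\<lambda>i. 1 + \<sigma> i * _"])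
  finally show ?thesis .
qed

text \<open>The integrand, as a function of the mixing variable \<open>w\<close>, of the unnormalised annealed
  expectation of \<open>F\<close> applied to the total spin. It is a signed weight for \<open>|w| > 1\<close>.\<close>

definition spin_kernel ::
    "real \<Rightarrow> real \<Rightarrow> nat \<Rightarrow> (nat \<Rightarrow> nat) \<Rightarrow> (real \<Rightarrow> 'b) \<Rightarrow> real \<Rightarrow> 'b::real_normed_vector" where
  "spin_kernel \<beta> B N d F w =
     (\<Sum>\<sigma>\<in>spin_configs N. ((\<Prod>i\<in>{1..N}. exp (B * \<sigma> i) * (1 + \<sigma> i * w) ^ d i) /
        (tanh \<beta> + w\<^sup>2) ^ Suc ((\<Sum>i\<in>{1..N}. d i) div 2)) *\<^sub>R F (total_spin N \<sigma>))"

lemma annealed_prob_nonneg_sum: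
  assumes n: "card (half_edges N d) = 2 * n"
  shows "\<And>\<sigma>. annealed_prob \<beta> B N d \<sigma> \<ge> 0"
    and "(\<Sum>\<sigma>\<in>spin_configs N. annealed_prob \<beta> B N d \<sigma>) = 1"
    and "measure_pmf.expectation (config_model N d) (partition_function \<beta> B N) =
      (\<Sum>\<sigma>\<in>spin_configs N. measure_pmf.expectation (config_model N d) (boltzmann_weight \<beta> B N \<sigma>))"
proof -
  let ?X = "half_edges N d"
  have fin: "finite (pairings ?X)" "pairings ?X \<noteq> {}"
    using finite_pairings finite_half_edges pairings_nonempty n by blast+
  have pos: "measure_pmf.expectation (config_model N d) (boltzmann_weight \<beta> B N \<sigma>) > 0" for \<sigma>
    unfolding expectation_config_model[OF n]
    by (intro divide_pos_pos sum_pos) (use fin in \<open>auto simp: boltzmann_weight_def card_gt_0_iff\<close>)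
  show Z: "measure_pmf.expectation (config_model N d) (partition_function \<beta> B N) =
      (\<Sum>\<sigma>\<in>spin_configs N. measure_pmf.expectation (config_model N d) (boltzmann_weight \<beta> B N \<sigma>))"
    unfolding expectation_config_model[OF n] partition_function_def
    by (simp add: sum_divide_distrib sum.swap[of _ "pairings ?X"])
  have Zpos: "measure_pmf.expectation (config_model N d) (partition_function \<beta> B N) > 0"
    unfolding Z by (intro sum_pos finite_spin_configs spin_configs_nonempty pos)
  show "annealed_prob \<beta> B N d \<sigma> \<ge> 0" for \<sigma>
    unfolding annealed_prob_def using pos[of \<sigma>] Zpos by simp
  show "(\<Sum>\<sigma>\<in>spin_configs N. annealed_prob \<beta> B N d \<sigma>) = 1"
    unfolding annealed_prob_def sum_divide_distrib[symmetric] Z[symmetric] using Zpos by simp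
qed

lemma integral_annealed_measure:
  fixes F :: "(nat \<Rightarrow> real) \<Rightarrow> 'b::{banach, second_countable_topology}"
  assumes n: "card (half_edges N d) = 2 * n"
  shows "(\<integral>\<sigma>. F \<sigma> \<partial>annealed_measure \<beta> B N d) = (\<Sum>\<sigma>\<in>spin_configs N. annealed_prob \<beta> B N d \<sigma> *\<^sub>R F \<sigma>)"
  unfolding annealed_measure_def
  by (rule lebesgue_integral_point_measure_finite)
     (use finite_spin_configs annealed_prob_nonneg_sum(1)[OF n] in auto)

lemma prob_space_annealed_measure:
  assumes n: "card (half_edges N d) = 2 * n"
  shows "prob_space (annealed_measure \<beta> B N d)"
proof
  show "emeasure (annealed_measure \<beta> B N d) (space (annealed_measure \<beta> B N d)) = 1"
    unfolding annealed_measure_def using annealed_prob_nonneg_sum(1,2)[OF n, of \<beta> B]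
    by (simp add: space_point_measure emeasure_point_measure_finite finite_spin_configs)
qed

lemma expectation_total_spin:
  fixes F :: "real \<Rightarrow> 'b::{banach, second_countable_topology}"
  assumes "\<beta> > 0" and n: "card (half_edges N d) = 2 * n"
  shows "(\<integral>\<sigma>. F (total_spin N \<sigma>) \<partial>annealed_measure \<beta> B N d) =
      (1 / (\<integral>w. spin_kernel \<beta> B N d (\<lambda>_. 1::real) w \<partial>lborel)) *\<^sub>R
      (\<integral>w. spin_kernel \<beta> B N d F w \<partial>lborel)"
proof -
  define J where "J \<sigma> w = (\<Prod>i\<in>{1..N}. exp (B * \<sigma> i) * (1 + \<sigma> i * w) ^ d i) / (tanh \<beta> + w\<^sup>2) ^ Suc n" for \<sigma> w
  have half: "(\<Sum>i\<in>{1..N}. d i) div 2 = n" using n by (simp add: card_half_edges)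
  have K: "spin_kernel \<beta> B N d F = (\<lambda>w. \<Sum>\<sigma>\<in>spin_configs N. J \<sigma> w *\<^sub>R F (total_spin N \<sigma>))"
    for F :: "real \<Rightarrow> 'c::real_normed_vector"
    unfolding spin_kernel_def half J_def by auto
  have J: "integrable lborel (J \<sigma>)" for \<sigma>
    unfolding J_def[abs_def] by (rule integrable_spin_weight) (use assms in auto)
  obtain C where C: "C > 0" and QC: "\<And>\<sigma>. \<sigma> \<in> spin_configs N \<Longrightarrow>
     measure_pmf.expectation (config_model N d) (boltzmann_weight \<beta> B N \<sigma>) = C * (\<integral>w. J \<sigma> w \<partial>lborel)"
    using expectation_boltzmann_weight[OF assms, of B] unfolding J_def by blast
  have intK: "(\<integral>w. spin_kernel \<beta> B N d F w \<partial>lborel) = (\<Sum>\<sigma>\<in>spin_configs N. (\<integral>w. J \<sigma> w \<partial>lborel) *\<^sub>R F (total_spin N \<sigma>))"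
    for F :: "real \<Rightarrow> 'c::{banach, second_countable_topology}"
    unfolding K by (subst Bochner_Integration.integral_sum) (use J in auto)
  have Z: "measure_pmf.expectation (config_model N d) (partition_function \<beta> B N) =
      C * (\<integral>w. spin_kernel \<beta> B N d (\<lambda>_. 1::real) w \<partial>lborel)"
    unfolding annealed_prob_nonneg_sum(3)[OF n] intK by (simp add: QC sum_distrib_left)
  show "(\<integral>\<sigma>. F (total_spin N \<sigma>) \<partial>annealed_measure \<beta> B N d) =
      (1 / (\<integral>w. spin_kernel \<beta> B N d (\<lambda>_. 1::real) w \<partial>lborel)) *\<^sub>R
      (\<integral>w. spin_kernel \<beta> B N d F w \<partial>lborel)"
    unfolding integral_annealed_measure[OF n] intK[of F] scaleR_sum_right
    by (intro sum.cong refl) (use C in \<open>simp add: annealed_prob_def QC Z\<close>)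
qed

lemma sum_spin_configs_prod:
  fixes g :: "nat \<Rightarrow> real \<Rightarrow> 'b::comm_semiring_1"
  shows "(\<Sum>\<sigma>\<in>spin_configs N. \<Prod>i\<in>{1..N}. g i (\<sigma> i)) = (\<Prod>i\<in>{1..N}. g i 1 + g i (- 1))"
  unfolding spin_configs_def by (subst prod_sum_PiE[symmetric]) (auto simp: add.commute)

section \<open>The free energy and its unique maximum\<close>

text \<open>The exponential rate of the mixture density at \<open>w = tanh h\<close>. In this coordinate, which is a
  field acting once on a leaf and twice on a vertex of degree 2, the powers of \<open>cosh h\<close> cancel.\<close>

definition free_energy :: "real \<Rightarrow> real \<Rightarrow> real \<Rightarrow> real \<Rightarrow> real" where
  "free_energy p \<beta> B h = (1 - p) * ln (cosh (B + h)) + p * ln (cosh (B + 2 * h))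
     - (1 + p) / 2 * ln (cosh (2 * h) - exp (- 2 * \<beta>))"

text \<open>The derivative of \<open>free_energy\<close> in \<open>h\<close>.\<close>

definition force :: "real \<Rightarrow> real \<Rightarrow> real \<Rightarrow> real \<Rightarrow> real" where
  "force p \<beta> B h = (1 - p) * tanh (B + h) + 2 * p * tanh (B + 2 * h)
     - (1 + p) * (sinh (2 * h) / (cosh (2 * h) - exp (- 2 * \<beta>)))"

text \<open>Minus the second derivative of \<open>free_energy\<close> in \<open>h\<close>.\<close>

definition stiffness :: "real \<Rightarrow> real \<Rightarrow> real \<Rightarrow> real \<Rightarrow> real" where
  "stiffness p \<beta> B h =
     2 * (1 + p) * (1 - exp (- 2 * \<beta>) * cosh (2 * h)) / (cosh (2 * h) - exp (- 2 * \<beta>))\<^sup>2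
     - (1 - p) * (1 - (tanh (B + h))\<^sup>2) - 4 * p * (1 - (tanh (B + 2 * h))\<^sup>2)"

text \<open>The mean spin per vertex when the spins are independent in the field \<open>h\<close>; also the derivative
  of \<open>free_energy\<close> in \<open>B\<close>.\<close>

definition spin_density :: "real \<Rightarrow> real \<Rightarrow> real \<Rightarrow> real" where
  "spin_density p B h = (1 - p) * tanh (B + h) + p * tanh (B + 2 * h)"

text \<open>The mixed second derivative of \<open>free_energy\<close> in \<open>B\<close> and \<open>h\<close>.\<close>

definition susceptibility :: "real \<Rightarrow> real \<Rightarrow> real \<Rightarrow> real" where
  "susceptibility p B h = (1 - p) * (1 - (tanh (B + h))\<^sup>2) + 2 * p * (1 - (tanh (B + 2 * h))\<^sup>2)"

text \<open>The variance per vertex when the spins are independent in the field \<open>h\<close>; also the second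
  derivative of \<open>free_energy\<close> in \<open>B\<close>.\<close>

definition spin_variance :: "real \<Rightarrow> real \<Rightarrow> real \<Rightarrow> real" where
  "spin_variance p B h = (1 - p) * (1 - (tanh (B + h))\<^sup>2) + p * (1 - (tanh (B + 2 * h))\<^sup>2)"

lemma cosh_minus_exp_pos:
  fixes \<beta> x :: real
  assumes "\<beta> > 0" shows "cosh x - exp (- 2 * \<beta>) > 0"
  using cosh_real_ge_1[of x] assms by (smt (verit) exp_less_one_iff)

lemma cosh_neq_0_real: "cosh (x::real) \<noteq> 0"
  using cosh_real_pos[of x] by simp

lemma free_energy_deriv:
  assumes "\<beta> > 0"
  shows "(free_energy p \<beta> B has_real_derivative force p \<beta> B h) (at h)"
proof -
  define u where "u = cosh (2 * h) - exp (- 2 * \<beta>)"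
  have u: "u > 0" using cosh_minus_exp_pos[OF assms] by (simp add: u_def)
  have 1: "((\<lambda>h. ln (cosh (B + c * h))) has_real_derivative c * tanh (B + c * h)) (at h)" for c
    by (auto intro!: derivative_eq_intros simp: tanh_def)
  have 2: "((\<lambda>h. ln (cosh (2 * h) - exp (- 2 * \<beta>))) has_real_derivative 2 * (sinh (2 * h) / u)) (at h)"
    using u unfolding u_def by (auto intro!: derivative_eq_intros)
  have "(free_energy p \<beta> B has_real_derivative (1 - p) * (1 * tanh (B + 1 * h))
      + p * (2 * tanh (B + 2 * h)) - (1 + p) / 2 * (2 * (sinh (2 * h) / u))) (at h)"
    using 1[of 1] unfolding free_energy_def[abs_def]
    by (intro DERIV_diff DERIV_add DERIV_cmult 1 2) simp
  then show ?thesis by (simp add: force_def u_def mult.assoc mult.left_commute)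
qed

lemma force_deriv:
  assumes "\<beta> > 0"
  shows "(force p \<beta> B has_real_derivative - stiffness p \<beta> B h) (at h)"
proof -
  define u where "u = cosh (2 * h) - exp (- 2 * \<beta>)"
  have u: "u > 0" using cosh_minus_exp_pos[OF assms] by (simp add: u_def)
  have sq: "(sinh (2 * h))\<^sup>2 = (cosh (2 * h))\<^sup>2 - 1" by (simp add: sinh_square_eq)
  have "(force p \<beta> B has_real_derivative (1 - p) * (1 - (tanh (B + h))\<^sup>2) + 4 * p * (1 - (tanh (B + 2 * h))\<^sup>2)
     - (1 + p) * ((2 * cosh (2 * h) * u - sinh (2 * h) * (2 * sinh (2 * h))) / (u * u))) (at h)"
  proof -
    have 1: "((\<lambda>h. tanh (B + c * h)) has_real_derivative c * (1 - (tanh (B + c * h))\<^sup>2)) (at h)" for c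
      by (auto intro!: derivative_eq_intros simp: cosh_neq_0_real)
    have 2: "((\<lambda>h. sinh (2 * h) / (cosh (2 * h) - exp (- 2 * \<beta>))) has_real_derivative
        (2 * cosh (2 * h) * u - sinh (2 * h) * (2 * sinh (2 * h))) / (u * u)) (at h)"
    proof -
      have "((\<lambda>h. sinh (2 * h)) has_real_derivative 2 * cosh (2 * h)) (at h)"
        "((\<lambda>h. cosh (2 * h) - exp (- 2 * \<beta>)) has_real_derivative 2 * sinh (2 * h)) (at h)"
        by (auto intro!: derivative_eq_intros)
      from DERIV_divide[OF this] show ?thesis using u by (simp add: u_def)
    qed
    have "(force p \<beta> B has_real_derivative (1 - p) * (1 * (1 - (tanh (B + 1 * h))\<^sup>2)) +
       2 * p * (2 * (1 - (tanh (B + 2 * h))\<^sup>2))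
       - (1 + p) * ((2 * cosh (2 * h) * u - sinh (2 * h) * (2 * sinh (2 * h))) / (u * u))) (at h)"
      using 1[of 1] unfolding force_def[abs_def]
      by (intro DERIV_diff DERIV_add DERIV_cmult 1 2) simp
    then show ?thesis by (simp add: algebra_simps)
  qed
  moreover have "2 * cosh (2 * h) * u - sinh (2 * h) * (2 * sinh (2 * h)) = 2 * (1 - exp (- 2 * \<beta>) * cosh (2 * h))"
    using sq by (simp add: u_def power2_eq_square algebra_simps)
  moreover have "(1 - p) * (1 - (tanh (B + h))\<^sup>2) + 4 * p * (1 - (tanh (B + 2 * h))\<^sup>2)
     - (1 + p) * ((2 * (1 - exp (- 2 * \<beta>) * cosh (2 * h))) / (u * u)) = - stiffness p \<beta> B h"
    unfolding stiffness_def u_def[symmetric] using u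
    by (simp add: power2_eq_square divide_simps) (simp add: algebra_simps)
  ultimately show ?thesis by simp
qed

lemma force_minus: "force p \<beta> (- B) (- h) = - force p \<beta> B h"
proof -
  have "- B - h = - (B + h)" "- B - 2 * h = - (B + 2 * h)" by simp_all
  then show ?thesis unfolding force_def
    by (simp only: tanh_minus sinh_minus cosh_minus mult_minus_right add_uminus_conv_diff)
qed

lemma stiffness_minus: "stiffness p \<beta> (- B) (- h) = stiffness p \<beta> B h"
proof -
  have "- B - h = - (B + h)" "- B - 2 * h = - (B + 2 * h)" by simp_all
  then show ?thesis unfolding stiffness_def by (simp only: tanh_minus sinh_minus cosh_minus mult_minus_right add_uminus_conv_diff power2_minus)
qed

text \<open>For \<open>h < 0 \<le> B\<close> the two hyperbolic tangents exceed \<open>tanh (2 h)\<close>, while the remaining term is below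
  it because \<open>exp (- 2 \<beta>) > 0\<close> shrinks the denominator.\<close>

lemma force_zero_nonneg:
  assumes p: "0 < p" "p < 1" and \<beta>: "\<beta> > 0" and B: "B \<ge> 0" and z: "force p \<beta> B h = 0"
  shows "h \<ge> 0"
proof (rule ccontr)
  assume "\<not> h \<ge> 0"
  then have h: "h < 0" by simp
  define u where "u = cosh (2 * h) - exp (- 2 * \<beta>)"
  have u: "0 < u" "u < cosh (2 * h)" using cosh_minus_exp_pos[OF \<beta>] by (simp_all add: u_def)
  have s: "sinh (2 * h) < 0" using h by simp
  have 1: "sinh (2 * h) / u < tanh (2 * h)"
    unfolding tanh_def using u s by (simp add: divide_strict_left_mono_neg)
  have 2: "tanh (2 * h) \<le> tanh (B + 2 * h)" using B by simp
  have 3: "tanh (2 * h) \<le> tanh (B + h)" using B h by simp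
  have "(1 - p) * tanh (2 * h) \<le> (1 - p) * tanh (B + h)" "2 * p * tanh (2 * h) \<le> 2 * p * tanh (B + 2 * h)"
    using p 2 3 by (auto intro: mult_left_mono)
  moreover have "(1 + p) * (sinh (2 * h) / u) < (1 + p) * tanh (2 * h)" using 1 p by (intro mult_strict_left_mono) auto
  ultimately have "force p \<beta> B h > 0" unfolding force_def u_def[symmetric] by (simp add: algebra_simps)
  then show False using z by simp
qed

text \<open>At a zero of the force, \<open>T = (1 - p) a + 2 p b\<close> (with \<open>a = tanh (B + h)\<close> and \<open>b = tanh (B + 2 h)\<close>)
  satisfies \<open>T = (1 + p) sinh (2 h) / (cosh (2 h) - exp (- 2 \<beta>))\<close>. This eliminates \<open>\<beta>\<close> from the
  stiffness, which becomes a quadratic polynomial in \<open>T\<close>. Expanding \<open>T\<^sup>2\<close> as a variance identity leaves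
  the positive term \<open>(b - a)\<^sup>2\<close> and two terms that are nonnegative by the addition theorems for
  \<open>sinh (2 B)\<close> and \<open>sinh B\<close>.\<close>

lemma stiffness_pos_nonneg_field:
  assumes p: "0 < p" "p < 1" and \<beta>: "\<beta> > 0" and B: "B \<ge> 0" and z: "force p \<beta> B h = 0"
  shows "stiffness p \<beta> B h > 0"
proof (cases "h = 0")
  case True
  have B0: "B = 0"
  proof (rule ccontr)
    assume "B \<noteq> 0"
    then have "tanh B > 0" using B by simp
    then have "(1 - p) * tanh B + 2 * p * tanh B > 0" using p by (simp add: add_pos_pos)
    then show False using z True by (simp add: force_def)
  qed
  define \<rho> where "\<rho> = exp (- 2 * \<beta>)"
  have \<rho>: "0 < \<rho>" "\<rho> < 1" using \<beta> by (simp_all add: \<rho>_def)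
  have "2 * (1 + p) * (1 - \<rho>) / (1 - \<rho>)\<^sup>2 = 2 * (1 + p) / (1 - \<rho>)"
    using \<rho> by (simp add: power2_eq_square)
  also have "\<dots> > 2 * (1 + p)" using \<rho> p by (simp add: less_divide_eq)
  finally show ?thesis using True B0 p by (simp add: stiffness_def \<rho>_def)
next
  case False
  then have h: "h > 0" using force_zero_nonneg[OF assms] by simp
  define C where "C = cosh (2 * h)"
  define S where "S = sinh (2 * h)"
  define u where "u = C - exp (- 2 * \<beta>)"
  define a where "a = tanh (B + h)"
  define b where "b = tanh (B + 2 * h)"
  define T where "T = (1 - p) * a + 2 * p * b"
  have u: "u > 0" using cosh_minus_exp_pos[OF \<beta>] by (simp add: u_def C_def)
  have S: "S > 0" using h by (simp add: S_def)
  have CS: "C\<^sup>2 = 1 + S\<^sup>2" by (simp add: C_def S_def cosh_square_eq)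
  have T: "T * u = (1 + p) * S"
    using z u by (simp add: force_def T_def a_def b_def u_def C_def S_def field_simps)
  have ab: "a < b" using h by (simp add: a_def b_def)
  have A: "2 * C * a - S * (1 + a\<^sup>2) \<ge> 0"
  proof -
    define x y where "x = cosh (B + h)" and "y = sinh (B + h)"
    have x: "x > 0" by (simp add: x_def)
    have "sinh (2 * (B + h) - 2 * h) = sinh (2 * (B + h)) * C - cosh (2 * (B + h)) * S"
      unfolding C_def S_def by (rule sinh_diff)
    also have "\<dots> = 2 * y * x * C - (x\<^sup>2 + y\<^sup>2) * S"
      by (simp only: sinh_double cosh_double x_def y_def)
    finally have "sinh (2 * B) = 2 * y * x * C - (x\<^sup>2 + y\<^sup>2) * S" by simp
    moreover have "sinh (2 * B) \<ge> 0" using B by simp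
    ultimately have "2 * y * x * C - (x\<^sup>2 + y\<^sup>2) * S \<ge> 0" by simp
    then have "(2 * y * x * C - (x\<^sup>2 + y\<^sup>2) * S) / x\<^sup>2 \<ge> 0" by simp
    moreover have "(2 * y * x * C - (x\<^sup>2 + y\<^sup>2) * S) / x\<^sup>2 = 2 * C * (y / x) - S * (1 + (y / x)\<^sup>2)"
      using x by (simp add: field_simps power2_eq_square)
    moreover have "a = y / x" by (simp add: a_def x_def y_def tanh_def)
    ultimately show ?thesis by simp
  qed
  have Bb: "C * b - S \<ge> 0"
  proof -
    define x y where "x = cosh (B + 2 * h)" and "y = sinh (B + 2 * h)"
    have x: "x > 0" by (simp add: x_def)
    have "sinh (B + 2 * h - 2 * h) = y * C - x * S"
      unfolding C_def S_def x_def y_def by (rule sinh_diff)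
    then have "sinh B = y * C - x * S" by simp
    moreover have "sinh B \<ge> 0" using B by simp
    ultimately have "y * C - x * S \<ge> 0" by simp
    then have "(y * C - x * S) / x \<ge> 0" using x by simp
    moreover have "b = y / x" by (simp add: b_def x_def y_def tanh_def)
    moreover have "(y * C - x * S) / x = C * (y / x) - S" using x by (simp add: field_simps)
    ultimately show ?thesis by simp
  qed
  have "0 < S * (2 * (1 - p) * (2 * p) * (b - a)\<^sup>2)" using S p ab by simp
  also have "\<dots> \<le> (1 + p) * (1 - p) * (2 * C * a - S * (1 + a\<^sup>2)) + (1 + p) * (2 * p) * 2 * (C * b - S)
      + S * (2 * (1 - p) * (2 * p) * (b - a)\<^sup>2)"
    using A Bb p by simp
  also have "\<dots> = (1 + p) * (2 * C * T) - 2 * S * T\<^sup>2 - (1 + p) * S * ((1 - p) * (1 - a\<^sup>2) + 4 * p * (1 - b\<^sup>2))"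
    unfolding T_def by (simp add: power2_eq_square algebra_simps)
  finally have main: "(1 + p) * S * ((1 - p) * (1 - a\<^sup>2) + 4 * p * (1 - b\<^sup>2)) < (1 + p) * (2 * C * T) - 2 * S * T\<^sup>2" by simp
  have "(1 + p) * S * (2 * (1 + p) * (1 - exp (- 2 * \<beta>) * C) / u\<^sup>2) = (1 + p) * (2 * C * T) - 2 * S * T\<^sup>2"
  proof -
    have e: "1 - exp (- 2 * \<beta>) * C = C * u - S\<^sup>2"
      using CS by (simp add: u_def power2_eq_square algebra_simps)
    have T': "T = (1 + p) * S / u" using T u by (simp add: field_simps)
    show ?thesis unfolding e T' using u by (simp add: field_simps power2_eq_square)
  qed
  with main have "(1 + p) * S * ((1 - p) * (1 - a\<^sup>2) + 4 * p * (1 - b\<^sup>2))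
      < (1 + p) * S * (2 * (1 + p) * (1 - exp (- 2 * \<beta>) * C) / u\<^sup>2)" by simp
  then have "(1 - p) * (1 - a\<^sup>2) + 4 * p * (1 - b\<^sup>2) < 2 * (1 + p) * (1 - exp (- 2 * \<beta>) * C) / u\<^sup>2"
    by (rule mult_less_cancel_left_pos[THEN iffD1, rotated]) (use S p in simp)
  then show ?thesis unfolding stiffness_def a_def b_def u_def C_def by simp
qed

lemma stiffness_pos:
  assumes p: "0 < p" "p < 1" and \<beta>: "\<beta> > 0" and z: "force p \<beta> B h = 0"
  shows "stiffness p \<beta> B h > 0"
proof (cases "B \<ge> 0")
  case True
  then show ?thesis using stiffness_pos_nonneg_field assms by blast
next
  case False
  then have "stiffness p \<beta> (- B) (- h) > 0"
    by (intro stiffness_pos_nonneg_field) (use assms force_minus in auto)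
  then show ?thesis by (simp only: stiffness_minus)
qed

text \<open>If \<open>f\<close> crosses every zero downwards, it cannot come back: at the first return to 0 the derivative
  would be nonnegative. So \<open>f\<close> has at most one zero.\<close>

lemma negative_after_nonpositive:
  fixes f f' :: "real \<Rightarrow> real"
  assumes deriv: "\<And>x. (f has_real_derivative f' x) (at x)" and dec: "\<And>x. f x = 0 \<Longrightarrow> f' x < 0"
    and "f x \<le> 0" "x < y"
  shows "f y < 0"
proof (rule ccontr)
  assume "\<not> f y < 0"
  then have fy: "f y \<ge> 0" by simp
  have cont: "continuous_on S f" for S
    by (rule DERIV_continuous_on[OF has_field_derivative_at_within]) (rule deriv)
  have "\<exists>x'. x \<le> x' \<and> x' < y \<and> f x' < 0"
  proof (cases "f x = 0")
    case True
    then obtain d where d: "d > 0" "\<And>e. 0 < e \<Longrightarrow> e < d \<Longrightarrow> f (x + e) < f x"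
      using DERIV_neg_dec_right[OF deriv dec] by blast
    define e where "e = min (d / 2) ((y - x) / 2)"
    have e: "0 < e" "e < d" "x + e < y" using d \<open>x < y\<close> by (auto simp: e_def min_def field_simps)
    then show ?thesis using d(2)[of e] True by (intro exI[of _ "x + e"]) auto
  qed (use assms in auto)
  then obtain x' where x': "x' < y" "f x' < 0" by auto
  define Z where "Z = {x'..y} \<inter> f -` {0..}"
  have "closed Z" unfolding Z_def by (intro continuous_closed_preimage cont) auto
  moreover have yZ: "y \<in> Z" using x' fy by (simp add: Z_def)
  moreover have bb: "bdd_below Z" by (auto simp: Z_def intro: bdd_below_mono[of "{x'..y}"])
  ultimately have c: "Inf Z \<in> Z" using closed_contains_Inf by blast
  define c where "c = Inf Z"
  have below: "f z < 0" if "x' \<le> z" "z < c" for z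
  proof (rule ccontr)
    assume "\<not> f z < 0"
    then have "z \<in> Z" using that c by (auto simp: Z_def c_def)
    then have "c \<le> z" unfolding c_def by (intro cInf_lower bb)
    then show False using that by simp
  qed
  have cZ: "x' \<le> c" "f c \<ge> 0" using c by (auto simp: Z_def c_def)
  then have xc: "x' < c" using x' by (cases "x' = c") auto
  have "f c = 0"
  proof (rule ccontr)
    assume "f c \<noteq> 0"
    then have "f c > 0" using cZ by simp
    then obtain z where "x' \<le> z" "z \<le> c" "f z = 0"
      using IVT'[of f x' 0 c] x' xc cont by auto
    then show False using below[of z] \<open>f c \<noteq> 0\<close> by (cases "z = c") auto
  qed
  then obtain d where d: "d > 0" "\<And>e. 0 < e \<Longrightarrow> e < d \<Longrightarrow> f c < f (c - e)"
    using DERIV_neg_dec_left[OF deriv dec] by blast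
  define e where "e = min (d / 2) (c - x')"
  have e: "0 < e" "e < d" "x' \<le> c - e" using d xc by (auto simp: e_def min_def)
  then show False using d(2)[of e] below[of "c - e"] \<open>f c = 0\<close> by auto
qed

text \<open>Beyond \<open>\<beta>\<close> the last quotient in the force is at least 1, which dominates the tangents. With the
  symmetry \<open>force_minus\<close> this confines the zero of the force to \<open>[-\<beta>, \<beta>]\<close>.\<close>

lemma force_neg_outside:
  assumes p: "0 < p" "p < 1" and \<beta>: "\<beta> > 0" and h: "h \<ge> \<beta>"
  shows "force p \<beta> B h < 0"
proof -
  have "exp (- (2 * h)) \<le> exp (- 2 * \<beta>)" using h by simp
  moreover have "cosh (2 * h) - sinh (2 * h) = exp (- (2 * h))" by (simp add: cosh_minus_sinh)
  ultimately have "cosh (2 * h) - exp (- 2 * \<beta>) \<le> sinh (2 * h)" by linarith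
  then have "sinh (2 * h) / (cosh (2 * h) - exp (- 2 * \<beta>)) \<ge> 1"
    using cosh_minus_exp_pos[OF \<beta>, of "2 * h"] by simp
  from mult_left_mono[OF this, of "1 + p"]
  have "(1 + p) * (sinh (2 * h) / (cosh (2 * h) - exp (- 2 * \<beta>))) \<ge> 1 + p" using p by simp
  moreover have "(1 - p) * tanh (B + h) < (1 - p) * 1" "2 * p * tanh (B + 2 * h) < 2 * p * 1"
    using p tanh_real_lt_1 by (auto intro!: mult_strict_left_mono)
  ultimately show ?thesis by (simp add: force_def)
qed

lemma force_ex1:
  assumes p: "0 < p" "p < 1" and \<beta>: "\<beta> > 0"
  shows "\<exists>!h. force p \<beta> B h = 0"
proof -
  have c: "continuous_on {-\<beta>..\<beta>} (force p \<beta> B)"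
    by (rule DERIV_continuous_on[OF has_field_derivative_at_within]) (rule force_deriv[OF \<beta>])
  have "force p \<beta> B \<beta> < 0" by (rule force_neg_outside) (use assms in auto)
  moreover have "force p \<beta> (- B) \<beta> < 0" by (rule force_neg_outside) (use assms in auto)
  then have "force p \<beta> B (- \<beta>) > 0" using force_minus[of p \<beta> B "- \<beta>"] by simp
  ultimately have "\<exists>h. force p \<beta> B h = 0"
    using IVT2'[of "force p \<beta> B" \<beta> 0 "- \<beta>"] c \<beta> by auto
  moreover have "h = h'" if "force p \<beta> B h = 0" "force p \<beta> B h' = 0" for h h'
  proof -
    have neg: "force p \<beta> B y < 0" if "force p \<beta> B x \<le> 0" "x < y" for x y
      by (rule negative_after_nonpositive[OF force_deriv[OF \<beta>] _ that]) (use stiffness_pos assms in auto)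
    show ?thesis using neg[of h h'] neg[of h' h] that by (cases h h' rule: linorder_cases) auto
  qed
  ultimately show ?thesis by blast
qed

definition cavity_field :: "real \<Rightarrow> real \<Rightarrow> real \<Rightarrow> real" where
  "cavity_field p \<beta> B = (THE h. force p \<beta> B h = 0)"

lemma force_sign:
  assumes p: "0 < p" "p < 1" and \<beta>: "\<beta> > 0"
  shows force_cavity_field: "force p \<beta> B (cavity_field p \<beta> B) = 0"
    and force_pos: "h < cavity_field p \<beta> B \<Longrightarrow> force p \<beta> B h > 0"
    and force_neg: "h > cavity_field p \<beta> B \<Longrightarrow> force p \<beta> B h < 0"
    and cavity_field_eqI: "force p \<beta> B h = 0 \<Longrightarrow> cavity_field p \<beta> B = h"
proof -
  have neg: "force p \<beta> B y < 0" if "force p \<beta> B x \<le> 0" "x < y" for x y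
    by (rule negative_after_nonpositive[OF force_deriv[OF \<beta>] _ that]) (use stiffness_pos assms in auto)
  show z: "force p \<beta> B (cavity_field p \<beta> B) = 0"
    unfolding cavity_field_def using force_ex1[OF assms] by (rule theI')
  show "h < cavity_field p \<beta> B \<Longrightarrow> force p \<beta> B h > 0"
    using neg[of h "cavity_field p \<beta> B"] z by force
  show "h > cavity_field p \<beta> B \<Longrightarrow> force p \<beta> B h < 0"
    using neg[of "cavity_field p \<beta> B" h] z by force
  show "force p \<beta> B h = 0 \<Longrightarrow> cavity_field p \<beta> B = h"
    using z force_ex1[OF assms] by blast
qed

lemma free_energy_strict_mono:
  assumes p: "0 < p" "p < 1" and \<beta>: "\<beta> > 0"
  shows "x < y \<Longrightarrow> y \<le> cavity_field p \<beta> B \<Longrightarrow> free_energy p \<beta> B x < free_energy p \<beta> B y"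
    and "cavity_field p \<beta> B \<le> x \<Longrightarrow> x < y \<Longrightarrow> free_energy p \<beta> B y < free_energy p \<beta> B x"
proof -
  have c: "continuous_on S (free_energy p \<beta> B)" for S
    by (rule DERIV_continuous_on[OF has_field_derivative_at_within]) (rule free_energy_deriv[OF \<beta>])
  show "free_energy p \<beta> B x < free_energy p \<beta> B y" if "x < y" "y \<le> cavity_field p \<beta> B"
    by (rule DERIV_pos_imp_increasing_open[OF that(1) _ c])
       (use free_energy_deriv[OF \<beta>] force_pos[OF assms] that in force)
  show "free_energy p \<beta> B y < free_energy p \<beta> B x" if "cavity_field p \<beta> B \<le> x" "x < y"
    by (rule DERIV_neg_imp_decreasing_open[OF that(2) _ c])
       (use free_energy_deriv[OF \<beta>] force_neg[OF assms] that in force)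
qed

text \<open>The zero is trapped between \<open>h\<^sup>* - e\<close> and \<open>h\<^sup>* + e\<close>, where the force has strict signs that persist
  for nearby \<open>B\<close>.\<close>

lemma continuous_cavity_field:
  assumes p: "0 < p" "p < 1" and \<beta>: "\<beta> > 0"
  shows "isCont (cavity_field p \<beta>) B"
  unfolding isCont_def tendsto_iff
proof (intro allI impI)
  fix e :: real assume e: "e > 0"
  let ?h = "cavity_field p \<beta> B"
  have c: "((\<lambda>b. force p \<beta> b h) \<longlongrightarrow> force p \<beta> B h) (at B)" for h
    unfolding force_def by (intro tendsto_intros) (auto simp: cosh_neq_0_real)
  have "force p \<beta> B (?h - e) > 0" by (rule force_pos) (use assms e in auto)
  with c have 1: "\<forall>\<^sub>F b in at B. force p \<beta> b (?h - e) > 0" by (rule order_tendstoD)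
  have "force p \<beta> B (?h + e) < 0" by (rule force_neg) (use assms e in auto)
  with c have 2: "\<forall>\<^sub>F b in at B. force p \<beta> b (?h + e) < 0" by (rule order_tendstoD)
  from 1 2 show "\<forall>\<^sub>F b in at B. dist (cavity_field p \<beta> b) ?h < e"
  proof eventually_elim
    case (elim b)
    have "?h - e < cavity_field p \<beta> b"
      using elim(1) force_neg[OF assms, of b "?h - e"] force_cavity_field[OF assms, of b]
      by (smt (verit))
    moreover have "cavity_field p \<beta> b < ?h + e"
      using elim(2) force_pos[OF assms, of "?h + e" b] force_cavity_field[OF assms, of b]
      by (smt (verit))
    ultimately show ?case by (simp add: dist_real_def abs_less_iff)
  qed
qed

section \<open>Derivatives of the maximal free energy\<close>

text \<open>The implicit function theorem in the form needed here: the implicit function is already known to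
  exist and to be continuous, so only its derivative is at stake.\<close>

lemma implicit_function_deriv:
  fixes F :: "real \<Rightarrow> real \<Rightarrow> real"
  assumes F: "((\<lambda>z. F (fst z) (snd z)) has_derivative (\<lambda>z. a * fst z - g * snd z)) (at (b, y b))"
    and g: "g > 0" and cont: "isCont y b" and zero: "\<And>t. F t (y t) = 0"
  shows "(y has_real_derivative a / g) (at b)"
  unfolding has_field_derivative_def has_derivative_at_alt
proof (intro conjI allI impI)
  show "bounded_linear ((*) (a / g))" by (rule bounded_linear_mult_right)
  fix e :: real assume e: "e > 0"
  \<comment> \<open>The bound \<open>\<eta> \<le> g / 2\<close> makes \<open>y\<close> Lipschitz at \<open>b\<close> with constant \<open>K - 1\<close>, so that \<open>K * |t - b|\<close>
    dominates both coordinates of the increment; the other bound then gives the error \<open>e\<close>.\<close>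
  define K where "K = 1 + (2 * \<bar>a\<bar> / g + 1)"
  have den: "K > 0" using g by (simp add: K_def add_pos_nonneg)
  define \<eta> where "\<eta> = min (g / 2) (e * g / (4 * K))"
  have \<eta>: "\<eta> > 0" using g e den by (simp add: \<eta>_def)
  obtain d where d: "d > 0" and D: "\<And>z. norm (z - (b, y b)) < d \<Longrightarrow>
      norm (F (fst z) (snd z) - F (fst (b, y b)) (snd (b, y b)) - (a * fst (z - (b, y b)) - g * snd (z - (b, y b))))
        \<le> \<eta> * norm (z - (b, y b))"
    using F \<eta> unfolding has_derivative_at_alt by blast
  obtain d' where d': "d' > 0" and D': "\<And>t. \<bar>t - b\<bar> < d' \<Longrightarrow> \<bar>y t - y b\<bar> < d / 2"
    using cont d unfolding continuous_at_eps_delta by (metis dist_real_def half_gt_zero)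
  show "\<exists>d>0. \<forall>t. norm (t - b) < d \<longrightarrow> norm (y t - y b - a / g * (t - b)) \<le> e * norm (t - b)"
  proof (intro exI[of _ "min (d / 2) d'"] conjI allI impI)
    show "min (d / 2) d' > 0" using d d' by simp
    fix t assume t: "norm (t - b) < min (d / 2) d'"
    define x where "x = t - b"
    define w where "w = y t - y b"
    have xw: "\<bar>x\<bar> < d / 2" "\<bar>w\<bar> < d / 2" using t D'[of t] by (auto simp: x_def w_def)
    have n: "norm (x, w) \<le> \<bar>x\<bar> + \<bar>w\<bar>" using norm_Pair_le[of x w] by simp
    have "\<bar>a * x - g * w\<bar> \<le> \<eta> * norm (x, w)"
      using D[of "(t, y t)"] n xw by (simp add: x_def w_def zero)
    also have "\<dots> \<le> \<eta> * (\<bar>x\<bar> + \<bar>w\<bar>)" using \<eta> n by simp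
    finally have est: "\<bar>a * x - g * w\<bar> \<le> \<eta> * \<bar>x\<bar> + \<eta> * \<bar>w\<bar>" by (simp add: distrib_left)
    have "g * \<bar>w\<bar> \<le> \<bar>a\<bar> * \<bar>x\<bar> + \<bar>a * x - g * w\<bar>"
    proof -
      have "g * \<bar>w\<bar> = \<bar>g * w\<bar>" using g by (simp add: abs_mult)
      also have "\<dots> \<le> \<bar>a * x\<bar> + \<bar>a * x - g * w\<bar>" by linarith
      finally show ?thesis by (simp add: abs_mult)
    qed
    also have "\<dots> \<le> \<bar>a\<bar> * \<bar>x\<bar> + (g / 2 * \<bar>x\<bar> + g / 2 * \<bar>w\<bar>)"
    proof -
      have "\<eta> \<le> g / 2" unfolding \<eta>_def by (rule min.cobounded1)
      then have "\<eta> * \<bar>x\<bar> \<le> g / 2 * \<bar>x\<bar>" "\<eta> * \<bar>w\<bar> \<le> g / 2 * \<bar>w\<bar>"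
        using mult_right_mono[of \<eta> "g / 2" "\<bar>x\<bar>"] mult_right_mono[of \<eta> "g / 2" "\<bar>w\<bar>"] by simp_all
      then show ?thesis using est by linarith
    qed
    finally have "g * \<bar>w\<bar> \<le> (2 * \<bar>a\<bar> + g) * \<bar>x\<bar>" by (simp add: algebra_simps)
    then have w: "\<bar>w\<bar> \<le> (2 * \<bar>a\<bar> / g + 1) * \<bar>x\<bar>" using g by (simp add: field_simps)
    have "\<eta> * \<bar>x\<bar> + \<eta> * \<bar>w\<bar> \<le> \<eta> * \<bar>x\<bar> + \<eta> * ((2 * \<bar>a\<bar> / g + 1) * \<bar>x\<bar>)"
      using w \<eta> by simp
    also have "\<dots> = \<eta> * K * \<bar>x\<bar>" by (simp add: K_def algebra_simps)
    also have "\<dots> \<le> e * g * \<bar>x\<bar>"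
    proof (rule mult_right_mono)
      have "\<eta> * K \<le> e * g / (4 * K) * K"
        by (rule mult_right_mono) (use den in \<open>auto simp: \<eta>_def\<close>)
      also have "\<dots> = e * g / 4" using den by simp
      also have "\<dots> \<le> e * g" using e g by simp
      finally show "\<eta> * K \<le> e * g" .
    qed simp
    finally have "\<bar>a * x - g * w\<bar> \<le> g * (e * \<bar>x\<bar>)" using est by (simp add: mult_ac)
    moreover have "\<bar>a * x - g * w\<bar> = g * \<bar>w - a / g * x\<bar>"
    proof -
      have "a * x - g * w = g * (a / g * x - w)" using g by (simp add: algebra_simps)
      then have "\<bar>a * x - g * w\<bar> = g * \<bar>a / g * x - w\<bar>" using g by (simp add: abs_mult)
      then show ?thesis by (simp add: abs_minus_commute)
    qed
    ultimately show "norm (y t - y b - a / g * (t - b)) \<le> e * norm (t - b)"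
      using g by (simp add: w_def x_def)
  qed
qed

lemma cavity_field_deriv:
  assumes p: "0 < p" "p < 1" and \<beta>: "\<beta> > 0"
  shows "(cavity_field p \<beta> has_real_derivative
     susceptibility p B (cavity_field p \<beta> B) / stiffness p \<beta> B (cavity_field p \<beta> B)) (at B)"
proof (rule implicit_function_deriv[where F="force p \<beta>"])
  let ?h = "cavity_field p \<beta> B"
  show "stiffness p \<beta> B ?h > 0" using stiffness_pos[OF assms] force_cavity_field[OF assms] by blast
  show "isCont (cavity_field p \<beta>) B" by (rule continuous_cavity_field[OF assms])
  show "force p \<beta> t (cavity_field p \<beta> t) = 0" for t by (rule force_cavity_field[OF assms])
  define X where "X h = sinh (2 * h) / (cosh (2 * h) - exp (- 2 * \<beta>))" for h
  define X' where "X' = 2 * (1 - exp (- 2 * \<beta>) * cosh (2 * ?h)) / (cosh (2 * ?h) - exp (- 2 * \<beta>))\<^sup>2"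
  have X: "(X has_derivative (\<lambda>t. X' * t)) (at ?h)"
  proof -
    have "(force 0 \<beta> B has_real_derivative - stiffness 0 \<beta> B ?h) (at ?h)"
      by (rule force_deriv[OF \<beta>])
    then have "((\<lambda>h. tanh (B + h) - force 0 \<beta> B h) has_real_derivative
        (1 - (tanh (B + ?h))\<^sup>2) - (- stiffness 0 \<beta> B ?h)) (at ?h)"
      by (auto intro!: derivative_eq_intros simp: cosh_neq_0_real)
    also have "(\<lambda>h. tanh (B + h) - force 0 \<beta> B h) = X" by (simp add: force_def X_def fun_eq_iff)
    finally have "(X has_real_derivative X') (at ?h)" by (simp add: stiffness_def X'_def)
    then show ?thesis by (simp only: has_field_derivative_def)
  qed
  have T: "((\<lambda>z::real \<times> real. tanh (fst z + c * snd z)) has_derivative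
      (\<lambda>z. (1 - (tanh (B + c * ?h))\<^sup>2) * (fst z + c * snd z))) (at (B, ?h))" for c
  proof -
    have "(tanh has_real_derivative (1 - (tanh (B + c * ?h))\<^sup>2)) (at (fst (B, ?h) + c * snd (B, ?h)))"
      by (auto intro!: derivative_eq_intros simp: cosh_neq_0_real)
    then have "(tanh has_derivative (\<lambda>t. (1 - (tanh (B + c * ?h))\<^sup>2) * t)) (at (fst (B, ?h) + c * snd (B, ?h)))"
      by (simp only: has_field_derivative_def)
    moreover have "((\<lambda>z::real \<times> real. fst z + c * snd z) has_derivative (\<lambda>z. fst z + c * snd z)) (at (B, ?h))"
      by (auto intro!: derivative_eq_intros)
    ultimately show ?thesis by (rule has_derivative_compose[rotated])
  qed
  have X2: "((\<lambda>z::real \<times> real. X (snd z)) has_derivative (\<lambda>z. X' * snd z)) (at (B, ?h))"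
    by (rule has_derivative_compose[where f=snd and g=X]) (use X in \<open>auto intro!: derivative_eq_intros\<close>)
  have "((\<lambda>z::real \<times> real. (1 - p) * tanh (fst z + 1 * snd z) + 2 * p * tanh (fst z + 2 * snd z) - (1 + p) * X (snd z))
     has_derivative (\<lambda>z. (1 - p) * ((1 - (tanh (B + 1 * ?h))\<^sup>2) * (fst z + 1 * snd z))
        + 2 * p * ((1 - (tanh (B + 2 * ?h))\<^sup>2) * (fst z + 2 * snd z)) - (1 + p) * (X' * snd z))) (at (B, ?h))"
    by (intro has_derivative_diff has_derivative_add has_derivative_mult_right T X2)
  also have "(\<lambda>z::real \<times> real. (1 - p) * tanh (fst z + 1 * snd z) + 2 * p * tanh (fst z + 2 * snd z) - (1 + p) * X (snd z))
      = (\<lambda>z. force p \<beta> (fst z) (snd z))" by (simp add: force_def X_def)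
  also have "(\<lambda>z. (1 - p) * ((1 - (tanh (B + 1 * ?h))\<^sup>2) * (fst z + 1 * snd z))
        + 2 * p * ((1 - (tanh (B + 2 * ?h))\<^sup>2) * (fst z + 2 * snd z)) - (1 + p) * (X' * snd z))
      = (\<lambda>z. susceptibility p B ?h * fst z - stiffness p \<beta> B ?h * snd z)"
    by (rule ext) (simp add: susceptibility_def stiffness_def X'_def algebra_simps)
  finally show "((\<lambda>z. force p \<beta> (fst z) (snd z)) has_derivative
      (\<lambda>z. susceptibility p B ?h * fst z - stiffness p \<beta> B ?h * snd z)) (at (B, ?h))" .
qed

definition pressure :: "real \<Rightarrow> real \<Rightarrow> real \<Rightarrow> real" where
  "pressure p \<beta> B = free_energy p \<beta> B (cavity_field p \<beta> B)"

text \<open>Fluctuations of independent spins in a fixed field, plus those caused by the Gaussian fluctuations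
  of the field, whose variance is the inverse stiffness.\<close>

definition limit_variance :: "real \<Rightarrow> real \<Rightarrow> real \<Rightarrow> real" where
  "limit_variance p \<beta> B = (let h = cavity_field p \<beta> B in
     spin_variance p B h + (susceptibility p B h)\<^sup>2 / stiffness p \<beta> B h)"

text \<open>Envelope theorem: the contribution of the moving maximiser is multiplied by the force, which
  vanishes there.\<close>

lemma pressure_deriv:
  assumes p: "0 < p" "p < 1" and \<beta>: "\<beta> > 0"
  shows "(pressure p \<beta> has_real_derivative spin_density p B (cavity_field p \<beta> B)) (at B)"
proof -
  define h' where "h' = susceptibility p B (cavity_field p \<beta> B) / stiffness p \<beta> B (cavity_field p \<beta> B)"
  define h where "h = cavity_field p \<beta> B"
  note d = cavity_field_deriv[OF assms, of B, folded h'_def]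
  have lc: "((\<lambda>b. ln (cosh (b + c * cavity_field p \<beta> b))) has_real_derivative
     tanh (B + c * h) * (1 + c * h')) (at B)" for c
    unfolding h_def
    by (auto intro!: derivative_eq_intros d simp: tanh_def)
  have lx: "((\<lambda>b. ln (cosh (2 * cavity_field p \<beta> b) - exp (- 2 * \<beta>))) has_real_derivative
     sinh (2 * h) / (cosh (2 * h) - exp (- 2 * \<beta>)) * (2 * h')) (at B)"
    unfolding h_def
    using cosh_minus_exp_pos[OF \<beta>, of "2 * cavity_field p \<beta> B"] by (auto intro!: derivative_eq_intros d)
  have "(pressure p \<beta> has_real_derivative (1 - p) * (tanh (B + 1 * h) * (1 + 1 * h'))
      + p * (tanh (B + 2 * h) * (1 + 2 * h'))
      - (1 + p) / 2 * (sinh (2 * h) / (cosh (2 * h) - exp (- 2 * \<beta>)) * (2 * h'))) (at B)"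
    using lc[of 1] unfolding pressure_def[abs_def] free_energy_def
    by (intro DERIV_diff DERIV_add DERIV_cmult lc lx) simp
  also have "(1 - p) * (tanh (B + 1 * h) * (1 + 1 * h')) + p * (tanh (B + 2 * h) * (1 + 2 * h'))
      - (1 + p) / 2 * (sinh (2 * h) / (cosh (2 * h) - exp (- 2 * \<beta>)) * (2 * h'))
      = spin_density p B h + force p \<beta> B h * h'"
  proof -
    define X where "X = sinh (2 * h) / (cosh (2 * h) - exp (- 2 * \<beta>))"
    show ?thesis unfolding spin_density_def force_def X_def[symmetric] by (simp add: algebra_simps)
  qed
  finally show ?thesis using force_cavity_field[OF assms, of B] by (simp add: h_def)
qed

lemma pressure_deriv2:
  assumes p: "0 < p" "p < 1" and \<beta>: "\<beta> > 0"
  shows "((\<lambda>B. spin_density p B (cavity_field p \<beta> B)) has_real_derivative limit_variance p \<beta> B) (at B)"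
proof -
  define h' where "h' = susceptibility p B (cavity_field p \<beta> B) / stiffness p \<beta> B (cavity_field p \<beta> B)"
  define h where "h = cavity_field p \<beta> B"
  note d = cavity_field_deriv[OF assms, of B, folded h'_def]
  have t: "((\<lambda>b. tanh (b + c * cavity_field p \<beta> b)) has_real_derivative
     (1 - (tanh (B + c * h))\<^sup>2) * (1 + c * h')) (at B)" for c
    unfolding h_def
    by (auto intro!: derivative_eq_intros d simp: cosh_neq_0_real)
  have "((\<lambda>B. spin_density p B (cavity_field p \<beta> B)) has_real_derivative
     (1 - p) * ((1 - (tanh (B + 1 * h))\<^sup>2) * (1 + 1 * h')) + p * ((1 - (tanh (B + 2 * h))\<^sup>2) * (1 + 2 * h'))) (at B)"
    using t[of 1] unfolding spin_density_def by (intro DERIV_add DERIV_cmult t) simp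
  also have "(1 - p) * ((1 - (tanh (B + 1 * h))\<^sup>2) * (1 + 1 * h')) + p * ((1 - (tanh (B + 2 * h))\<^sup>2) * (1 + 2 * h'))
     = spin_variance p B h + susceptibility p B h * h'"
    by (simp add: spin_variance_def susceptibility_def algebra_simps)
  also have "\<dots> = limit_variance p \<beta> B"
    by (simp add: limit_variance_def Let_def h_def h'_def power2_eq_square)
  finally show ?thesis .
qed

lemma limit_variance_pos:
  assumes p: "0 < p" "p < 1" and \<beta>: "\<beta> > 0"
  shows "limit_variance p \<beta> B > 0"
proof -
  have t: "1 - (tanh x)\<^sup>2 > 0" for x :: real
    using tanh_real_bounds[of x] abs_square_less_1[of "tanh x"] by (auto simp: abs_less_iff)
  have "spin_variance p B h > 0" for h
    unfolding spin_variance_def using p t by (intro add_pos_pos mult_pos_pos) auto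
  moreover have "stiffness p \<beta> B (cavity_field p \<beta> B) > 0"
    using stiffness_pos[OF assms] force_cavity_field[OF assms] by blast
  ultimately show ?thesis
    unfolding limit_variance_def Let_def by (intro add_pos_nonneg) auto
qed

section \<open>The variational formula for the combinatorial entropy\<close>

lemma ln_gibbs_term:
  fixes s u :: real
  assumes "s \<ge> 0" "u > 0" shows "s * ln u - s * ln s \<le> u - s"
proof (cases "s = 0")
  case False
  then have s: "s > 0" using assms by simp
  have "s * ln (u / s) \<le> s * (u / s - 1)"
    using s assms by (intro mult_left_mono ln_le_minus_one) auto
  then show ?thesis using s assms by (simp add: ln_div algebra_simps)
qed (use assms in auto)

text \<open>Concavity of the logarithm; equivalently, a binomial term is at most the whole sum in the binomial
  theorem, on the exponential scale.\<close>

lemma gibbs_inequality: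
  fixes s t x y :: real
  assumes "s \<ge> 0" "t \<ge> 0" "x > 0" "y > 0"
  shows "s * ln x + t * ln y - s * ln s - t * ln t + (s + t) * ln (s + t) \<le> (s + t) * ln (x + y)"
proof (cases "s + t = 0")
  case True
  then have "s = 0" "t = 0" using assms by auto
  then show ?thesis by simp
next
  case False
  then have st: "s + t > 0" using assms by simp
  define c where "c = (s + t) / (x + y)"
  have c: "c > 0" using st assms by (simp add: c_def)
  have "s * ln (c * x) - s * ln s \<le> c * x - s" "t * ln (c * y) - t * ln t \<le> c * y - t"
    using assms c by (intro ln_gibbs_term; simp)+
  moreover have "c * x + c * y = s + t"
  proof -
    have "c * (x + y) = s + t" using assms by (simp add: c_def)
    then show ?thesis by (simp add: distrib_left)
  qed
  moreover have "ln (c * x) = ln c + ln x" "ln (c * y) = ln c + ln y" using c assms by (simp_all add: ln_mult)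
  moreover have "ln c = ln (s + t) - ln (x + y)" using st assms by (simp add: c_def ln_div)
  ultimately show ?thesis by (simp add: algebra_simps)
qed

text \<open>The equality case: the weights are proportional to \<open>x\<close> and \<open>y\<close>.\<close>

lemma gibbs_equality:
  fixes c x y :: real
  assumes "c > 0" "x > 0" "y > 0" "s = c * x" "t = c * y"
  shows "s * ln x + t * ln y - s * ln s - t * ln t + (s + t) * ln (s + t) = (s + t) * ln (x + y)"
proof -
  have "s + t = c * (x + y)" using assms by (simp add: algebra_simps)
  then have "ln (s + t) = ln c + ln (x + y)" "ln s = ln c + ln x" "ln t = ln c + ln y"
    using assms by (simp_all add: ln_mult)
  then show ?thesis by (simp add: algebra_simps)
qed

definition entropy_const :: "real \<Rightarrow> real" where
  "entropy_const p = (1 - p) / 2 * ln ((1 - p) / 2) + p * ln p - (1 + p) / 2 * ln ((1 + p) / 2)"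

text \<open>Three binomial coefficients are encoded in \<open>H\<close>: the choice of the paths that carry the second
  eigenvalue, the distribution of inner vertices over those, and over the other paths. Each bracket is one
  application of Gibbs' inequality, with \<open>z\<close> a free tilting parameter.\<close>

lemma H_fun_regroup:
  fixes p \<beta> B s t z :: real
  defines "q \<equiv> (1 - p) / 2" and "\<alpha> \<equiv> a_ratio \<beta> B * (r_ratio \<beta> B)\<^sup>2" and "r \<equiv> r_ratio \<beta> B"
  assumes "\<alpha> > 0" "0 < r" "r < 1" "0 < z" "z < 1"
  shows "H_fun p \<beta> B s t =
     (s * ln (\<alpha> / (1 - r * z)) + (q - s) * ln (1 / (1 - z)) - s * ln s - (q - s) * ln (q - s) + (s + (q - s)) * ln (s + (q - s)))
     + (s * ln (1 - r * z) + t * ln (r * z) - s * ln s - t * ln t + (s + t) * ln (s + t))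
     + ((q - s) * ln (1 - z) + (p - t) * ln z - (q - s) * ln (q - s) - (p - t) * ln (p - t) + ((q - s) + (p - t)) * ln ((q - s) + (p - t)))
     - p * ln z + entropy_const p"
proof -
  have rz: "r * z < 1" using mult_strict_mono[of r 1 z 1] assms by simp
  have L: "(1 + p) / 2 - s - t = (q - s) + (p - t)" by (simp add: q_def field_simps)
  have q2: "1 - p = 2 * q" by (simp add: q_def)
  have ln: "ln (\<alpha> / (1 - r * z)) = ln \<alpha> - ln (1 - r * z)" "ln (1 / (1 - z)) = - ln (1 - z)"
    "ln (r * z) = ln r + ln z"
    using rz \<open>\<alpha> > 0\<close> \<open>0 < r\<close> \<open>0 < z\<close> \<open>z < 1\<close> by (simp_all add: ln_div ln_mult)
  show ?thesis
    unfolding H_fun_def entropy_const_def L q_def[symmetric] \<alpha>_def[symmetric] unfolding r_def[symmetric] q2 ln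
    by (simp add: algebra_simps)
qed

text \<open>Every \<open>z\<close> bounds \<open>H\<close> from above. If \<open>z\<close> solves the saddle point equation, the three equality cases
  are compatible with \<open>s\<close> and \<open>t\<close> in the rectangle, so the bound is attained.\<close>

lemma SUP_H_fun:
  fixes p \<beta> B z :: real
  defines "q \<equiv> (1 - p) / 2" and "\<alpha> \<equiv> a_ratio \<beta> B * (r_ratio \<beta> B)\<^sup>2" and "r \<equiv> r_ratio \<beta> B"
  defines "x \<equiv> \<alpha> / (1 - r * z)" and "y \<equiv> 1 / (1 - z)"
  assumes p: "0 < p" "p < 1" and pos: "\<alpha> > 0" "0 < r" "r < 1" "0 < z" "z < 1"
    and saddle: "q * (x * (r * z / (1 - r * z)) + y * (z / (1 - z))) = p * (x + y)"
  shows "(SUP (s, t)\<in>{0..(1 - p) / 2} \<times> {0..p}. H_fun p \<beta> B s t) = q * ln (x + y) - p * ln z + entropy_const p"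
proof -
  have rz: "r * z < 1" "0 < r * z" using mult_strict_mono[of r 1 z 1] pos by simp_all
  have q: "q > 0" using p by (simp add: q_def)
  have xy: "x > 0" "y > 0" using rz pos by (simp_all add: x_def y_def)
  note regroup = H_fun_regroup[of \<beta> B z p, folded q_def \<alpha>_def r_def, OF pos, folded x_def y_def]
  have ub: "H_fun p \<beta> B s t \<le> q * ln (x + y) - p * ln z + entropy_const p"
    if "s \<in> {0..q}" "t \<in> {0..p}" for s t
    using gibbs_inequality[of s "q - s" x y] gibbs_inequality[of s t "1 - r * z" "r * z"]
      gibbs_inequality[of "q - s" "p - t" "1 - z" z] that rz pos xy
    unfolding regroup by simp
  define s where "s = q * x / (x + y)"
  define t where "t = s * (r * z) / (1 - r * z)"
  have s: "s > 0" "q - s > 0" "q - s = q * y / (x + y)"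
    using q xy by (simp_all add: s_def field_simps)
  have t: "t > 0" using s rz by (simp add: t_def)
  have pt: "p - t = (q - s) * z / (1 - z)"
  proof -
    have "t + (q - s) * z / (1 - z) = q * (x * (r * z / (1 - r * z)) + y * (z / (1 - z))) / (x + y)"
      unfolding t_def s(3) unfolding s_def by (simp add: add_divide_distrib distrib_left mult_ac)
    also have "\<dots> = p" unfolding saddle using xy by simp
    finally show ?thesis by simp
  qed
  have pt0: "p - t > 0" unfolding pt using s(2) pos by (intro divide_pos_pos mult_pos_pos) auto
  have 1: "s * ln x + (q - s) * ln y - s * ln s - (q - s) * ln (q - s) + (s + (q - s)) * ln (s + (q - s)) = (s + (q - s)) * ln (x + y)"
    by (rule gibbs_equality[of "q / (x + y)"]) (use q xy s in \<open>auto simp: s_def\<close>)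
  have 2: "s * ln (1 - r * z) + t * ln (r * z) - s * ln s - t * ln t + (s + t) * ln (s + t) = (s + t) * ln ((1 - r * z) + r * z)"
    by (rule gibbs_equality[of "s / (1 - r * z)"]) (use s rz in \<open>auto simp: t_def\<close>)
  have 3: "(q - s) * ln (1 - z) + (p - t) * ln z - (q - s) * ln (q - s) - (p - t) * ln (p - t) + ((q - s) + (p - t)) * ln ((q - s) + (p - t))
      = ((q - s) + (p - t)) * ln ((1 - z) + z)"
  proof (rule gibbs_equality[of "(q - s) / (1 - z)"])
    show "(q - s) / (1 - z) > 0" using s(2) pos by (intro divide_pos_pos) auto
  qed (use pos pt in auto)
  have "H_fun p \<beta> B s t = q * ln (x + y) - p * ln z + entropy_const p"
    unfolding regroup 1 2 3 by simp
  moreover have "(s, t) \<in> {0..q} \<times> {0..p}" using s t pt0 by auto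
  ultimately show ?thesis
    unfolding q_def[symmetric] by (intro cSup_eq_maximum) (use ub in \<open>force+\<close>)
qed

text \<open>\<open>\<lambda>\<^sub>\<plusminus>\<close> are the eigenvalues of the transfer matrix with rows \<open>(exp (\<beta> + B), exp (- \<beta>))\<close> and
  \<open>(exp (- \<beta>), exp (\<beta> - B))\<close>; this is its trace, and \<open>lambda_prod\<close> its determinant.\<close>

lemma lambda_sum: "lambda_plus \<beta> B + lambda_minus \<beta> B = exp \<beta> * (exp B + exp (- B))"
  by (simp add: lambda_plus_def lambda_minus_def cosh_def algebra_simps)

lemma lambda_prod: "lambda_plus \<beta> B * lambda_minus \<beta> B = (exp \<beta>)\<^sup>2 - (exp (- \<beta>))\<^sup>2"
proof -
  define S where "S = sqrt ((sinh B)\<^sup>2 + exp (- 4 * \<beta>))"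
  have S: "S\<^sup>2 = (cosh B)\<^sup>2 - 1 + exp (- 4 * \<beta>)"
    unfolding S_def sinh_square_eq[symmetric] by simp
  have e: "(exp \<beta>)\<^sup>2 * exp (- 4 * \<beta>) = (exp (- \<beta>))\<^sup>2"
    by (simp add: power2_eq_square exp_add[symmetric])
  have "lambda_plus \<beta> B * lambda_minus \<beta> B = (exp \<beta>)\<^sup>2 * ((cosh B)\<^sup>2 - S\<^sup>2)"
    unfolding lambda_plus_def lambda_minus_def S_def[symmetric] by (simp add: power2_eq_square algebra_simps)
  also have "\<dots> = (exp \<beta>)\<^sup>2 - (exp \<beta>)\<^sup>2 * exp (- 4 * \<beta>)" by (simp add: S algebra_simps)
  finally show ?thesis using e by simp
qed

lemma lambda_order:
  assumes "\<beta> > 0"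
  shows lambda_minus_pos: "lambda_minus \<beta> B > 0" and lambda_minus_less: "lambda_minus \<beta> B < lambda_plus \<beta> B"
    and lambda_plus_gt: "lambda_plus \<beta> B > exp (\<beta> + B)" and lambda_plus_pos: "lambda_plus \<beta> B > 0"
proof -
  define S where "S = sqrt ((sinh B)\<^sup>2 + exp (- 4 * \<beta>))"
  have "\<bar>sinh B\<bar> = sqrt ((sinh B)\<^sup>2)" by simp
  also have "\<dots> < S" unfolding S_def by (rule real_sqrt_less_mono) simp
  finally have S: "S > sinh B" "S > 0" by auto
  have "S < sqrt ((sinh B)\<^sup>2 + 1)" unfolding S_def by (rule real_sqrt_less_mono) (use assms in simp)
  also have "\<dots> = cosh B" by (simp add: sinh_square_eq)
  finally have "S < cosh B" .
  then show 1: "lambda_minus \<beta> B > 0" by (simp add: lambda_minus_def S_def)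
  show 2: "lambda_minus \<beta> B < lambda_plus \<beta> B"
    using S by (simp add: lambda_minus_def lambda_plus_def S_def)
  have "exp B < cosh B + S" using S cosh_plus_sinh[of B] by linarith
  then show "lambda_plus \<beta> B > exp (\<beta> + B)"
    unfolding lambda_plus_def S_def[symmetric] exp_add by simp
  show "lambda_plus \<beta> B > 0" using 1 2 by simp
qed

text \<open>\<open>A\<^sub>\<plusminus> \<lambda>\<^sub>\<plusminus>\<close> are the squared components of \<open>(exp (B/2), exp (- B/2))\<close> along the normalised eigenvectors
  of the transfer matrix \<open>T\<close>. The last two facts compute the squared norm of that vector and its quadratic form
  in \<open>T\<close>. The second component vanishes only if the vector is an eigenvector, that is for \<open>B = 0\<close>.\<close>

lemma A_coefficients:
  fixes \<beta> B :: real
  assumes "\<beta> > 0"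
  defines "e \<equiv> exp \<beta>" and "e' \<equiv> exp (- \<beta>)" and "b \<equiv> exp B" and "b' \<equiv> exp (- B)"
    and "l \<equiv> lambda_plus \<beta> B" and "m \<equiv> lambda_minus \<beta> B"
  shows "A_plus \<beta> B > 0" and "B \<noteq> 0 \<Longrightarrow> A_minus \<beta> B > 0"
    and "A_plus \<beta> B * l + A_minus \<beta> B * m = b + b'"
    and "A_plus \<beta> B * l\<^sup>2 + A_minus \<beta> B * m\<^sup>2 = e * (b\<^sup>2 + b'\<^sup>2) + 2 * e'"
proof -
  define x where "x = l - e * b"
  define D where "D = e'\<^sup>2 + x\<^sup>2"
  have lm: "l > 0" "m > 0" using lambda_order[OF assms(1)] by (simp_all add: l_def m_def)
  have x: "x > 0" using lambda_plus_gt[OF assms(1), of B] by (simp add: x_def l_def e_def b_def exp_add)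
  have inv: "e * e' = 1" "b * b' = 1" by (simp_all add: e_def e'_def b_def b'_def exp_add[symmetric])
  have pos: "e' > 0" "b > 0" "b' > 0" "e > 0" by (simp_all add: e_def e'_def b_def b'_def)
  have D: "D > 0" using pos by (simp add: D_def add_pos_nonneg)
  have sum: "l + m = e * (b + b')" using lambda_sum by (simp add: l_def m_def e_def b_def b'_def)
  have prod: "l * m = e\<^sup>2 - e'\<^sup>2" using lambda_prod by (simp add: l_def m_def e_def e'_def)
  have l: "l = x + e * b" by (simp add: x_def)
  have m: "m = e * b' - x" using sum l by (simp add: algebra_simps)
  have quad: "x\<^sup>2 = e'\<^sup>2 - x * e * (b - b')"
  proof -
    have "(x + e * b) * (e * b' - x) = e\<^sup>2 - e'\<^sup>2" using prod l m by simp
    moreover have "(x + e * b) * (e * b' - x) = e\<^sup>2 * (b * b') - x\<^sup>2 - x * e * (b - b')"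
      by (simp add: power2_eq_square algebra_simps)
    ultimately show ?thesis using inv by simp
  qed
  have e2: "exp (- 2 * \<beta>) = e'\<^sup>2" by (simp add: e'_def power2_eq_square exp_add[symmetric])
  have eb: "exp (\<beta> + B) = e * b" by (simp add: e_def b_def exp_add)
  have Ap: "A_plus \<beta> B = (e'\<^sup>2 * b + x\<^sup>2 * b' + 2 * e' * x) / (D * l)"
    unfolding A_plus_def e2 eb l_def[symmetric] x_def[symmetric] D_def[symmetric]
      e'_def[symmetric] b_def[symmetric] b'_def[symmetric] ..
  have Am: "A_minus \<beta> B = (e'\<^sup>2 * b' + x\<^sup>2 * b - 2 * e' * x) / (D * m)"
    unfolding A_minus_def e2 eb l_def[symmetric] m_def[symmetric] x_def[symmetric] D_def[symmetric]
      e'_def[symmetric] b_def[symmetric] b'_def[symmetric] ..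
  show "A_plus \<beta> B > 0" unfolding Ap using D lm x pos by (intro divide_pos_pos add_pos_nonneg mult_pos_pos) auto
  show "A_minus \<beta> B > 0" if "B \<noteq> 0"
  proof -
    have sq: "e'\<^sup>2 * b' + x\<^sup>2 * b - 2 * e' * x = b * (x - e' * b')\<^sup>2"
    proof -
      have "b * (x - e' * b')\<^sup>2 = x\<^sup>2 * b - 2 * e' * x * (b * b') + e'\<^sup>2 * b' * (b * b')"
        by (simp add: power2_eq_square algebra_simps)
      then show ?thesis using inv by simp
    qed
    have "x \<noteq> e' * b'"
    proof
      assume xe: "x = e' * b'"
      have "(1 - b'\<^sup>2) * (1 - e'\<^sup>2) = 0"
        using quad inv unfolding xe by algebra
      moreover have "e' < 1" using assms(1) by (simp add: e'_def)
      then have "e'\<^sup>2 < 1" using pos by (simp add: power_less_one_iff)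
      ultimately have "b'\<^sup>2 = 1" by simp
      then have "b' = 1" using pos by (simp add: power2_eq_1_iff)
      then show False using that by (simp add: b'_def)
    qed
    then show ?thesis unfolding Am sq using D lm pos by simp
  qed
  have Al: "A_plus \<beta> B * l = (e'\<^sup>2 * b + x\<^sup>2 * b' + 2 * e' * x) / D" unfolding Ap using lm by simp
  have Bm: "A_minus \<beta> B * m = (e'\<^sup>2 * b' + x\<^sup>2 * b - 2 * e' * x) / D" unfolding Am using lm by simp
  have "A_plus \<beta> B * l + A_minus \<beta> B * m = ((b + b') * D) / D"
    unfolding Al Bm add_divide_distrib[symmetric] by (simp add: D_def algebra_simps)
  then show "A_plus \<beta> B * l + A_minus \<beta> B * m = b + b'" using D by simp
  have "A_plus \<beta> B * l\<^sup>2 + A_minus \<beta> B * m\<^sup>2 = (A_plus \<beta> B * l) * l + (A_minus \<beta> B * m) * m"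
    by (simp add: power2_eq_square)
  also have "\<dots> = ((e'\<^sup>2 * b + x\<^sup>2 * b' + 2 * e' * x) * l + (e'\<^sup>2 * b' + x\<^sup>2 * b - 2 * e' * x) * m) / D"
  proof -
    have "(u / D) * l + (v / D) * m = (u * l + v * m) / D" for u v
      by (simp add: add_divide_distrib)
    then show ?thesis unfolding Al Bm by blast
  qed
  also have "(e'\<^sup>2 * b + x\<^sup>2 * b' + 2 * e' * x) * l + (e'\<^sup>2 * b' + x\<^sup>2 * b - 2 * e' * x) * m = (e * (b\<^sup>2 + b'\<^sup>2) + 2 * e') * D"
    unfolding l m D_def using quad inv by algebra
  finally show "A_plus \<beta> B * l\<^sup>2 + A_minus \<beta> B * m\<^sup>2 = e * (b\<^sup>2 + b'\<^sup>2) + 2 * e'" using D by simp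
qed

text \<open>Linear algebra for the symmetric matrix \<open>M\<close> with diagonal \<open>c e - y b\<close>, \<open>c e - y b'\<close> and off-diagonal
  entry \<open>- c e'\<close>. The equations say \<open>M (E, E') = \<mu> (b, b')\<close> with positive vectors, so \<open>M\<close> is positive definite and
  \<open>M\<^sup>-\<^sup>1 (b, b') = (E, E') / \<mu>\<close>. The last two facts evaluate the quadratic forms of \<open>M\<^sup>-\<^sup>1\<close> and of its
  derivative in \<open>y\<close> at \<open>(b, b')\<close>, cleared of the determinant.\<close>

lemma resolvent_at_cavity:
  fixes c e e' b b' E E' y \<mu> :: real
  assumes inv: "e * e' = 1" "b * b' = 1" "E * E' = 1" and c: "c * (e\<^sup>2 - e'\<^sup>2) = 1"
    and pos: "c > 0" "e > 0" "e' > 0" "b > 0" "b' > 0" "E > 0" "E' > 0" "y > 0" "\<mu> > 0"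
    and eq1: "(c * e - y * b) * E = c * e' * E' + \<mu> * b"
    and eq2: "(c * e - y * b') * E' = c * e' * E + \<mu> * b'"
  defines "\<Delta> \<equiv> (c * e - y * b) * (c * e - y * b') - (c * e')\<^sup>2"
  shows "\<Delta> > 0" and "c * e - y * b > 0" and "c * e - y * b' > 0"
    and "b\<^sup>2 * (c * e - y * b') + 2 * (c * e') + b'\<^sup>2 * (c * e - y * b) = \<Delta> * ((b * E + b' * E') / \<mu>)"
    and "b * ((c * e - y * b') * b + c * e' * b')\<^sup>2 + b' * (c * e' * b + (c * e - y * b) * b')\<^sup>2
       = \<Delta>\<^sup>2 * ((b * E\<^sup>2 + b' * E'\<^sup>2) / \<mu>\<^sup>2)"
proof -
  define m1 where "m1 = c * e - y * b"
  define m2 where "m2 = c * e - y * b'"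
  define k where "k = c * e'"
  have kpos: "k > 0" using pos by (simp add: k_def)
  note q = eq1[folded m1_def k_def] eq2[folded m2_def k_def]
  have \<Delta>_eq: "\<Delta> = m1 * m2 - k\<^sup>2" by (simp add: \<Delta>_def m1_def m2_def k_def)
  have "m1 * E > 0" "m2 * E' > 0" unfolding q using kpos pos by (simp_all add: add_pos_pos)
  then show "c * e - y * b > 0" "c * e - y * b' > 0"
    using pos by (simp_all add: m1_def m2_def zero_less_mult_iff)
  have "\<Delta> = \<mu> * (k * (b * E + b' * E') + \<mu>)"
    unfolding \<Delta>_eq using q inv by algebra
  then show "\<Delta> > 0" using pos kpos by (simp add: add_pos_pos)
  have 1: "m2 * b + k * b' = \<Delta> * E / \<mu>"
  proof -
    have "\<mu> * (m2 * b + k * b') = \<Delta> * E" unfolding \<Delta>_eq using q inv by algebra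
    then show ?thesis using pos by (simp add: field_simps)
  qed
  have 2: "k * b + m1 * b' = \<Delta> * E' / \<mu>"
  proof -
    have "\<mu> * (k * b + m1 * b') = \<Delta> * E'" unfolding \<Delta>_eq using q inv by algebra
    then show ?thesis using pos by (simp add: field_simps)
  qed
  have "b\<^sup>2 * m2 + 2 * k + b'\<^sup>2 * m1 = b * (m2 * b + k * b') + b' * (k * b + m1 * b')"
    using inv by algebra
  also have "\<dots> = \<Delta> * ((b * E + b' * E') / \<mu>)" unfolding 1 2 by (simp add: algebra_simps add_divide_distrib)
  finally show "b\<^sup>2 * (c * e - y * b') + 2 * (c * e') + b'\<^sup>2 * (c * e - y * b) = \<Delta> * ((b * E + b' * E') / \<mu>)"
    by (simp add: m1_def m2_def k_def)
  have "b * (m2 * b + k * b')\<^sup>2 + b' * (k * b + m1 * b')\<^sup>2 = \<Delta>\<^sup>2 * ((b * E\<^sup>2 + b' * E'\<^sup>2) / \<mu>\<^sup>2)"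
    unfolding 1 2 by (simp add: power_divide power_mult_distrib algebra_simps add_divide_distrib)
  then show "b * ((c * e - y * b') * b + c * e' * b')\<^sup>2 + b' * (c * e' * b + (c * e - y * b) * b')\<^sup>2
       = \<Delta>\<^sup>2 * ((b * E\<^sup>2 + b' * E'\<^sup>2) / \<mu>\<^sup>2)"
    by (simp add: m1_def m2_def k_def)
qed


text \<open>The critical point \<open>h\<close> of the free energy gives the tilting parameter: \<open>(exp h, exp (- h))\<close> is
  proportional to \<open>M\<^sup>-\<^sup>1 (b, b')\<close> for the matrix \<open>M\<close> of \<open>resolvent_at_cavity\<close>, with \<open>y\<close> and \<open>\<mu>\<close> fixed by
  homogeneity, and \<open>z = \<lambda>\<^sub>+ y\<close>. The value of the generating function is then \<open>2 cosh (B + h) / \<mu>\<close>, and the saddle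
  point equation reduces to the proportion between \<open>y\<close> and \<open>\<mu>\<close>.\<close>

lemma I_fun_eq_pressure_nonzero:
  assumes p: "0 < p" "p < 1" and \<beta>: "\<beta> > 0" and B: "B \<noteq> 0"
  shows "I_fun p \<beta> B = pressure p \<beta> B - ln (lambda_plus \<beta> B) - (1 - p) / 2 * ln (A_plus \<beta> B)
     + ((1 - p) / 2 * ln 2 - (1 + p) / 2 * ln (exp \<beta> / ((exp \<beta>)\<^sup>2 - (exp (- \<beta>))\<^sup>2)))"
proof -
  define h where "h = cavity_field p \<beta> B"
  define q L where "q = (1 - p) / 2" and "L = (1 + p) / 2"
  define e e' b b' E E' where "e = exp \<beta>" and "e' = exp (- \<beta>)" and "b = exp B" and "b' = exp (- B)"
    and "E = exp h" and "E' = exp (- h)"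
  define l m where "l = lambda_plus \<beta> B" and "m = lambda_minus \<beta> B"
  define c where "c = 1 / (e\<^sup>2 - e'\<^sup>2)"
  define U where "U = cosh (2 * h) - exp (- 2 * \<beta>)"
  define C1 C2 where "C1 = cosh (B + h)" and "C2 = cosh (B + 2 * h)"
  \<comment> \<open>\<open>y C2\<close> and \<open>\<mu> C1\<close> split \<open>c e U\<close> in the ratio \<open>p : q\<close>, the equality case of the weighted
    arithmetic-geometric mean inequality.\<close>
  define y where "y = p / L * (c * e * U) / C2"
  define \<mu> where "\<mu> = q / L * (c * e * U) / C1"
  have qL: "q > 0" "L > 0" "q + p = L" "2 * q + p = 1" using p by (simp_all add: q_def L_def field_simps)
  have inv: "e * e' = 1" "b * b' = 1" "E * E' = 1"
    by (simp_all add: e_def e'_def b_def b'_def E_def E'_def exp_add[symmetric])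
  have lm: "l > 0" "m > 0" "m < l" using lambda_order[OF \<beta>] by (simp_all add: l_def m_def)
  have sum: "l + m = e * (b + b')" using lambda_sum by (simp add: l_def m_def e_def b_def b'_def)
  have prod: "l * m = e\<^sup>2 - e'\<^sup>2" using lambda_prod by (simp add: l_def m_def e_def e'_def)
  have cpos: "c > 0" using lm prod by (simp add: c_def flip: prod)
  have c1: "c * (e\<^sup>2 - e'\<^sup>2) = 1" using lm prod by (simp add: c_def flip: prod)
  have clm: "c * (l * m) = 1" using c1 prod by simp
  have U: "U > 0" using cosh_minus_exp_pos[OF \<beta>] by (simp add: U_def)
  have C: "C1 > 0" "C2 > 0" by (simp_all add: C1_def C2_def)
  have pos: "e > 0" "e' > 0" "b > 0" "b' > 0" "E > 0" "E' > 0" "y > 0" "\<mu> > 0"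
    using qL p cpos U C by (simp_all add: e_def e'_def b_def b'_def E_def E'_def y_def \<mu>_def)
  have C1: "b * E + b' * E' = 2 * C1"
    by (simp add: C1_def b_def b'_def E_def E'_def cosh_def exp_add[symmetric])
  have C2: "b * E\<^sup>2 + b' * E'\<^sup>2 = 2 * C2"
    by (simp add: C2_def b_def b'_def E_def E'_def cosh_def power2_eq_square exp_add[symmetric])
  have S1: "b * E - b' * E' = 2 * sinh (B + h)"
    by (simp add: b_def b'_def E_def E'_def sinh_def exp_add[symmetric])
  have S2: "b * E\<^sup>2 - b' * E'\<^sup>2 = 2 * sinh (B + 2 * h)"
    by (simp add: b_def b'_def E_def E'_def sinh_def power2_eq_square exp_add[symmetric])
  have EE: "E\<^sup>2 + E'\<^sup>2 = 2 * U + 2 * e'\<^sup>2" "E\<^sup>2 - E'\<^sup>2 = 2 * sinh (2 * h)"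
    by (simp_all add: U_def E_def E'_def e'_def cosh_def sinh_def power2_eq_square exp_add[symmetric])
  have crit: "c * e * sinh (2 * h) = y * sinh (B + 2 * h) + \<mu> * sinh (B + h)"
  proof -
    have "(1 - p) * tanh (B + h) + 2 * p * tanh (B + 2 * h) = (1 + p) * (sinh (2 * h) / U)"
      using force_cavity_field[OF p \<beta>, of B] by (simp add: force_def h_def U_def)
    then have "q * tanh (B + h) + p * tanh (B + 2 * h) = L * (sinh (2 * h) / U)"
      by (simp add: q_def L_def field_simps)
    then have "c * e * sinh (2 * h) = (c * e * U) * (q * tanh (B + h) + p * tanh (B + 2 * h)) / L"
      using qL U by simp
    also have "\<dots> = y * sinh (B + 2 * h) + \<mu> * sinh (B + h)"
      by (simp add: y_def \<mu>_def C1_def C2_def tanh_def algebra_simps add_divide_distrib)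
    finally show ?thesis .
  qed
  have normal: "c * e * U = y * C2 + \<mu> * C1"
  proof -
    have "y * C2 + \<mu> * C1 = (q + p) / L * (c * e * U)"
      using C by (simp add: y_def \<mu>_def add_divide_distrib distrib_right)
    then show ?thesis using qL(2,3) by simp
  qed
  have S: "((c * e - y * b) * E) * E + ((c * e - y * b') * E') * E' = (c * e' * E' + \<mu> * b) * E + (c * e' * E + \<mu> * b') * E'"
  proof -
    have "((c * e - y * b) * E) * E + ((c * e - y * b') * E') * E' = c * e * (E\<^sup>2 + E'\<^sup>2) - y * (b * E\<^sup>2 + b' * E'\<^sup>2)"
      by (simp add: power2_eq_square algebra_simps)
    also have "\<dots> = 2 * (c * e * U) + 2 * c * e' * (e * e') - 2 * (y * C2)"
      unfolding EE C2 by (simp add: power2_eq_square algebra_simps)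
    also have "\<dots> = 2 * (\<mu> * C1) + 2 * c * e'" unfolding normal inv by simp
    also have "\<dots> = \<mu> * (b * E + b' * E') + 2 * c * e' * (E * E')" unfolding C1 inv by simp
    finally show ?thesis by (simp add: algebra_simps)
  qed
  have D: "((c * e - y * b) * E) * E - ((c * e - y * b') * E') * E' = (c * e' * E' + \<mu> * b) * E - (c * e' * E + \<mu> * b') * E'"
  proof -
    have "((c * e - y * b) * E) * E - ((c * e - y * b') * E') * E' = c * e * (E\<^sup>2 - E'\<^sup>2) - y * (b * E\<^sup>2 - b' * E'\<^sup>2)"
      by (simp add: power2_eq_square algebra_simps)
    also have "\<dots> = 2 * (c * e * sinh (2 * h)) - 2 * (y * sinh (B + 2 * h))"
      unfolding EE S2 by simp
    also have "\<dots> = \<mu> * (b * E - b' * E')" unfolding crit S1 by (simp add: algebra_simps)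
    finally show ?thesis by (simp add: algebra_simps)
  qed
  have eq1: "(c * e - y * b) * E = c * e' * E' + \<mu> * b"
  proof -
    have "((c * e - y * b) * E) * E = (c * e' * E' + \<mu> * b) * E" using S D by linarith
    then show ?thesis using pos by simp
  qed
  have eq2: "(c * e - y * b') * E' = c * e' * E + \<mu> * b'"
  proof -
    have "((c * e - y * b') * E') * E' = (c * e' * E + \<mu> * b') * E'" using S D by linarith
    then show ?thesis using pos by simp
  qed
  define \<Delta> where "\<Delta> = (c * e - y * b) * (c * e - y * b') - (c * e')\<^sup>2"
  note res = resolvent_at_cavity[OF inv c1 cpos pos eq1 eq2, folded \<Delta>_def]
  have De: "(1 - l * y) * (1 - m * y) = \<Delta> / c"
  proof -
    have "c * ((1 - l * y) * (1 - m * y)) = c - c * (l + m) * y + (c * (l * m)) * y\<^sup>2"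
      by (simp add: power2_eq_square algebra_simps)
    also have "\<dots> = c * (c * (e\<^sup>2 - e'\<^sup>2)) - c * e * (b + b') * y + (b * b') * y\<^sup>2"
      unfolding sum clm c1 inv by simp
    also have "\<dots> = \<Delta>" by (simp add: \<Delta>_def power2_eq_square algebra_simps)
    finally show ?thesis using cpos by (simp add: field_simps)
  qed
  have prodpos: "(1 - l * y) * (1 - m * y) > 0" unfolding De using res(1) cpos by simp
  \<comment> \<open>Both factors of the product are positive, not both negative: \<open>y < c e \<le> c l = 1 / m\<close>.\<close>
  have ly: "l * y < 1"
  proof (rule ccontr)
    assume "\<not> l * y < 1"
    then have my: "m * y > 1" using prodpos by (simp add: zero_less_mult_iff)
    have "(y * b) * (y * b') < (c * e) * (c * e)"
      by (rule mult_strict_mono') (use res(2,3) pos in auto)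
    then have "y\<^sup>2 * (b * b') < (c * e)\<^sup>2" by (simp add: power2_eq_square mult_ac)
    then have "y < c * e" unfolding inv using pos cpos by (simp add: power_less_imp_less_base)
    have "2 \<le> b + b'"
    proof -
      have "0 \<le> (b - 1)\<^sup>2 / b" using pos by simp
      also have "\<dots> = b + 1 / b - 2" using pos by (simp add: field_simps power2_eq_square)
      also have "1 / b = b'" using inv pos by (simp add: field_simps)
      finally show ?thesis by simp
    qed
    then have "c * (e * 2) \<le> c * (e * (b + b'))" using cpos pos by (intro mult_left_mono) auto
    also have "\<dots> < c * (2 * l)" unfolding sum[symmetric] using lm cpos by simp
    finally have "c * e < c * l" by simp
    with \<open>y < c * e\<close> have "y < c * l" by simp
    then have "m * y < m * (c * l)" using lm by simp
    also have "\<dots> = 1" using clm by (simp add: mult_ac)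
    finally show False using my by simp
  qed
  have my: "m * y < 1" using ly prodpos by (simp add: zero_less_mult_iff)
  define Ap Am where "Ap = A_plus \<beta> B" and "Am = A_minus \<beta> B"
  have A: "Ap > 0" "Am > 0" using A_coefficients(1,2)[OF \<beta>] B by (simp_all add: Ap_def Am_def)
  have A1: "Ap * l + Am * m = b + b'" and A2: "Ap * l\<^sup>2 + Am * m\<^sup>2 = e * (b\<^sup>2 + b'\<^sup>2) + 2 * e'"
    using A_coefficients(3,4)[OF \<beta>] by (simp_all add: Ap_def Am_def l_def m_def b_def b'_def e_def e'_def)
  define u v where "u = 1 - l * y" and "v = 1 - m * y"
  have uv: "u > 0" "v > 0" "u * v = \<Delta> / c" using ly my De by (simp_all add: u_def v_def)
  have \<Phi>: "Ap * l\<^sup>2 / u + Am * m\<^sup>2 / v = 2 * C1 / \<mu>"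
  proof -
    have "c * (Ap * l\<^sup>2 * v + Am * m\<^sup>2 * u) = c * (Ap * l\<^sup>2 + Am * m\<^sup>2) - (c * (l * m)) * y * (Ap * l + Am * m)"
      by (simp add: u_def v_def power2_eq_square algebra_simps)
    also have "\<dots> = c * (e * (b\<^sup>2 + b'\<^sup>2) + 2 * e') - y * (b + b') * (b * b')"
      unfolding A1 A2 clm inv by simp
    also have "\<dots> = b\<^sup>2 * (c * e - y * b') + 2 * (c * e') + b'\<^sup>2 * (c * e - y * b)"
      by (simp add: power2_eq_square algebra_simps)
    also have "\<dots> = \<Delta> * (2 * C1 / \<mu>)" using res(4) C1 by simp
    also have "\<dots> = c * ((u * v) * (2 * C1 / \<mu>))" unfolding uv(3) using cpos by simp
    finally have "Ap * l\<^sup>2 * v + Am * m\<^sup>2 * u = (u * v) * (2 * C1 / \<mu>)"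
      using cpos by (simp only: mult_cancel_left) simp
    then have "(Ap * l\<^sup>2 * v + Am * m\<^sup>2 * u) / (u * v) = 2 * C1 / \<mu>" using uv(1,2) by simp
    then show ?thesis using uv(1,2) by (simp add: add_divide_distrib)
  qed
  have \<Phi>': "Ap * l^3 / u\<^sup>2 + Am * m^3 / v\<^sup>2 = 2 * C2 / \<mu>\<^sup>2"
  proof -
    have A3: "Ap * l^3 + Am * m^3 = (l + m) * (Ap * l\<^sup>2 + Am * m\<^sup>2) - l * m * (Ap * l + Am * m)"
      by (simp add: power2_eq_square power3_eq_cube algebra_simps)
    have "c\<^sup>2 * (Ap * l^3 * v\<^sup>2 + Am * m^3 * u\<^sup>2) =
        c\<^sup>2 * (Ap * l^3 + Am * m^3) - 2 * c * (c * (l * m)) * y * (Ap * l\<^sup>2 + Am * m\<^sup>2) + (c * (l * m))\<^sup>2 * y\<^sup>2 * (Ap * l + Am * m)"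
      by (simp add: u_def v_def power2_eq_square power3_eq_cube algebra_simps)
    also have "\<dots> = c\<^sup>2 * (e * (b + b') * (e * (b\<^sup>2 + b'\<^sup>2) + 2 * e')) - c * (c * (l * m)) * (b + b')
        - 2 * c * (c * (l * m)) * y * (e * (b\<^sup>2 + b'\<^sup>2) + 2 * e') + (c * (l * m))\<^sup>2 * y\<^sup>2 * (b + b')"
      unfolding A3 A1 A2 sum by (simp add: power2_eq_square algebra_simps)
    also have "\<dots> = c\<^sup>2 * (e * (b + b') * (e * (b\<^sup>2 + b'\<^sup>2) + 2 * e')) - c * (b + b')
        - 2 * c * y * (e * (b\<^sup>2 + b'\<^sup>2) + 2 * e') + y\<^sup>2 * (b + b')"
      unfolding clm by simp
    also have "\<dots> = b * ((c * e - y * b') * b + c * e' * b')\<^sup>2 + b' * (c * e' * b + (c * e - y * b) * b')\<^sup>2"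
      using inv(1,2) c1 by algebra
    also have "\<dots> = \<Delta>\<^sup>2 * (2 * C2 / \<mu>\<^sup>2)" using res(5) C2 by simp
    also have "\<dots> = c\<^sup>2 * ((u * v)\<^sup>2 * (2 * C2 / \<mu>\<^sup>2))"
      unfolding uv(3) using cpos by (simp add: power_divide)
    finally have "Ap * l^3 * v\<^sup>2 + Am * m^3 * u\<^sup>2 = (u * v)\<^sup>2 * (2 * C2 / \<mu>\<^sup>2)"
      using cpos by (simp only: mult_cancel_left) simp
    then have "(Ap * l^3 * v\<^sup>2 + Am * m^3 * u\<^sup>2) / (u * v)\<^sup>2 = 2 * C2 / \<mu>\<^sup>2" using uv(1,2) by simp
    then show ?thesis using uv(1,2) by (simp add: add_divide_distrib power_mult_distrib)
  qed
  define r where "r = r_ratio \<beta> B"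
  define \<alpha> where "\<alpha> = a_ratio \<beta> B * (r_ratio \<beta> B)\<^sup>2"
  have r: "r = m / l" by (simp add: r_def r_ratio_def m_def l_def)
  have \<alpha>: "\<alpha> = Am * m\<^sup>2 / (Ap * l\<^sup>2)"
    by (simp add: \<alpha>_def a_ratio_def r_ratio_def m_def l_def Am_def Ap_def power_divide)
  define z where "z = l * y"
  have z: "0 < z" "z < 1" "r * z = m * y" "1 - z = u" "1 - r * z = v"
    using lm pos ly by (simp_all add: z_def r u_def v_def)
  have rr: "0 < r" "r < 1" using lm by (simp_all add: r)
  have \<alpha>0: "\<alpha> > 0" using A lm by (simp add: \<alpha>)
  have f: "Ap * l\<^sup>2 * (\<alpha> / v + 1 / u) = 2 * C1 / \<mu>"
    unfolding \<Phi>[symmetric] \<alpha> using A lm by (simp add: field_simps)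
  have saddle: "q * (\<alpha> / v * (r * z / v) + 1 / u * (z / u)) = p * (\<alpha> / v + 1 / u)"
  proof -
    have "Ap * l\<^sup>2 * (q * (\<alpha> / v * (r * z / v) + 1 / u * (z / u))) = q * y * (Ap * l^3 / u\<^sup>2 + Am * m^3 / v\<^sup>2)"
    proof -
      have "Ap * l\<^sup>2 * (q * (\<alpha> / v * (m * y / v) + 1 / u * (l * y / u))) =
          q * y * (Ap * l\<^sup>2 * \<alpha> * m / v\<^sup>2 + Ap * l\<^sup>2 * l / u\<^sup>2)"
        by (simp add: power2_eq_square algebra_simps)
      also have "Ap * l\<^sup>2 * \<alpha> = Am * m\<^sup>2" unfolding \<alpha> using A lm by simp
      finally show ?thesis
        unfolding z(3) unfolding z_def by (simp add: power2_eq_square power3_eq_cube mult_ac add.commute)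
    qed
    also have "\<dots> = (q * y * C2) * 2 / \<mu>\<^sup>2" unfolding \<Phi>' by simp
    also have "q * y * C2 = p * \<mu> * C1" using C by (simp add: y_def \<mu>_def)
    also have "p * \<mu> * C1 * 2 / \<mu>\<^sup>2 = p * (2 * C1 / \<mu>)" using pos by (simp add: power2_eq_square)
    also have "\<dots> = Ap * l\<^sup>2 * (p * (\<alpha> / v + 1 / u))" unfolding f[symmetric] by simp
    finally show ?thesis using A lm by simp
  qed
  have "I_fun p \<beta> B = q * ln (\<alpha> / v + 1 / u) - p * ln z + entropy_const p"
    unfolding I_fun_def q_def[symmetric] using B SUP_H_fun[OF p, of \<beta> B z, folded \<alpha>_def r_def q_def, OF \<alpha>0 rr z(1,2)] saddle
    unfolding z(4,5) by simp
  also have "\<alpha> / v + 1 / u = 2 * C1 / \<mu> / (Ap * l\<^sup>2)"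
  proof -
    have "Ap * l\<^sup>2 \<noteq> 0" using A lm by simp
    then have "\<alpha> / v + 1 / u = Ap * l\<^sup>2 * (\<alpha> / v + 1 / u) / (Ap * l\<^sup>2)" by simp
    then show ?thesis unfolding f .
  qed
  also have "ln (2 * C1 / \<mu> / (Ap * l\<^sup>2)) = ln 2 + ln C1 - ln \<mu> - ln Ap - 2 * ln l"
    using A lm C pos by (simp add: ln_div ln_mult ln_realpow)
  also have "ln \<mu> = ln q - ln L + ln (c * e) + ln U - ln C1"
    using qL cpos pos U C by (simp add: \<mu>_def ln_div ln_mult)
  also have "ln z = ln l + ln p - ln L + ln (c * e) + ln U - ln C2"
    using qL p cpos pos U C lm by (simp add: z_def y_def ln_div ln_mult)
  also have "entropy_const p = q * ln q + p * ln p - (q + p) * ln L"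
    unfolding qL(3) by (simp add: entropy_const_def q_def L_def)
  also have "q * (ln 2 + ln C1 - (ln q - ln L + ln (c * e) + ln U - ln C1) - ln Ap - 2 * ln l)
      - p * (ln l + ln p - ln L + ln (c * e) + ln U - ln C2) + (q * ln q + p * ln p - (q + p) * ln L)
      = (2 * q * ln C1 + p * ln C2 - (q + p) * ln U) - (2 * q + p) * ln l - q * ln Ap + (q * ln 2 - (q + p) * ln (c * e))"
    by (simp add: algebra_simps)
  also have "\<dots> = pressure p \<beta> B - ln l - q * ln Ap + (q * ln 2 - L * ln (e / (e\<^sup>2 - e'\<^sup>2)))"
    unfolding qL(3,4) by (simp add: pressure_def free_energy_def h_def[symmetric] C1_def C2_def U_def q_def L_def c_def)
  finally show ?thesis
    by (simp only: l_def q_def Ap_def L_def e_def e'_def)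
qed

text \<open>At \<open>B = 0\<close> the prescribed value 0 agrees with the formula, since there \<open>h\<^sup>* = 0\<close>,
  \<open>\<lambda>\<^sub>+ = exp \<beta> + exp (- \<beta>)\<close> and \<open>A\<^sub>+ = 2 / \<lambda>\<^sub>+\<close>. So \<open>I\<close> is as smooth at 0 as elsewhere.\<close>

lemma I_fun_eq_pressure:
  assumes p: "0 < p" "p < 1" and \<beta>: "\<beta> > 0"
  shows "I_fun p \<beta> B = pressure p \<beta> B - ln (lambda_plus \<beta> B) - (1 - p) / 2 * ln (A_plus \<beta> B)
     + ((1 - p) / 2 * ln 2 - (1 + p) / 2 * ln (exp \<beta> / ((exp \<beta>)\<^sup>2 - (exp (- \<beta>))\<^sup>2)))"
proof (cases "B = 0")
  case True
  define e e' where "e = exp \<beta>" and "e' = exp (- \<beta>)"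
  have inv: "e * e' = 1" by (simp add: e_def e'_def exp_add[symmetric])
  have pos: "e > 0" "e' > 0" "e' < e" using \<beta> by (simp_all add: e_def e'_def)
  have h: "cavity_field p \<beta> 0 = 0" by (rule cavity_field_eqI[OF assms]) (simp add: force_def)
  have e4: "exp (- 4 * \<beta>) = (e'\<^sup>2)\<^sup>2" by (simp add: e'_def power2_eq_square exp_add[symmetric])
  have e2: "exp (- 2 * \<beta>) = e'\<^sup>2" by (simp add: e'_def power2_eq_square exp_add[symmetric])
  have "lambda_plus \<beta> 0 = e * (1 + e'\<^sup>2)" 
    unfolding lambda_plus_def e4 e_def[symmetric] by (simp only: cosh_0 sinh_0 zero_power2 add_0_left real_sqrt_abs abs_power2)
  also have "\<dots> = e + (e * e') * e'" by (simp add: power2_eq_square algebra_simps)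
  finally have l: "lambda_plus \<beta> 0 = e + e'" unfolding inv by simp
  have A: "A_plus \<beta> 0 = 2 / (e + e')"
  proof -
    have "A_plus \<beta> 0 = (2 * (2 * e'\<^sup>2)) / ((e + e') * (2 * e'\<^sup>2))"
      unfolding A_plus_def l e2 by (simp add: e_def[symmetric] e'_def[symmetric] power2_eq_square)
    also have "\<dots> = 2 / (e + e')" by (rule nonzero_mult_divide_mult_cancel_right) (use pos in simp)
    finally show ?thesis .
  qed
  have "1 - e'\<^sup>2 = (e - e') / e"
    using pos inv by (simp add: field_simps power2_eq_square)
  moreover have "e\<^sup>2 - e'\<^sup>2 = (e + e') * (e - e')" by (simp add: power2_eq_square algebra_simps)
  ultimately have "ln (1 - e'\<^sup>2) = ln (e - e') - ln e" "ln (e / (e\<^sup>2 - e'\<^sup>2)) = ln e - ln (e + e') - ln (e - e')"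
    using pos by (simp_all add: ln_div ln_mult)
  moreover have "pressure p \<beta> 0 = - ((1 + p) / 2 * ln (1 - e'\<^sup>2))"
    unfolding pressure_def free_energy_def h e2
    by (simp add: minus_mult_left[symmetric])
  moreover have "ln (A_plus \<beta> 0) = ln 2 - ln (e + e')" unfolding A using pos by (simp add: ln_div)
  ultimately show ?thesis
    unfolding True l e_def[symmetric] e'_def[symmetric] by (simp add: I_fun_def) (simp add: field_simps)
qed (rule I_fun_eq_pressure_nonzero[OF assms])

section \<open>Laplace's method\<close>

lemma integrable_affine_gaussian:
  fixes a b :: real
  shows "integrable lborel (\<lambda>x. (a + b * \<bar>x\<bar>) * exp (- x\<^sup>2 / 4))"
proof -
  have d: "normal_density 0 (sqrt 2) x = exp (- x\<^sup>2 / 4) / sqrt (4 * pi)" for x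
    by (simp add: normal_density_def)
  have "integrable lborel (\<lambda>x. sqrt (4 * pi) * a * (normal_density 0 (sqrt 2) x * \<bar>x - 0\<bar> ^ 0)
      + sqrt (4 * pi) * b * (normal_density 0 (sqrt 2) x * \<bar>x - 0\<bar> ^ 1))"
    by (intro Bochner_Integration.integrable_add integrable_mult_right integrable_normal_moment_abs) auto
  also have "(\<lambda>x. sqrt (4 * pi) * a * (normal_density 0 (sqrt 2) x * \<bar>x - 0\<bar> ^ 0)
      + sqrt (4 * pi) * b * (normal_density 0 (sqrt 2) x * \<bar>x - 0\<bar> ^ 1)) = (\<lambda>x. (a + b * \<bar>x\<bar>) * exp (- x\<^sup>2 / 4))"
    unfolding d by (rule ext) (simp add: algebra_simps)
  finally show ?thesis .
qed

lemma tendsto_mult_exp_minus: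
  fixes T :: "nat \<Rightarrow> real"
  assumes "filterlim T at_top sequentially" "\<eta> > 0"
  shows "(\<lambda>k. T k * exp (- (\<eta> * T k))) \<longlonglongrightarrow> 0"
proof -
  have "filterlim (\<lambda>k. \<eta> * T k) at_top sequentially"
    using assms by (simp add: filterlim_tendsto_pos_mult_at_top[OF tendsto_const])
  moreover have "((\<lambda>x::real. x ^ 1 / exp x) \<longlongrightarrow> 0) at_top" by (rule tendsto_power_div_exp_0)
  ultimately have "(\<lambda>k. (\<eta> * T k) ^ 1 / exp (\<eta> * T k)) \<longlonglongrightarrow> 0" by (rule filterlim_compose[rotated])
  then have "(\<lambda>k. (1 / \<eta>) * ((\<eta> * T k) ^ 1 / exp (\<eta> * T k))) \<longlonglongrightarrow> (1 / \<eta>) * 0" by (rule tendsto_mult_left)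
  then show ?thesis using assms(2) by (simp add: exp_minus field_simps)
qed

text \<open>The weights \<open>\<mu> k\<close> concentrate at \<open>w0\<close> on the scale \<open>1 / sqrt (\<gamma> T)\<close>. After rescaling, the part near
  \<open>w0\<close> converges by dominated convergence, with the majorant provided by half of the quadratic decay; the
  part away from \<open>w0\<close> is of order \<open>T exp (- \<eta> T)\<close>. The bounded perturbation \<open>\<delta> X\<close> of the exponent has no
  limit along the sequence, but it is asymptotically constant near \<open>w0\<close> and is divided out with
  \<open>\<mu> k w0\<close>. The factor \<open>sqrt T\<close> allowed in the bounds on \<open>G\<close> and \<open>f\<close> accommodates
  rescaled sums as well as characteristic functions.\<close>

lemma laplace_method:
  fixes \<Psi> X \<omega> :: "real \<Rightarrow> real" and T \<delta> :: "nat \<Rightarrow> real" and w0 \<gamma> C CX :: real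
    and G f :: "nat \<Rightarrow> real \<Rightarrow> 'b::{banach, second_countable_topology}" and \<phi> :: "real \<Rightarrow> 'b"
  defines "\<mu> \<equiv> \<lambda>k w. exp (T k * \<Psi> w + \<delta> k * X w) * \<omega> w"
  assumes T: "filterlim T at_top sequentially" and \<delta>: "\<And>k. \<bar>\<delta> k\<bar> \<le> 1"
    and X: "\<And>w. \<bar>X w\<bar> \<le> CX" "isCont X w0"
    and \<omega>: "\<And>w. \<omega> w \<ge> 0" "\<omega> w0 > 0" "isCont \<omega> w0" "integrable lborel \<omega>"
    and \<gamma>: "\<gamma> > 0" and quad: "((\<lambda>w. (\<Psi> w - \<Psi> w0) / (w - w0)\<^sup>2) \<longlongrightarrow> - \<gamma> / 2) (at w0)"
    and gap: "\<And>\<epsilon>. \<epsilon> > 0 \<Longrightarrow> \<exists>\<eta>>0. \<forall>w. \<bar>w - w0\<bar> \<ge> \<epsilon> \<longrightarrow> \<Psi> w \<le> \<Psi> w0 - \<eta>"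
    and meas: "\<And>k. G k \<in> borel_measurable borel" "\<phi> \<in> borel_measurable borel"
    and C: "C \<ge> 0" and far: "\<forall>\<^sub>F k in sequentially. \<forall>w. norm (G k w) \<le> C * sqrt (T k) * \<mu> k w"
    and near: "\<exists>\<epsilon>>0. \<forall>k w. \<bar>w - w0\<bar> < \<epsilon> \<longrightarrow> G k w = \<mu> k w *\<^sub>R f k w \<and> norm (f k w) \<le> C * (1 + sqrt (T k) * \<bar>w - w0\<bar>)"
    and lim: "\<And>x. (\<lambda>k. f k (w0 + x / sqrt (\<gamma> * T k))) \<longlonglongrightarrow> \<phi> x"
  shows "(\<lambda>k. (sqrt (\<gamma> * T k) / \<mu> k w0) *\<^sub>R (\<integral>w. G k w \<partial>lborel)) \<longlonglongrightarrow> (\<integral>x. exp (- x\<^sup>2 / 2) *\<^sub>R \<phi> x \<partial>lborel)"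
proof -
  obtain \<epsilon>1 where \<epsilon>1: "\<epsilon>1 > 0" "\<And>k w. \<bar>w - w0\<bar> < \<epsilon>1 \<Longrightarrow> G k w = \<mu> k w *\<^sub>R f k w"
    "\<And>k w. \<bar>w - w0\<bar> < \<epsilon>1 \<Longrightarrow> norm (f k w) \<le> C * (1 + sqrt (T k) * \<bar>w - w0\<bar>)"
    using near by blast
  have "\<forall>\<^sub>F w in at w0. (\<Psi> w - \<Psi> w0) / (w - w0)\<^sup>2 < - \<gamma> / 4"
    by (rule order_tendstoD(2)[OF quad]) (use \<gamma> in simp)
  then obtain \<epsilon>2 where \<epsilon>2: "\<epsilon>2 > 0" "\<And>w. w \<noteq> w0 \<Longrightarrow> \<bar>w - w0\<bar> < \<epsilon>2 \<Longrightarrow> (\<Psi> w - \<Psi> w0) / (w - w0)\<^sup>2 < - \<gamma> / 4"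
    unfolding eventually_at dist_real_def by auto
  have "\<forall>\<^sub>F w in at w0. \<omega> w < 2 * \<omega> w0"
    using \<omega>(2,3) by (intro order_tendstoD(2)[of \<omega>]) (auto simp: isCont_def)
  then obtain \<epsilon>3 where \<epsilon>3: "\<epsilon>3 > 0" "\<And>w. w \<noteq> w0 \<Longrightarrow> \<bar>w - w0\<bar> < \<epsilon>3 \<Longrightarrow> \<omega> w < 2 * \<omega> w0"
    unfolding eventually_at dist_real_def by auto
  define \<epsilon> where "\<epsilon> = min \<epsilon>1 (min \<epsilon>2 \<epsilon>3)"
  have \<epsilon>: "\<epsilon> > 0" "\<epsilon> \<le> \<epsilon>1" "\<epsilon> \<le> \<epsilon>2" "\<epsilon> \<le> \<epsilon>3" using \<epsilon>1 \<epsilon>2 \<epsilon>3 by (auto simp: \<epsilon>_def)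
  \<comment> \<open>Half of the limiting curvature is kept on a whole neighbourhood.\<close>
  have quad_le: "\<Psi> w - \<Psi> w0 \<le> - \<gamma> / 4 * (w - w0)\<^sup>2" if "\<bar>w - w0\<bar> < \<epsilon>" for w
  proof (cases "w = w0")
    case False
    then have "(\<Psi> w - \<Psi> w0) / (w - w0)\<^sup>2 < - \<gamma> / 4" using \<epsilon>2(2) \<epsilon> that by simp
    moreover have "(w - w0)\<^sup>2 > 0" using False by simp
    ultimately have "\<Psi> w - \<Psi> w0 < - \<gamma> / 4 * (w - w0)\<^sup>2" by (simp only: pos_divide_less_eq)
    then show ?thesis by simp
  qed simp
  have \<omega>_le: "\<omega> w \<le> 2 * \<omega> w0" if "\<bar>w - w0\<bar> < \<epsilon>" for w
    using \<epsilon>3(2)[of w] \<epsilon> that \<omega>(2) by (cases "w = w0") auto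
  obtain \<eta> where \<eta>: "\<eta> > 0" "\<And>w. \<bar>w - w0\<bar> \<ge> \<epsilon> \<Longrightarrow> \<Psi> w \<le> \<Psi> w0 - \<eta>"
    using gap[OF \<epsilon>(1)] by blast
  define s where "s k = sqrt (\<gamma> * T k)" for k
  have CX: "CX \<ge> 0" using X(1)[of 0] by linarith
  have \<delta>X: "\<delta> k * (X w - X w0) \<le> 2 * CX" for k w
  proof -
    have "\<delta> k * (X w - X w0) \<le> \<bar>\<delta> k\<bar> * \<bar>X w - X w0\<bar>" by (metis abs_ge_self abs_mult)
    also have "\<dots> \<le> 1 * (2 * CX)"
      using \<delta>[of k] X(1)[of w] X(1)[of w0] by (intro mult_mono) auto
    finally show ?thesis by simp
  qed
  have \<mu>0: "\<mu> k w0 > 0" for k using \<omega>(2) by (simp add: \<mu>_def)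
  have ratio: "\<mu> k w / \<mu> k w0 = exp (T k * (\<Psi> w - \<Psi> w0) + \<delta> k * (X w - X w0)) * (\<omega> w / \<omega> w0)" for k w
    by (simp add: \<mu>_def algebra_simps exp_add exp_diff)
  have Tpos: "\<forall>\<^sub>F k in sequentially. T k \<ge> 1" using T by (auto simp: filterlim_at_top)
  have slim: "filterlim s at_top sequentially"
    unfolding s_def using T \<gamma>
    by (intro filterlim_compose[OF sqrt_at_top] filterlim_tendsto_pos_mult_at_top[OF tendsto_const])
  have wlim: "(\<lambda>k. w0 + x / s k) \<longlonglongrightarrow> w0" for x
  proof -
    have "(\<lambda>k. x / s k) \<longlonglongrightarrow> 0" by (rule tendsto_divide_0[OF tendsto_const filterlim_at_top_imp_at_infinity[OF slim]])
    then show ?thesis using tendsto_add[OF tendsto_const, of "\<lambda>k. x / s k" 0 sequentially w0] by simp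
  qed
  define S where "S k = {x. \<bar>x\<bar> < \<epsilon> * s k}" for k
  define h where "h k x = (1 / \<mu> k w0) *\<^sub>R G k (w0 + x / s k)" for k x
  have Smeas[measurable]: "S k \<in> sets borel" for k unfolding S_def by measurable
  have hmeas[measurable]: "h k \<in> borel_measurable borel" for k
    unfolding h_def using meas(1)[of k] by measurable
  note meas(2)[measurable]
  define bound where "bound x = (C * exp (2 * CX) * 2) * (1 + 1 / sqrt \<gamma> * \<bar>x\<bar>) * exp (- x\<^sup>2 / 4)" for x
  have bound_int: "integrable lborel bound"
    unfolding bound_def using integrable_affine_gaussian[of 1 "1 / sqrt \<gamma>"]
    by (simp only: mult.assoc integrable_mult_right)
  have dom: "norm (indicator (S k) x *\<^sub>R h k x) \<le> bound x" if "T k \<ge> 1" for k x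
  proof (cases "x \<in> S k")
    case True
    have sk: "s k > 0" using that \<gamma> by (simp add: s_def)
    define w where "w = w0 + x / s k"
    have w: "\<bar>w - w0\<bar> < \<epsilon>" using True sk by (simp add: S_def w_def field_simps)
    have x: "\<bar>w - w0\<bar> = \<bar>x\<bar> / s k" using sk by (simp add: w_def)
    have "T k * (\<Psi> w - \<Psi> w0) \<le> T k * (- \<gamma> / 4 * (w - w0)\<^sup>2)"
      by (rule mult_left_mono[OF quad_le[OF w]]) (use that in simp)
    also have "(w - w0)\<^sup>2 = x\<^sup>2 / (\<gamma> * T k)" using that \<gamma> by (simp add: w_def power_divide s_def)
    also have "T k * (- \<gamma> / 4 * (x\<^sup>2 / (\<gamma> * T k))) = - x\<^sup>2 / 4" using that \<gamma> by simp
    finally have "exp (T k * (\<Psi> w - \<Psi> w0) + \<delta> k * (X w - X w0)) \<le> exp (- x\<^sup>2 / 4 + 2 * CX)"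
      using \<delta>X[of k w] by simp
    moreover have "\<omega> w / \<omega> w0 \<le> 2" using \<omega>_le[OF w] \<omega>(2) by (simp add: field_simps)
    ultimately have "\<mu> k w / \<mu> k w0 \<le> exp (- x\<^sup>2 / 4 + 2 * CX) * 2"
      unfolding ratio by (intro mult_mono) (use \<omega> in auto)
    moreover have "norm (f k w) \<le> C * (1 + 1 / sqrt \<gamma> * \<bar>x\<bar>)"
    proof -
      have "norm (f k w) \<le> C * (1 + sqrt (T k) * \<bar>w - w0\<bar>)" using \<epsilon>1(3) w \<epsilon> by simp
      also have "sqrt (T k) * \<bar>w - w0\<bar> = 1 / sqrt \<gamma> * \<bar>x\<bar>"
        unfolding x s_def using that \<gamma> by (simp add: real_sqrt_mult)
      finally show ?thesis .
    qed
    ultimately have "\<mu> k w / \<mu> k w0 * norm (f k w) \<le> (exp (- x\<^sup>2 / 4 + 2 * CX) * 2) * (C * (1 + 1 / sqrt \<gamma> * \<bar>x\<bar>))"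
      by (intro mult_mono) auto
    moreover have "norm (h k x) = \<mu> k w / \<mu> k w0 * norm (f k w)"
    proof -
      have "\<mu> k w \<ge> 0" using \<omega> by (simp add: \<mu>_def)
      then show ?thesis using \<mu>0[of k] \<epsilon>1(2)[of w k] w \<epsilon> by (simp add: h_def w_def)
    qed
    moreover have "(exp (- x\<^sup>2 / 4 + 2 * CX) * 2) * (C * (1 + 1 / sqrt \<gamma> * \<bar>x\<bar>)) = bound x"
      by (simp only: bound_def exp_add mult_ac)
    ultimately show ?thesis using True by simp
  next
    case False
    then show ?thesis using C CX \<gamma> by (simp add: bound_def)
  qed
  have ptw: "(\<lambda>k. indicator (S k) x *\<^sub>R h k x) \<longlonglongrightarrow> exp (- x\<^sup>2 / 2) *\<^sub>R \<phi> x" for x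
  proof -
    define w where "w k = w0 + x / s k" for k
    have wl: "w \<longlonglongrightarrow> w0" using wlim[of x] unfolding w_def[abs_def] .
    have 1: "(\<lambda>k. T k * (\<Psi> (w k) - \<Psi> w0)) \<longlonglongrightarrow> - x\<^sup>2 / 2"
    proof (cases "x = 0")
      case False
      have "filterlim w (at w0) sequentially"
        unfolding filterlim_at
      proof (intro conjI wl)
        show "\<forall>\<^sub>F k in sequentially. w k \<in> UNIV \<and> w k \<noteq> w0"
          using Tpos by eventually_elim (use False \<gamma> in \<open>auto simp: w_def s_def\<close>)
      qed
      then have "(\<lambda>k. x\<^sup>2 / \<gamma> * ((\<Psi> (w k) - \<Psi> w0) / (w k - w0)\<^sup>2)) \<longlonglongrightarrow> x\<^sup>2 / \<gamma> * (- \<gamma> / 2)"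
        by (intro tendsto_mult_left filterlim_compose[OF quad])
      moreover have "\<forall>\<^sub>F k in sequentially. x\<^sup>2 / \<gamma> * ((\<Psi> (w k) - \<Psi> w0) / (w k - w0)\<^sup>2) = T k * (\<Psi> (w k) - \<Psi> w0)"
        using Tpos by eventually_elim (use False \<gamma> in \<open>simp add: w_def power_divide s_def\<close>)
      ultimately show ?thesis using \<gamma> by (simp add: tendsto_cong)
    qed (simp add: w_def)
    have 2: "(\<lambda>k. \<delta> k * (X (w k) - X w0)) \<longlonglongrightarrow> 0"
    proof (rule Lim_null_comparison)
      have "(\<lambda>k. X (w k)) \<longlonglongrightarrow> X w0" using X(2) wl by (rule isCont_tendsto_compose)
      then show "(\<lambda>k. \<bar>X (w k) - X w0\<bar>) \<longlonglongrightarrow> 0" by (simp add: LIM_zero_iff tendsto_rabs_zero_iff)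
      show "\<forall>\<^sub>F k in sequentially. norm (\<delta> k * (X (w k) - X w0)) \<le> \<bar>X (w k) - X w0\<bar>"
        by (intro always_eventually allI) (use \<delta> in \<open>simp add: abs_mult mult_left_le_one_le\<close>)
    qed
    have 3: "(\<lambda>k. \<omega> (w k) / \<omega> w0) \<longlonglongrightarrow> 1"
      using tendsto_divide[OF isCont_tendsto_compose[OF \<omega>(3) wl] tendsto_const, of "\<omega> w0"] \<omega>(2) by simp
    have "(\<lambda>k. \<mu> k (w k) / \<mu> k w0) \<longlonglongrightarrow> exp (- x\<^sup>2 / 2 + 0) * 1"
      unfolding ratio by (intro tendsto_mult tendsto_exp tendsto_add 1 2 3)
    moreover have "(\<lambda>k. f k (w k)) \<longlonglongrightarrow> \<phi> x" using lim[of x] by (simp add: w_def s_def)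
    ultimately have "(\<lambda>k. (\<mu> k (w k) / \<mu> k w0) *\<^sub>R f k (w k)) \<longlonglongrightarrow> exp (- x\<^sup>2 / 2) *\<^sub>R \<phi> x"
      by (intro tendsto_scaleR) simp_all
    moreover have "\<forall>\<^sub>F k in sequentially. (\<mu> k (w k) / \<mu> k w0) *\<^sub>R f k (w k) = indicator (S k) x *\<^sub>R h k x"
    proof -
      have "\<forall>\<^sub>F k in sequentially. s k > \<bar>x\<bar> / \<epsilon>" using slim by (auto simp: filterlim_at_top_dense)
      then show ?thesis
      proof eventually_elim
        case (elim k)
        moreover have "\<bar>x\<bar> / \<epsilon> \<ge> 0" using \<epsilon> by simp
        ultimately have "s k > 0" by linarith
        with elim have sk: "s k > 0" "\<bar>x\<bar> < \<epsilon> * s k" using \<epsilon> by (auto simp: field_simps)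
        then have "\<bar>w k - w0\<bar> < \<epsilon>" by (simp add: w_def field_simps)
        then have "G k (w k) = \<mu> k (w k) *\<^sub>R f k (w k)" using \<epsilon>1(2) \<epsilon> by simp
        then show ?case using sk by (simp add: S_def h_def w_def)
      qed
    qed
    ultimately show ?thesis by (rule Lim_transform_eventually)
  qed
  obtain k0 where k0: "\<And>k. k \<ge> k0 \<Longrightarrow> T k \<ge> 1 \<and> (\<forall>w. norm (G k w) \<le> C * sqrt (T k) * \<mu> k w)"
    using eventually_conj[OF Tpos far] unfolding eventually_sequentially by blast
  have main: "(\<lambda>k. \<integral>x. indicator (S (k + k0)) x *\<^sub>R h (k + k0) x \<partial>lborel) \<longlonglongrightarrow> (\<integral>x. exp (- x\<^sup>2 / 2) *\<^sub>R \<phi> x \<partial>lborel)"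
  proof (rule integral_dominated_convergence[where w=bound])
    show "integrable lborel bound" by (rule bound_int)
    show "AE x in lborel. (\<lambda>k. indicator (S (k + k0)) x *\<^sub>R h (k + k0) x) \<longlonglongrightarrow> exp (- x\<^sup>2 / 2) *\<^sub>R \<phi> x"
      by (intro AE_I2 LIMSEQ_ignore_initial_segment ptw)
    show "\<And>k. AE x in lborel. norm (indicator (S (k + k0)) x *\<^sub>R h (k + k0) x) \<le> bound x"
      by (intro AE_I2 dom) (use k0 in auto)
  qed measurable
  define K where "K k = C * sqrt (T k) * exp (- (\<eta> * T k) + 2 * CX) / \<omega> w0" for k
  have farle: "norm (indicator (- S k) x *\<^sub>R h k x) \<le> K k * \<omega> (w0 + x / s k)" if "k \<ge> k0" for k x
  proof (cases "x \<in> S k")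
    case True
    then show ?thesis using C \<omega> k0[OF that] by (simp add: K_def)
  next
    case False
    define w where "w = w0 + x / s k"
    have Tk: "T k \<ge> 1" "norm (G k w) \<le> C * sqrt (T k) * \<mu> k w" using k0[OF that] by auto
    have sk: "s k > 0" using Tk \<gamma> by (simp add: s_def)
    have "\<bar>w - w0\<bar> \<ge> \<epsilon>" using False sk by (simp add: w_def S_def field_simps)
    then have "T k * (\<Psi> w - \<Psi> w0) \<le> T k * (- \<eta>)" using \<eta>(2)[of w] Tk by (intro mult_left_mono) auto
    then have e: "exp (T k * (\<Psi> w - \<Psi> w0) + \<delta> k * (X w - X w0)) \<le> exp (- (\<eta> * T k) + 2 * CX)"
      using \<delta>X[of k w] by (simp add: mult.commute)
    have "norm (h k x) = norm (G k w) / \<mu> k w0" using \<mu>0[of k] by (simp add: h_def w_def)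
    also have "\<dots> \<le> C * sqrt (T k) * \<mu> k w / \<mu> k w0" using Tk \<mu>0[of k] by (simp add: divide_right_mono)
    also have "\<dots> = C * sqrt (T k) * (\<mu> k w / \<mu> k w0)" by simp
    also have "\<dots> \<le> C * sqrt (T k) * (exp (- (\<eta> * T k) + 2 * CX) * (\<omega> w / \<omega> w0))"
      unfolding ratio using e C Tk \<omega> by (intro mult_left_mono mult_right_mono) auto
    also have "\<dots> = K k * \<omega> w" by (simp add: K_def)
    finally show ?thesis using False by (simp add: w_def)
  qed
  have farint: "integrable lborel (\<lambda>x. K k * \<omega> (w0 + x / s k))" if "k \<ge> k0" for k
  proof -
    have "s k > 0" using k0[OF that] \<gamma> by (simp add: s_def)
    then have "integrable lborel (\<lambda>x. \<omega> (w0 + (1 / s k) * x))"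
      by (intro lborel_integrable_real_affine \<omega>) auto
    then show ?thesis by (intro integrable_mult_right) simp
  qed
  have farI: "integrable lborel (\<lambda>x. indicator (- S k) x *\<^sub>R h k x)" if "k \<ge> k0" for k
  proof (rule Bochner_Integration.integrable_bound[OF farint[OF that]])
    show "AE x in lborel. norm (indicator (- S k) x *\<^sub>R h k x) \<le> norm (K k * \<omega> (w0 + x / s k))"
      by (intro AE_I2 order_trans[OF farle[OF that]]) simp
  qed measurable
  have farbound: "norm (\<integral>x. indicator (- S k) x *\<^sub>R h k x \<partial>lborel) \<le> K k * s k * (\<integral>w. \<omega> w \<partial>lborel)" if "k \<ge> k0" for k
  proof -
    have sk: "s k > 0" using k0[OF that] \<gamma> by (simp add: s_def)
    have "norm (\<integral>x. indicator (- S k) x *\<^sub>R h k x \<partial>lborel) \<le> (\<integral>x. K k * \<omega> (w0 + x / s k) \<partial>lborel)"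
      by (rule Bochner_Integration.integral_norm_bound_integral[OF farI[OF that] farint[OF that]]) (rule farle[OF that])
    also have "\<dots> = K k * (\<integral>x. \<omega> (w0 + x / s k) \<partial>lborel)" by simp
    also have "(\<integral>x. \<omega> (w0 + x / s k) \<partial>lborel) = s k * (\<integral>w. \<omega> w \<partial>lborel)"
      using lborel_integral_real_affine[of "1 / s k" \<omega> w0] sk by simp
    finally show ?thesis by simp
  qed
  have farlim: "(\<lambda>k. \<integral>x. indicator (- S (k + k0)) x *\<^sub>R h (k + k0) x \<partial>lborel) \<longlonglongrightarrow> 0"
  proof (rule Lim_null_comparison)
    show "\<forall>\<^sub>F k in sequentially. norm (\<integral>x. indicator (- S (k + k0)) x *\<^sub>R h (k + k0) x \<partial>lborel) \<le> K (k + k0) * s (k + k0) * (\<integral>w. \<omega> w \<partial>lborel)"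
      by (intro always_eventually allI farbound) simp
    define c where "c = C * exp (2 * CX) / \<omega> w0 * sqrt \<gamma> * (\<integral>w. \<omega> w \<partial>lborel)"
    have "(\<lambda>k. c * (T k * exp (- (\<eta> * T k)))) \<longlonglongrightarrow> c * 0"
      by (intro tendsto_mult_left tendsto_mult_exp_minus T \<eta>)
    then have "(\<lambda>k. c * (T (k + k0) * exp (- (\<eta> * T (k + k0))))) \<longlonglongrightarrow> 0"
      by (intro LIMSEQ_ignore_initial_segment) simp
    moreover have "c * (T k * exp (- (\<eta> * T k))) = K k * s k * (\<integral>w. \<omega> w \<partial>lborel)" if "k \<ge> k0" for k
    proof -
      have Tk: "T k = sqrt (T k) * sqrt (T k)" using k0[OF that] by simp
      have "s k = sqrt \<gamma> * sqrt (T k)" by (simp add: s_def real_sqrt_mult)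
      then have "K k * s k * (\<integral>w. \<omega> w \<partial>lborel) = c * ((sqrt (T k) * sqrt (T k)) * exp (- (\<eta> * T k)))"
        by (simp only: K_def c_def exp_add) (simp add: algebra_simps)
      then show ?thesis using Tk by simp
    qed
    ultimately show "(\<lambda>k. K (k + k0) * s (k + k0) * (\<integral>w. \<omega> w \<partial>lborel)) \<longlonglongrightarrow> 0" by simp
  qed
  have eq: "(sqrt (\<gamma> * T k) / \<mu> k w0) *\<^sub>R (\<integral>w. G k w \<partial>lborel) =
     (\<integral>x. indicator (S k) x *\<^sub>R h k x \<partial>lborel) + (\<integral>x. indicator (- S k) x *\<^sub>R h k x \<partial>lborel)" if "k \<ge> k0" for k
  proof -
    have sk: "s k > 0" using k0[OF that] \<gamma> by (simp add: s_def)
    have "integrable lborel (\<lambda>x. indicator (S k) x *\<^sub>R h k x)"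
    proof (rule Bochner_Integration.integrable_bound[OF bound_int])
      show "AE x in lborel. norm (indicator (S k) x *\<^sub>R h k x) \<le> norm (bound x)"
        by (intro AE_I2 order_trans[OF dom]) (use k0[OF that] in auto)
    qed measurable
    moreover note farI[OF that]
    ultimately have "(\<integral>x. indicator (S k) x *\<^sub>R h k x \<partial>lborel) + (\<integral>x. indicator (- S k) x *\<^sub>R h k x \<partial>lborel)
       = (\<integral>x. indicator (S k) x *\<^sub>R h k x + indicator (- S k) x *\<^sub>R h k x \<partial>lborel)" by simp
    also have "\<dots> = (\<integral>x. h k x \<partial>lborel)"
      by (rule Bochner_Integration.integral_cong) (auto split: split_indicator)
    also have "\<dots> = (1 / \<mu> k w0) *\<^sub>R (\<integral>x. G k (w0 + (1 / s k) * x) \<partial>lborel)"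
      by (simp add: h_def)
    also have "(\<integral>x. G k (w0 + (1 / s k) * x) \<partial>lborel) = s k *\<^sub>R (\<integral>w. G k w \<partial>lborel)"
      using lborel_integral_real_affine[of "1 / s k" "G k" w0] sk by simp
    finally show ?thesis by (simp add: s_def)
  qed
  have "(\<lambda>k. (\<integral>x. indicator (S (k + k0)) x *\<^sub>R h (k + k0) x \<partial>lborel) + (\<integral>x. indicator (- S (k + k0)) x *\<^sub>R h (k + k0) x \<partial>lborel))
     \<longlonglongrightarrow> (\<integral>x. exp (- x\<^sup>2 / 2) *\<^sub>R \<phi> x \<partial>lborel) + 0"
    by (rule tendsto_add[OF main farlim])
  then have "(\<lambda>k. (sqrt (\<gamma> * T (k + k0)) / \<mu> (k + k0) w0) *\<^sub>R (\<integral>w. G (k + k0) w \<partial>lborel)) \<longlonglongrightarrow> (\<integral>x. exp (- x\<^sup>2 / 2) *\<^sub>R \<phi> x \<partial>lborel)"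
    by (simp add: eq)
  then show ?thesis by (rule LIMSEQ_offset)
qed

section \<open>The integrand of the mixture\<close>

text \<open>The weight of a leaf summed over its spin. The absolute values are the identity for \<open>|w| \<le> 1\<close>; outside they
  make it an upper bound for the signed weights.\<close>

definition end_weight :: "real \<Rightarrow> real \<Rightarrow> real" where
  "end_weight B w = exp B * \<bar>1 + w\<bar> + exp (- B) * \<bar>1 - w\<bar>"

definition bulk_weight :: "real \<Rightarrow> real \<Rightarrow> real" where
  "bulk_weight B w = exp B * (1 + w)\<^sup>2 + exp (- B) * (1 - w)\<^sup>2"

text \<open>The exponential rate of the mixture density per vertex, in the original coordinate \<open>w\<close>.\<close>

definition exponent :: "real \<Rightarrow> real \<Rightarrow> real \<Rightarrow> real \<Rightarrow> real" where
  "exponent p \<beta> B w = (1 - p) * ln (end_weight B w) + p * ln (bulk_weight B w)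
     - (1 + p) / 2 * ln (tanh \<beta> + w\<^sup>2)"

text \<open>The derivative of the logarithm of the mixture density with respect to turning a vertex of degree 2
  into a leaf; it takes care of the rounding of \<open>p N\<close>.\<close>

definition correction :: "real \<Rightarrow> real \<Rightarrow> real \<Rightarrow> real" where
  "correction \<beta> B w = ln (end_weight B w) - ln (bulk_weight B w) + ln (tanh \<beta> + w\<^sup>2) / 2"

lemma end_weight_pos: "end_weight B w > 0"
proof (cases "1 + w = 0")
  case False
  then show ?thesis unfolding end_weight_def by (intro add_pos_nonneg) auto
next
  case True
  then have "1 - w = 2" by simp
  then show ?thesis unfolding end_weight_def by (simp add: add_nonneg_pos)
qed

lemma bulk_weight_pos: "bulk_weight B w > 0"
proof (cases "1 + w = 0")
  case False
  then show ?thesis unfolding bulk_weight_def by (intro add_pos_nonneg) auto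
next
  case True
  then have "1 - w = 2" by simp
  then show ?thesis unfolding bulk_weight_def by (simp add: add_nonneg_pos)
qed

lemma tanh_add_square_pos: "\<beta> > 0 \<Longrightarrow> tanh \<beta> + w\<^sup>2 > (0::real)"
  by (simp add: add_pos_nonneg)

text \<open>The square of \<open>end_weight\<close>, \<open>bulk_weight\<close> and \<open>tanh \<beta> + w\<^sup>2\<close> are comparable up to constants.\<close>

lemma abs_correction_le:
  assumes "\<beta> > 0" shows "\<exists>C. \<forall>w. \<bar>correction \<beta> B w\<bar> \<le> C"
proof -
  define k where "k = tanh \<beta>"
  have k: "0 < k" "k < 1" using assms tanh_real_lt_1 by (simp_all add: k_def)
  \<comment> \<open>The numbers \<open>exp B\<close> and \<open>exp (- B)\<close>, which are inverse to each other, lie in \<open>[1 / s, s]\<close>.\<close>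
  define s where "s = exp \<bar>B\<bar>"
  have s: "s \<ge> 1" by (simp add: s_def)
  have sB: "exp B \<le> s" "exp (- B) \<le> s" "1 \<le> s * exp B" "1 \<le> s * exp (- B)"
    by (simp_all add: s_def exp_add[symmetric] del: exp_minus)
  have bounds: "a\<^sup>2 \<le> (2 * s) * b" "b \<le> s^3 * a\<^sup>2" "b \<le> (2 * s / k) * c" "c \<le> s * b"
    if "a = end_weight B w" "b = bulk_weight B w" "c = k + w\<^sup>2" for a b c w
  proof -
    define u v where "u = \<bar>1 + w\<bar>" and "v = \<bar>1 - w\<bar>"
    have uv: "u \<ge> 0" "v \<ge> 0" "u\<^sup>2 + v\<^sup>2 = 2 + 2 * w\<^sup>2" by (simp_all add: u_def v_def power2_eq_square algebra_simps)
    have a: "a = exp B * u + exp (- B) * v" using that by (simp add: end_weight_def u_def v_def)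
    have b: "b = exp B * u\<^sup>2 + exp (- B) * v\<^sup>2" using that by (simp add: bulk_weight_def u_def v_def)
    have inv: "exp B * exp (- B) = 1" by (simp add: exp_add[symmetric])
    have "(exp B + exp (- B)) * b - a\<^sup>2 = (exp B * exp (- B)) * (u - v)\<^sup>2"
      unfolding a b by (simp add: power2_eq_square algebra_simps)
    then have "a\<^sup>2 \<le> (exp B + exp (- B)) * b" unfolding inv by (smt (verit) zero_le_power2)
    also have "\<dots> \<le> (2 * s) * b" using sB bulk_weight_pos[of B w] that by (intro mult_right_mono) auto
    finally show "a\<^sup>2 \<le> (2 * s) * b" .
    have "u\<^sup>2 \<le> (s * (exp B * u))\<^sup>2" "v\<^sup>2 \<le> (s * (exp (- B) * v))\<^sup>2"
      using mult_right_mono[OF sB(3) uv(1)] mult_right_mono[OF sB(4) uv(2)] uv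
      by (auto intro!: power_mono simp: mult.assoc)
    then have "u\<^sup>2 + v\<^sup>2 \<le> (s * (exp B * u))\<^sup>2 + (s * (exp (- B) * v))\<^sup>2" by simp
    also have "\<dots> \<le> (s * (exp B * u) + s * (exp (- B) * v))\<^sup>2"
      using uv s by (simp add: power2_sum)
    also have "\<dots> = s\<^sup>2 * a\<^sup>2" unfolding a by (simp add: power_mult_distrib[symmetric] distrib_left)
    finally have ua: "u\<^sup>2 + v\<^sup>2 \<le> s\<^sup>2 * a\<^sup>2" .
    have bu: "b \<le> s * (u\<^sup>2 + v\<^sup>2)" unfolding b distrib_left using sB by (intro add_mono mult_right_mono) auto
    also have "\<dots> \<le> s * (s\<^sup>2 * a\<^sup>2)" using ua s by simp
    finally show "b \<le> s^3 * a\<^sup>2" by (simp add: power2_eq_square power3_eq_cube mult_ac)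
    have "k * (2 + 2 * w\<^sup>2) \<le> 2 * c" using k mult_right_mono[of k 1 "w\<^sup>2"] that by (simp add: algebra_simps)
    then have "u\<^sup>2 + v\<^sup>2 \<le> 2 * c / k" unfolding uv using k by (simp add: field_simps)
    then have "s * (u\<^sup>2 + v\<^sup>2) \<le> s * (2 * c / k)" using s by (intro mult_left_mono) auto
    with bu have "b \<le> s * (2 * c / k)" by linarith
    then show "b \<le> (2 * s / k) * c" by (simp add: mult_ac)
    have "c \<le> u\<^sup>2 + v\<^sup>2" unfolding uv that using k zero_le_power2[of w] by linarith
    also have "\<dots> \<le> (s * exp B) * u\<^sup>2 + (s * exp (- B)) * v\<^sup>2"
      using mult_right_mono[OF sB(3), of "u\<^sup>2"] mult_right_mono[OF sB(4), of "v\<^sup>2"] by simp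
    also have "\<dots> = s * b" unfolding b by (simp add: algebra_simps)
    finally show "c \<le> s * b" .
  qed
  have "\<bar>correction \<beta> B w\<bar> \<le> ln (2 * s) + ln s + ln (s^3) + ln (2 * s / k)" for w
  proof -
    define a b c where "a = end_weight B w" and "b = bulk_weight B w" and "c = k + w\<^sup>2"
    have pos: "a > 0" "b > 0" "c > 0"
      using end_weight_pos bulk_weight_pos tanh_add_square_pos[OF assms] by (simp_all add: a_def b_def c_def k_def)
    note bd = bounds[OF a_def b_def c_def]
    have "ln (a\<^sup>2) \<le> ln ((2 * s) * b)" "ln b \<le> ln (s^3 * a\<^sup>2)" "ln b \<le> ln ((2 * s / k) * c)" "ln c \<le> ln (s * b)"
      using pos bd by (intro ln_mono; simp)+
    moreover have "ln ((2 * s) * b) = ln (2 * s) + ln b" "ln (s^3 * a\<^sup>2) = ln (s^3) + ln (a\<^sup>2)"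
      "ln ((2 * s / k) * c) = ln (2 * s / k) + ln c" "ln (s * b) = ln s + ln b"
      by (rule ln_mult_pos; use pos s k in simp)+
    moreover have "2 * correction \<beta> B w = (ln (a\<^sup>2) - ln b) + (ln c - ln b)"
      using pos by (simp add: correction_def a_def b_def c_def k_def ln_realpow)
    moreover have "ln (2 * s) \<ge> 0" "ln s \<ge> 0" "ln (s^3) \<ge> 0" "ln (2 * s / k) \<ge> 0"
      using s k by (auto simp: le_divide_eq)
    ultimately show ?thesis by linarith
  qed
  then show ?thesis by blast
qed

text \<open>The three exponents are affine in \<open>N\<close> and \<open>\<delta>\<close>, as \<open>n = (n1 + 2 n2) / 2\<close>.\<close>

lemma weight_eq_exp:
  assumes "\<beta> > 0" and n: "n1 + 2 * n2 = 2 * n" and N: "real n1 = (1 - p) * N + \<delta>" "real n2 = p * N - \<delta>"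
  shows "end_weight B w ^ n1 * bulk_weight B w ^ n2 / (tanh \<beta> + w\<^sup>2) ^ Suc n =
     exp (N * exponent p \<beta> B w + \<delta> * correction \<beta> B w) * (1 / (tanh \<beta> + w\<^sup>2))"
proof -
  define c where "c = tanh \<beta> + w\<^sup>2"
  have pos: "end_weight B w > 0" "bulk_weight B w > 0" "c > 0"
    using end_weight_pos bulk_weight_pos tanh_add_square_pos[OF assms(1)] by (simp_all add: c_def)
  have "2 * real n = real n1 + 2 * real n2" using n by linarith
  then have n': "real n = (1 + p) / 2 * N - \<delta> / 2" unfolding N by (simp add: field_simps)
  have pw: "x ^ j = exp (real j * ln x)" if "x > 0" for x :: real and j
    using that by (simp add: exp_of_nat_mult)
  have "end_weight B w ^ n1 * bulk_weight B w ^ n2 / c ^ n =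
     exp (real n1 * ln (end_weight B w) + real n2 * ln (bulk_weight B w) - real n * ln c)"
    by (simp add: exp_add exp_diff pw[OF pos(1)] pw[OF pos(2)] pw[OF pos(3)])
  also have "real n1 * ln (end_weight B w) + real n2 * ln (bulk_weight B w) - real n * ln c
     = N * exponent p \<beta> B w + \<delta> * correction \<beta> B w"
    unfolding n' N exponent_def correction_def c_def[symmetric] by (simp add: algebra_simps)
  finally have "end_weight B w ^ n1 * bulk_weight B w ^ n2 / c ^ n = exp (N * exponent p \<beta> B w + \<delta> * correction \<beta> B w)" .
  then have "end_weight B w ^ n1 * bulk_weight B w ^ n2 / c ^ n * (1 / c) =
      exp (N * exponent p \<beta> B w + \<delta> * correction \<beta> B w) * (1 / c)" by simp
  then show ?thesis unfolding c_def[symmetric] by (simp add: mult.commute)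
qed

lemma one_plus_minus_tanh:
  fixes h :: real
  shows "1 + tanh h = exp h / cosh h" "1 - tanh h = exp (- h) / cosh h"
  using cosh_real_pos[of h] by (auto simp: tanh_def cosh_plus_sinh[symmetric] cosh_minus_sinh[symmetric] field_simps)

lemma end_weight_tanh: "end_weight B (tanh h) = 2 * cosh (B + h) / cosh h"
proof -
  have "end_weight B (tanh h) = exp B * (exp h / cosh h) + exp (- B) * (exp (- h) / cosh h)"
    unfolding end_weight_def one_plus_minus_tanh by (simp add: abs_of_pos)
  also have "\<dots> = (exp B * exp h + exp (- B) * exp (- h)) / cosh h" by (simp add: add_divide_distrib)
  also have "exp B * exp h + exp (- B) * exp (- h) = 2 * cosh (B + h)"
    by (simp add: cosh_def exp_add[symmetric])
  finally show ?thesis .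
qed

lemma bulk_weight_tanh: "bulk_weight B (tanh h) = 2 * cosh (B + 2 * h) / (cosh h)\<^sup>2"
proof -
  have "bulk_weight B (tanh h) = (exp B * (exp h)\<^sup>2 + exp (- B) * (exp (- h))\<^sup>2) / (cosh h)\<^sup>2"
    unfolding bulk_weight_def one_plus_minus_tanh by (simp add: power_divide add_divide_distrib)
  also have "exp B * (exp h)\<^sup>2 + exp (- B) * (exp (- h))\<^sup>2 = 2 * cosh (B + 2 * h)"
    by (simp add: cosh_def power2_eq_square exp_add[symmetric] algebra_simps)
  finally show ?thesis .
qed

text \<open>The algebra behind the change of variables: \<open>exp (- 2 \<beta>) = (1 - tanh \<beta>) / (1 + tanh \<beta>)\<close>.\<close>

lemma denominator_tanh:
  fixes \<beta> h :: real
  shows "tanh \<beta> + (tanh h)\<^sup>2 = (1 + tanh \<beta>) / 2 * (cosh (2 * h) - exp (- 2 * \<beta>)) / (cosh h)\<^sup>2"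
proof -
  have c: "cosh h > 0" "cosh \<beta> > 0" by simp_all
  have r: "exp (- 2 * \<beta>) = (1 - tanh \<beta>) / (1 + tanh \<beta>)"
  proof -
    have "exp (- 2 * \<beta>) = exp (- \<beta> - \<beta>)" by simp
    also have "\<dots> = exp (- \<beta>) / exp \<beta>" by (rule exp_diff)
    finally show ?thesis unfolding one_plus_minus_tanh using c by simp
  qed
  have t: "1 + tanh \<beta> > 0" unfolding one_plus_minus_tanh by simp
  have "(1 + tanh \<beta>) / 2 * (cosh (2 * h) - exp (- 2 * \<beta>)) = ((1 + tanh \<beta>) * cosh (2 * h) - (1 - tanh \<beta>)) / 2"
    unfolding r using t by (simp add: field_simps)
  also have "\<dots> = tanh \<beta> * (cosh h)\<^sup>2 + (sinh h)\<^sup>2"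
    unfolding cosh_double by (simp add: cosh_square_eq algebra_simps)
  finally have "(1 + tanh \<beta>) / 2 * (cosh (2 * h) - exp (- 2 * \<beta>)) = tanh \<beta> * (cosh h)\<^sup>2 + (sinh h)\<^sup>2" .
  moreover have "tanh \<beta> + (tanh h)\<^sup>2 = (tanh \<beta> * (cosh h)\<^sup>2 + (sinh h)\<^sup>2) / (cosh h)\<^sup>2"
    using c by (simp add: tanh_def[of h] add_divide_distrib power_divide)
  ultimately show ?thesis by (simp only:)
qed

lemma exponent_tanh:
  assumes "\<beta> > 0"
  shows "exponent p \<beta> B (tanh h) = free_energy p \<beta> B h + (ln 2 - (1 + p) / 2 * ln ((1 + tanh \<beta>) / 2))"
proof -
  have t: "(1 + tanh \<beta>) / 2 > 0" unfolding one_plus_minus_tanh by simp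
  have u: "cosh (2 * h) - exp (- 2 * \<beta>) > 0" by (rule cosh_minus_exp_pos[OF assms])
  have a: "ln (end_weight B (tanh h)) = ln 2 + ln (cosh (B + h)) - ln (cosh h)"
    unfolding end_weight_tanh by (simp add: ln_div ln_mult)
  have b: "ln (bulk_weight B (tanh h)) = ln 2 + ln (cosh (B + 2 * h)) - 2 * ln (cosh h)"
    unfolding bulk_weight_tanh by (simp add: ln_div ln_mult ln_realpow)
  have c: "ln (tanh \<beta> + (tanh h)\<^sup>2) = ln ((1 + tanh \<beta>) / 2) + ln (cosh (2 * h) - exp (- 2 * \<beta>)) - 2 * ln (cosh h)"
  proof -
    have "ln (tanh \<beta> + (tanh h)\<^sup>2) = ln ((1 + tanh \<beta>) / 2 * (cosh (2 * h) - exp (- 2 * \<beta>))) - ln ((cosh h)\<^sup>2)"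
      unfolding denominator_tanh by (rule ln_divide_pos) (use t u in auto)
    then show ?thesis unfolding ln_mult_pos[OF t u] by (simp add: ln_realpow)
  qed
  show ?thesis unfolding exponent_def free_energy_def a b c by (simp add: field_simps)
qed

text \<open>Both vertex weights are homogeneous functions of \<open>(1, w)\<close> that are symmetric in the two entries, whereas
  the denominator is not. This compares \<open>|w| > 1\<close> with \<open>|w| < 1\<close>.\<close>

lemma exponent_inverse:
  assumes "\<beta> > 0" "w \<noteq> 0"
  shows "exponent p \<beta> B w = exponent p \<beta> B (1 / w) - (1 + p) / 2 * (ln (tanh \<beta> + w\<^sup>2) - ln (tanh \<beta> * w\<^sup>2 + 1))"
proof -
  have k: "tanh \<beta> > 0" using assms by simp
  have e: "end_weight B (1 / w) = end_weight B w / \<bar>w\<bar>"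
  proof -
    have "\<bar>1 + 1 / w\<bar> = \<bar>1 + w\<bar> / \<bar>w\<bar>" "\<bar>1 - 1 / w\<bar> = \<bar>1 - w\<bar> / \<bar>w\<bar>"
      unfolding abs_divide[symmetric] using assms(2) by (simp_all add: field_simps abs_minus_commute)
    then show ?thesis by (simp add: end_weight_def add_divide_distrib)
  qed
  have b: "bulk_weight B (1 / w) = bulk_weight B w / w\<^sup>2"
    unfolding bulk_weight_def using assms(2) by (simp add: field_simps power2_eq_square)
  have c: "tanh \<beta> + (1 / w)\<^sup>2 = (tanh \<beta> * w\<^sup>2 + 1) / w\<^sup>2"
    using assms(2) by (simp add: field_simps)
  have "ln (w\<^sup>2) = ln (\<bar>w\<bar>\<^sup>2)" by simp
  also have "\<dots> = 2 * ln \<bar>w\<bar>" using assms(2) by (subst ln_realpow) auto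
  finally have w: "ln (w\<^sup>2) = 2 * ln \<bar>w\<bar>" .
  have "tanh \<beta> * w\<^sup>2 + 1 > 0" using k by (simp add: add_nonneg_pos)
  then have ln: "ln (end_weight B (1 / w)) = ln (end_weight B w) - ln \<bar>w\<bar>"
    "ln (bulk_weight B (1 / w)) = ln (bulk_weight B w) - 2 * ln \<bar>w\<bar>"
    "ln (tanh \<beta> + (1 / w)\<^sup>2) = ln (tanh \<beta> * w\<^sup>2 + 1) - 2 * ln \<bar>w\<bar>"
    unfolding e b c w[symmetric] using assms(2) end_weight_pos[of B w] bulk_weight_pos[of B w] by (simp_all add: ln_div)
  show ?thesis unfolding exponent_def ln by (simp add: field_simps)
qed

lemma continuous_exponent:
  assumes "\<beta> > 0" shows "isCont (exponent p \<beta> B) w"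
proof -
  have "end_weight B w \<noteq> 0" "bulk_weight B w \<noteq> 0" "tanh \<beta> + w\<^sup>2 \<noteq> 0"
    using end_weight_pos[of B w] bulk_weight_pos[of B w] tanh_add_square_pos[OF assms, of w] by auto
  then show ?thesis
    unfolding exponent_def[abs_def] end_weight_def[abs_def] bulk_weight_def[abs_def]
    by (intro continuous_intros) auto
qed

lemma continuous_correction:
  assumes "\<beta> > 0" shows "isCont (correction \<beta> B) w"
proof -
  have "end_weight B w \<noteq> 0" "bulk_weight B w \<noteq> 0" "tanh \<beta> + w\<^sup>2 \<noteq> 0"
    using end_weight_pos[of B w] bulk_weight_pos[of B w] tanh_add_square_pos[OF assms, of w] by auto
  then show ?thesis
    unfolding correction_def[abs_def] end_weight_def[abs_def] bulk_weight_def[abs_def]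
    by (intro continuous_intros) auto
qed

text \<open>The maximiser of \<open>exponent\<close>.\<close>

definition saddle :: "real \<Rightarrow> real \<Rightarrow> real \<Rightarrow> real" where
  "saddle p \<beta> B = tanh (cavity_field p \<beta> B)"

lemma saddle_bounds: "- 1 < saddle p \<beta> B" "saddle p \<beta> B < 1"
  using tanh_real_bounds[of "cavity_field p \<beta> B"] by (auto simp: saddle_def)

lemma tanh_artanh_real: "- 1 < w \<Longrightarrow> w < 1 \<Longrightarrow> tanh (artanh w) = (w::real)"
proof -
  assume w: "- 1 < w" "w < 1"
  have e: "exp (2 * artanh w) = (1 + w) / (1 - w)" using w by (simp add: artanh_def)
  have "tanh (artanh w) = (1 - exp (- 2 * artanh w)) / (1 + exp (- 2 * artanh w))"
    by (rule tanh_real_altdef)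
  also have "exp (- 2 * artanh w) = (1 - w) / (1 + w)" using e by (simp add: exp_minus)
  also have "1 - (1 - w) / (1 + w) = 2 * w / (1 + w)" using w by (simp add: field_simps)
  also have "1 + (1 - w) / (1 + w) = 2 / (1 + w)" using w by (simp add: field_simps)
  finally show ?thesis using w by simp
qed

lemma artanh_less_iff: 
  fixes x y :: real
  assumes "- 1 < x" "x < 1" "- 1 < y" "y < 1" 
  shows "artanh x < artanh y \<longleftrightarrow> x < y"
  using tanh_real_less_iff[of "artanh x" "artanh y"] tanh_artanh_real assms by simp

lemma exponent_strict_mono:
  assumes p: "0 < p" "p < 1" and \<beta>: "\<beta> > 0"
  shows "- 1 < x \<Longrightarrow> x < y \<Longrightarrow> y \<le> saddle p \<beta> B \<Longrightarrow> exponent p \<beta> B x < exponent p \<beta> B y"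
    and "saddle p \<beta> B \<le> x \<Longrightarrow> x < y \<Longrightarrow> y < 1 \<Longrightarrow> exponent p \<beta> B y < exponent p \<beta> B x"
proof -
  have E: "exponent p \<beta> B x = free_energy p \<beta> B (artanh x) + (ln 2 - (1 + p) / 2 * ln ((1 + tanh \<beta>) / 2))"
    if "- 1 < x" "x < 1" for x
    using exponent_tanh[OF \<beta>, of p B "artanh x"] tanh_artanh_real[OF that] by simp
  note sb = saddle_bounds[of p \<beta> B]
  have as: "artanh (saddle p \<beta> B) = cavity_field p \<beta> B" by (simp add: saddle_def artanh_tanh_real)
  show "exponent p \<beta> B x < exponent p \<beta> B y" if "- 1 < x" "x < y" "y \<le> saddle p \<beta> B"
  proof -
    have "artanh x < artanh y" using that sb by (simp add: artanh_less_iff)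
    moreover have "artanh y \<le> cavity_field p \<beta> B"
      using artanh_less_iff[of "saddle p \<beta> B" y] that sb by (simp add: as not_less[symmetric])
    ultimately show ?thesis using free_energy_strict_mono(1)[OF assms] that sb by (simp add: E)
  qed
  show "exponent p \<beta> B y < exponent p \<beta> B x" if "saddle p \<beta> B \<le> x" "x < y" "y < 1"
  proof -
    have "artanh x < artanh y" using that sb by (simp add: artanh_less_iff)
    moreover have "cavity_field p \<beta> B \<le> artanh x"
      using artanh_less_iff[of x "saddle p \<beta> B"] that sb by (simp add: as not_less[symmetric])
    ultimately show ?thesis using free_energy_strict_mono(2)[OF assms] that sb by (simp add: E)
  qed
qed

text \<open>Inside the unit interval this is monotonicity on both sides of the maximum. For \<open>|w| > 1\<close>, either
  \<open>1 / w\<close> is away from the maximum, or \<open>exponent_inverse\<close> gains a fixed amount because \<open>|w|\<close> is bounded away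
  from 1.\<close>

lemma exponent_gap:
  assumes p: "0 < p" "p < 1" and \<beta>: "\<beta> > 0" and \<epsilon>: "\<epsilon> > 0"
  shows "\<exists>\<eta>>0. \<forall>w. \<bar>w - saddle p \<beta> B\<bar> \<ge> \<epsilon> \<longrightarrow> exponent p \<beta> B w \<le> exponent p \<beta> B (saddle p \<beta> B) - \<eta>"
proof -
  define w0 where "w0 = saddle p \<beta> B"
  define \<Psi> where "\<Psi> = exponent p \<beta> B"
  have w0: "- 1 < w0" "w0 < 1" using saddle_bounds by (simp_all add: w0_def)
  define d where "d = min \<epsilon> (min (1 - w0) (1 + w0) / 2)"
  have d: "d > 0" "d \<le> \<epsilon>" "- 1 < w0 - d" "w0 + d < 1" using \<epsilon> w0 by (auto simp: d_def min_def field_simps)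
  have mono: "- 1 < x \<Longrightarrow> x < y \<Longrightarrow> y \<le> w0 \<Longrightarrow> \<Psi> x < \<Psi> y" "w0 \<le> x \<Longrightarrow> x < y \<Longrightarrow> y < 1 \<Longrightarrow> \<Psi> y < \<Psi> x" for x y
    using exponent_strict_mono[OF p \<beta>] by (auto simp: \<Psi>_def w0_def)
  define \<eta>1 where "\<eta>1 = \<Psi> w0 - max (\<Psi> (w0 - d)) (\<Psi> (w0 + d))"
  have "\<Psi> (w0 - d) < \<Psi> w0" "\<Psi> (w0 + d) < \<Psi> w0" using mono d by auto
  then have \<eta>1: "\<eta>1 > 0" by (simp add: \<eta>1_def)
  have open_interval: "\<Psi> w \<le> \<Psi> w0 - \<eta>1" if "- 1 < w" "w < 1" "\<bar>w - w0\<bar> \<ge> d" for w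
  proof (cases "w \<le> w0 - d")
    case True
    then have "\<Psi> w \<le> \<Psi> (w0 - d)" using mono(1)[of w "w0 - d"] that d by (cases "w = w0 - d") auto
    then show ?thesis by (simp add: \<eta>1_def)
  next
    case False
    then have "w0 + d \<le> w" using that by linarith
    then have "\<Psi> w \<le> \<Psi> (w0 + d)" using mono(2)[of "w0 + d" w] that d by (cases "w = w0 + d") auto
    then show ?thesis by (simp add: \<eta>1_def)
  qed
  have cont: "(\<Psi> \<longlongrightarrow> \<Psi> w) (at w within S)" for w S
    using continuous_exponent[OF \<beta>, where p=p and B=B and w=w] unfolding isCont_def \<Psi>_def
    by (rule tendsto_within_subset) simp
  have left: "\<Psi> (- 1) \<le> \<Psi> w0 - \<eta>1"
  proof (rule tendsto_upperbound[OF cont])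
    show "\<forall>\<^sub>F w in at_right (- 1). \<Psi> w \<le> \<Psi> w0 - \<eta>1"
      unfolding eventually_at_right_field using d by (intro exI[of _ "w0 - d"]) (auto intro!: open_interval)
  qed simp
  have right: "\<Psi> 1 \<le> \<Psi> w0 - \<eta>1"
  proof (rule tendsto_upperbound[OF cont])
    show "\<forall>\<^sub>F w in at_left 1. \<Psi> w \<le> \<Psi> w0 - \<eta>1"
      unfolding eventually_at_left_field using d by (intro exI[of _ "w0 + d"]) (auto intro!: open_interval)
  qed simp
  have closed_interval: "\<Psi> w \<le> \<Psi> w0 - \<eta>1" if "\<bar>w\<bar> \<le> 1" "\<bar>w - w0\<bar> \<ge> d" for w
    using open_interval[of w] left right that by (cases "w = 1 \<or> w = - 1") auto
  have top: "\<Psi> w \<le> \<Psi> w0" if "\<bar>w\<bar> < 1" for w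
    using mono(1)[of w w0] mono(2)[of w0 w] that by (cases w w0 rule: linorder_cases) (auto simp: abs_less_iff)
  define k where "k = tanh \<beta>"
  have k: "0 < k" "k < 1" using \<beta> tanh_real_lt_1 by (simp_all add: k_def)
  \<comment> \<open>\<open>R\<close> is the least factor by which the denominator at \<open>w\<close> exceeds its mirror image when
    \<open>|1 / w| \<le> \<theta>\<close>.\<close>
  define \<theta> where "\<theta> = max \<bar>w0 - d\<bar> \<bar>w0 + d\<bar>"
  have \<theta>: "\<theta> < 1" "\<theta> \<ge> 0" using d w0 by (auto simp: \<theta>_def)
  define R where "R = (k * \<theta>\<^sup>2 + 1) / (k + \<theta>\<^sup>2)"
  have \<theta>2: "\<theta>\<^sup>2 < 1" using \<theta> by (simp add: power_less_one_iff)
  have den: "k + \<theta>\<^sup>2 > 0" using k by (simp add: add_pos_nonneg)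
  have "0 < (1 - k) * (1 - \<theta>\<^sup>2)" using k \<theta>2 by simp
  then have "k + \<theta>\<^sup>2 < k * \<theta>\<^sup>2 + 1" by (simp add: algebra_simps)
  then have R: "R > 1" using den by (simp add: R_def)
  define \<eta>2 where "\<eta>2 = (1 + p) / 2 * ln R"
  have \<eta>2: "\<eta>2 > 0" using R p by (simp add: \<eta>2_def)
  have outer: "\<Psi> w \<le> \<Psi> w0 - min \<eta>1 \<eta>2" if "\<bar>w\<bar> > 1" for w
  proof -
    define x where "x = 1 / w"
    have w: "w \<noteq> 0" "w\<^sup>2 > 1" using that one_less_power[of "\<bar>w\<bar>" 2] by auto
    have x: "\<bar>x\<bar> < 1" using that by (simp add: x_def)
    have c: "k + w\<^sup>2 > 0" "k * w\<^sup>2 + 1 > 0" using k by (simp_all add: add_pos_nonneg add_nonneg_pos)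
    have "0 < (1 - k) * (w\<^sup>2 - 1)" using k w by simp
    then have kw: "k * w\<^sup>2 + 1 \<le> k + w\<^sup>2" by (simp add: algebra_simps)
    have inv: "\<Psi> w = \<Psi> x - (1 + p) / 2 * (ln (k + w\<^sup>2) - ln (k * w\<^sup>2 + 1))"
      unfolding \<Psi>_def x_def k_def by (rule exponent_inverse[OF \<beta> w(1)])
    show ?thesis
    proof (cases "\<bar>x - w0\<bar> \<ge> d")
      case True
      have "ln (k + w\<^sup>2) - ln (k * w\<^sup>2 + 1) \<ge> 0" using kw c by simp
      then have "\<Psi> w \<le> \<Psi> x" unfolding inv using p by simp
      also have "\<Psi> x \<le> \<Psi> w0 - \<eta>1" using closed_interval[of x] x True by simp
      finally show ?thesis by simp
    next
      case False
      then have "\<bar>x\<bar> \<le> \<theta>" unfolding \<theta>_def by linarith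
      then have x2: "x\<^sup>2 \<le> \<theta>\<^sup>2" using power_mono[of "\<bar>x\<bar>" \<theta> 2] by simp
      have dx: "k + x\<^sup>2 > 0" using k by (simp add: add_pos_nonneg)
      have "R \<le> (k * x\<^sup>2 + 1) / (k + x\<^sup>2)"
      proof -
        have "0 \<le> (1 - k\<^sup>2) * (\<theta>\<^sup>2 - x\<^sup>2)" using k x2 by (simp add: power_le_one)
        then have "(k * \<theta>\<^sup>2 + 1) * (k + x\<^sup>2) \<le> (k * x\<^sup>2 + 1) * (k + \<theta>\<^sup>2)"
          by (simp add: power2_eq_square algebra_simps)
        then show ?thesis unfolding R_def using den dx by (simp add: divide_simps)
      qed
      also have "(k * x\<^sup>2 + 1) / (k + x\<^sup>2) = (k + w\<^sup>2) / (k * w\<^sup>2 + 1)"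
      proof -
        have "k * x\<^sup>2 + 1 = (k + w\<^sup>2) / w\<^sup>2" "k + x\<^sup>2 = (k * w\<^sup>2 + 1) / w\<^sup>2"
          unfolding x_def using w(1) by (simp_all add: field_simps)
        then show ?thesis using w(1) by simp
      qed
      finally have "ln R \<le> ln ((k + w\<^sup>2) / (k * w\<^sup>2 + 1))" using R by (intro ln_mono) auto
      then have "ln R \<le> ln (k + w\<^sup>2) - ln (k * w\<^sup>2 + 1)" using c by (simp add: ln_div)
      then have "\<eta>2 \<le> (1 + p) / 2 * (ln (k + w\<^sup>2) - ln (k * w\<^sup>2 + 1))"
        unfolding \<eta>2_def using p by (intro mult_left_mono) auto
      then show ?thesis using inv top[OF x] by simp
    qed
  qed
  have "\<Psi> w \<le> \<Psi> w0 - min \<eta>1 \<eta>2" if "\<bar>w - w0\<bar> \<ge> \<epsilon>" for w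
    using outer[of w] closed_interval[of w] that d by (cases "\<bar>w\<bar> > 1") auto
  then show ?thesis unfolding \<Psi>_def w0_def using \<eta>1 \<eta>2 by (intro exI[of _ "min \<eta>1 \<eta>2"]) (auto simp: \<Psi>_def w0_def)
qed

text \<open>L'Hopital's rule reduces the claim to the definition of \<open>c\<close> as a derivative of \<open>f'\<close>.\<close>

lemma second_order_quotient:
  fixes f f' :: "real \<Rightarrow> real"
  assumes f: "\<And>x. (f has_real_derivative f' x) (at x)" and f': "(f' has_real_derivative c) (at x0)" and "f' x0 = 0"
  shows "((\<lambda>x. (f x - f x0) / (x - x0)\<^sup>2) \<longlongrightarrow> c / 2) (at x0)"
proof (rule lhopital)
  have "isCont f x0" using f DERIV_isCont by blast
  then show "((\<lambda>x. f x - f x0) \<longlongrightarrow> 0) (at x0)" by (simp add: isCont_def LIM_zero)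
  have "((\<lambda>x. (x - x0)\<^sup>2) \<longlongrightarrow> (x0 - x0)\<^sup>2) (at x0)" by (intro tendsto_intros)
  then show "((\<lambda>x. (x - x0)\<^sup>2) \<longlongrightarrow> 0) (at x0)" by simp
  show "\<forall>\<^sub>F x in at x0. (x - x0)\<^sup>2 \<noteq> 0" by (auto simp: eventually_at_filter)
  show "\<forall>\<^sub>F x in at x0. 2 * (x - x0) \<noteq> 0" by (auto simp: eventually_at_filter)
  show "\<forall>\<^sub>F x in at x0. ((\<lambda>x. f x - f x0) has_real_derivative f' x) (at x)"
    by (intro always_eventually allI) (auto intro!: derivative_eq_intros f)
  show "\<forall>\<^sub>F x in at x0. ((\<lambda>x. (x - x0)\<^sup>2) has_real_derivative 2 * (x - x0)) (at x)"
    by (intro always_eventually allI) (auto intro!: derivative_eq_intros)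
  have "((\<lambda>x. (f' x - f' x0) / (x - x0)) \<longlongrightarrow> c) (at x0)"
    using f' by (simp add: has_field_derivative_iff)
  then have "((\<lambda>x. (f' x - f' x0) / (x - x0) / 2) \<longlongrightarrow> c / 2) (at x0)" by (rule tendsto_divide) auto
  then show "((\<lambda>x. f' x / (2 * (x - x0))) \<longlongrightarrow> c / 2) (at x0)"
    using assms(3) by (simp add: mult.commute)
qed

text \<open>Minus the second derivative of \<open>exponent\<close> at the maximum, from \<open>stiffness\<close> by the chain rule with
  \<open>dh / dw = 1 / (1 - w\<^sup>2)\<close>.\<close>

definition saddle_curvature :: "real \<Rightarrow> real \<Rightarrow> real \<Rightarrow> real" where
  "saddle_curvature p \<beta> B = stiffness p \<beta> B (cavity_field p \<beta> B) / (1 - (saddle p \<beta> B)\<^sup>2)\<^sup>2"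

lemma one_minus_saddle_square: "1 - (saddle p \<beta> B)\<^sup>2 > 0"
  using saddle_bounds[of p \<beta> B] abs_square_less_1[of "saddle p \<beta> B"] by (auto simp: abs_less_iff)

lemma artanh_deriv_saddle:
  "(artanh has_real_derivative 1 / (1 - (saddle p \<beta> B)\<^sup>2)) (at (saddle p \<beta> B))"
  using saddle_bounds[of p \<beta> B] by (intro artanh_real_has_field_derivative) auto

lemma artanh_saddle: "artanh (saddle p \<beta> B) = cavity_field p \<beta> B"
  by (simp add: saddle_def artanh_tanh_real)

lemma exponent_quadratic:
  assumes p: "0 < p" "p < 1" and \<beta>: "\<beta> > 0"
  shows "((\<lambda>w. (exponent p \<beta> B w - exponent p \<beta> B (saddle p \<beta> B)) / (w - saddle p \<beta> B)\<^sup>2)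
     \<longlongrightarrow> - saddle_curvature p \<beta> B / 2) (at (saddle p \<beta> B))"
proof -
  define w0 h0 where "w0 = saddle p \<beta> B" and "h0 = cavity_field p \<beta> B"
  have w0: "- 1 < w0" "w0 < 1" using saddle_bounds by (simp_all add: w0_def)
  have h0: "artanh w0 = h0" by (simp add: w0_def h0_def artanh_saddle)
  have q: "((\<lambda>h. (free_energy p \<beta> B h - free_energy p \<beta> B h0) / (h - h0)\<^sup>2) \<longlongrightarrow> - stiffness p \<beta> B h0 / 2) (at h0)"
    by (rule second_order_quotient[OF free_energy_deriv[OF \<beta>] force_deriv[OF \<beta>]])
       (simp add: h0_def force_cavity_field[OF assms])
  have nbhd: "\<forall>\<^sub>F w in at w0. - 1 < w \<and> w < 1 \<and> w \<noteq> w0"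
  proof -
    have "\<forall>\<^sub>F w in at w0. w \<in> {- 1<..<1}" by (rule eventually_at_in_open') (use w0 in auto)
    then show ?thesis unfolding eventually_at_filter by eventually_elim auto
  qed
  have "filterlim artanh (at h0) (at w0)"
    unfolding filterlim_at
  proof (intro conjI)
    show "\<forall>\<^sub>F x in at w0. artanh x \<in> UNIV \<and> artanh x \<noteq> h0"
      using nbhd
    proof eventually_elim
      case (elim x)
      then have "tanh (artanh x) \<noteq> tanh (artanh w0)" using tanh_artanh_real w0 by simp
      then show ?case using h0 by auto
    qed
    show "(artanh \<longlongrightarrow> h0) (at w0)"
      using DERIV_isCont[OF artanh_deriv_saddle[of p \<beta> B]] by (simp add: isCont_def h0 w0_def[symmetric])
  qed
  then have 1: "((\<lambda>w. (free_energy p \<beta> B (artanh w) - free_energy p \<beta> B h0) / (artanh w - h0)\<^sup>2) \<longlongrightarrow> - stiffness p \<beta> B h0 / 2) (at w0)"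
    by (rule filterlim_compose[OF q])
  have 2: "((\<lambda>w. (artanh w - h0) / (w - w0)) \<longlongrightarrow> 1 / (1 - w0\<^sup>2)) (at w0)"
    using artanh_deriv_saddle[of p \<beta> B] unfolding has_field_derivative_iff w0_def[symmetric] h0 .
  have "((\<lambda>w. (free_energy p \<beta> B (artanh w) - free_energy p \<beta> B h0) / (artanh w - h0)\<^sup>2 * ((artanh w - h0) / (w - w0))\<^sup>2)
     \<longlongrightarrow> - stiffness p \<beta> B h0 / 2 * (1 / (1 - w0\<^sup>2))\<^sup>2) (at w0)"
    by (intro tendsto_mult tendsto_power 1 2)
  also have "- stiffness p \<beta> B h0 / 2 * (1 / (1 - w0\<^sup>2))\<^sup>2 = - saddle_curvature p \<beta> B / 2"
    by (simp add: saddle_curvature_def h0_def w0_def power_divide)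
  finally have "((\<lambda>w. (free_energy p \<beta> B (artanh w) - free_energy p \<beta> B h0) / (artanh w - h0)\<^sup>2 * ((artanh w - h0) / (w - w0))\<^sup>2)
     \<longlongrightarrow> - saddle_curvature p \<beta> B / 2) (at w0)" .
  moreover have "\<forall>\<^sub>F w in at w0. (free_energy p \<beta> B (artanh w) - free_energy p \<beta> B h0) / (artanh w - h0)\<^sup>2 * ((artanh w - h0) / (w - w0))\<^sup>2
      = (exponent p \<beta> B w - exponent p \<beta> B w0) / (w - w0)\<^sup>2"
    using nbhd
  proof eventually_elim
    case (elim w)
    then have "tanh (artanh w) \<noteq> tanh (artanh w0)" using tanh_artanh_real w0 by simp
    then have "artanh w \<noteq> h0" using h0 by auto
    moreover have "exponent p \<beta> B w - exponent p \<beta> B w0 = free_energy p \<beta> B (artanh w) - free_energy p \<beta> B h0"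
    proof -
      have "tanh h0 = w0" "tanh (artanh w) = w" using tanh_artanh_real elim by (simp_all add: w0_def h0_def saddle_def)
      then show ?thesis
        using exponent_tanh[OF \<beta>, of p B "artanh w"] exponent_tanh[OF \<beta>, of p B h0] by simp
    qed
    ultimately show ?case by (simp add: power_divide)
  qed
  ultimately show ?thesis unfolding w0_def[symmetric] by (simp add: tendsto_cong)
qed

section \<open>Expectations of the total spin\<close>

text \<open>The weight of a vertex of degree \<open>j\<close> summed over its spin, and below the mean spin under this weight.\<close>

definition vertex_weight :: "real \<Rightarrow> nat \<Rightarrow> real \<Rightarrow> real" where
  "vertex_weight B j w = exp B * (1 + w) ^ j + exp (- B) * (1 - w) ^ j"

definition vertex_mean :: "real \<Rightarrow> nat \<Rightarrow> real \<Rightarrow> real" where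
  "vertex_mean B j w = (exp B * (1 + w) ^ j - exp (- B) * (1 - w) ^ j) / vertex_weight B j w"

lemma vertex_weight_eq:
  assumes "\<bar>w\<bar> < 1"
  shows "vertex_weight B 1 w = end_weight B w" "vertex_weight B 2 w = bulk_weight B w" "vertex_weight B j w > 0"
  using assms by (auto simp: vertex_weight_def end_weight_def bulk_weight_def abs_less_iff intro!: add_pos_pos)

lemma vertex_mean_le:
  assumes "\<bar>w\<bar> < 1" shows "\<bar>vertex_mean B j w\<bar> \<le> 1"
proof -
  define x y where "x = exp B * (1 + w) ^ j" and "y = exp (- B) * (1 - w) ^ j"
  have "x > 0" "y > 0" using assms by (auto simp: x_def y_def abs_less_iff)
  then show ?thesis
    unfolding vertex_mean_def vertex_weight_def x_def[symmetric] y_def[symmetric]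
    by (simp add: abs_divide divide_le_eq)
qed

lemma vertex_mean_tanh:
  "vertex_mean B 1 (tanh h) = tanh (B + h)" "vertex_mean B 2 (tanh h) = tanh (B + 2 * h)"
proof -
  have t: "(exp x - exp (- x)) / (exp x + exp (- x)) = tanh x" for x :: real
    unfolding cosh_plus_sinh[symmetric] cosh_minus_sinh[symmetric] tanh_def by simp
  have c: "cosh h > 0" by simp
  have g: "(x / c - y / c) / (x / c + y / c) = (x - y) / (x + y)" if "c > 0" for x y c :: real
    using that by (simp add: diff_divide_distrib[symmetric] add_divide_distrib[symmetric])
  have "vertex_mean B 1 (tanh h) = (exp B * exp h / cosh h - exp (- B) * exp (- h) / cosh h) / (exp B * exp h / cosh h + exp (- B) * exp (- h) / cosh h)"
    unfolding vertex_mean_def vertex_weight_def one_plus_minus_tanh by simp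
  also have "\<dots> = (exp (B + h) - exp (- (B + h))) / (exp (B + h) + exp (- (B + h)))"
    unfolding g[OF c] by (simp add: exp_add[symmetric] del: exp_minus)
  finally show "vertex_mean B 1 (tanh h) = tanh (B + h)" unfolding t .
  have c2: "(cosh h)\<^sup>2 > 0" by simp
  have "vertex_mean B 2 (tanh h) = (exp B * (exp h)\<^sup>2 / (cosh h)\<^sup>2 - exp (- B) * (exp (- h))\<^sup>2 / (cosh h)\<^sup>2)
      / (exp B * (exp h)\<^sup>2 / (cosh h)\<^sup>2 + exp (- B) * (exp (- h))\<^sup>2 / (cosh h)\<^sup>2)"
    unfolding vertex_mean_def vertex_weight_def one_plus_minus_tanh by (simp add: power_divide)
  also have "\<dots> = (exp (B + 2 * h) - exp (- (B + 2 * h))) / (exp (B + 2 * h) + exp (- (B + 2 * h)))"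
    unfolding g[OF c2] by (simp add: exp_add[symmetric] power2_eq_square algebra_simps del: exp_minus)
  finally show "vertex_mean B 2 (tanh h) = tanh (B + 2 * h)" unfolding t .
qed

text \<open>The characteristic function of a \<open>\<plusminus>1\<close>-valued spin of mean \<open>m\<close>.\<close>

definition spin_char :: "real \<Rightarrow> real \<Rightarrow> complex" where
  "spin_char m \<theta> = Complex (cos \<theta>) (m * sin \<theta>)"

lemma norm_spin_kernel_le:
  fixes F :: "real \<Rightarrow> 'b::real_normed_vector"
  assumes "\<beta> > 0"
    and F: "\<And>\<sigma>. \<sigma> \<in> spin_configs N \<Longrightarrow> norm (F (total_spin N \<sigma>)) \<le> C"
    and n: "n1 + 2 * n2 = 2 * n" "(\<Sum>i\<in>{1..N}. d i) div 2 = n"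
    and prod: "\<And>f :: nat \<Rightarrow> real. (\<Prod>i\<in>{1..N}. f (d i)) = f 1 ^ n1 * f 2 ^ n2"
  shows "norm (spin_kernel \<beta> B N d F w) \<le> C * (end_weight B w ^ n1 * bulk_weight B w ^ n2 / (tanh \<beta> + w\<^sup>2) ^ Suc n)"
proof -
  have pos: "tanh \<beta> + w\<^sup>2 > 0" by (rule tanh_add_square_pos) fact
  have "norm (spin_kernel \<beta> B N d F w) \<le> (\<Sum>\<sigma>\<in>spin_configs N.
      (\<Prod>i\<in>{1..N}. exp (B * \<sigma> i) * \<bar>1 + \<sigma> i * w\<bar> ^ d i) / (tanh \<beta> + w\<^sup>2) ^ Suc n * C)"
    unfolding spin_kernel_def n(2)
  proof (rule sum_norm_le)
    fix \<sigma> assume "\<sigma> \<in> spin_configs N"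
    then have "norm (F (total_spin N \<sigma>)) \<le> C" by (rule F)
    then show "norm (((\<Prod>i = 1..N. exp (B * \<sigma> i) * (1 + \<sigma> i * w) ^ d i) / (tanh \<beta> + w\<^sup>2) ^ Suc n) *\<^sub>R F (total_spin N \<sigma>))
       \<le> (\<Prod>i = 1..N. exp (B * \<sigma> i) * \<bar>1 + \<sigma> i * w\<bar> ^ d i) / (tanh \<beta> + w\<^sup>2) ^ Suc n * C"
      using pos by (simp add: abs_prod abs_mult power_abs mult_left_mono prod_nonneg divide_right_mono del: power_Suc)
  qed
  also have "\<dots> = C / (tanh \<beta> + w\<^sup>2) ^ Suc n * (\<Sum>\<sigma>\<in>spin_configs N. \<Prod>i\<in>{1..N}. (\<lambda>i s. exp (B * s) * \<bar>1 + s * w\<bar> ^ d i) i (\<sigma> i))"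
    by (simp add: sum_distrib_left mult_ac)
  also have "(\<Sum>\<sigma>\<in>spin_configs N. \<Prod>i\<in>{1..N}. (\<lambda>i s. exp (B * s) * \<bar>1 + s * w\<bar> ^ d i) i (\<sigma> i))
      = (\<Prod>i\<in>{1..N}. exp B * \<bar>1 + w\<bar> ^ d i + exp (- B) * \<bar>1 - w\<bar> ^ d i)"
    by (subst sum_spin_configs_prod) simp
  also have "\<dots> = end_weight B w ^ n1 * bulk_weight B w ^ n2"
    using prod[of "\<lambda>j. exp B * \<bar>1 + w\<bar> ^ j + exp (- B) * \<bar>1 - w\<bar> ^ j"] by (simp add: end_weight_def bulk_weight_def)
  finally show ?thesis by (simp add: mult_ac)
qed

lemma spin_kernel_exp:
  assumes w: "\<bar>w\<bar> < 1" and n: "(\<Sum>i\<in>{1..N}. d i) div 2 = n"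
    and prod: "\<And>f :: nat \<Rightarrow> complex. (\<Prod>i\<in>{1..N}. f (d i)) = f 1 ^ n1 * f 2 ^ n2"
  shows "spin_kernel \<beta> B N d (\<lambda>x. iexp (\<theta> * x)) w =
    (end_weight B w ^ n1 * bulk_weight B w ^ n2 / (tanh \<beta> + w\<^sup>2) ^ Suc n) *\<^sub>R
      (spin_char (vertex_mean B 1 w) \<theta> ^ n1 * spin_char (vertex_mean B 2 w) \<theta> ^ n2)"
proof -
  define c where "c = (tanh \<beta> + w\<^sup>2) ^ Suc n"
  define g where "g i s = of_real (exp (B * s) * (1 + s * w) ^ d i) * iexp (\<theta> * s)" for i :: nat and s :: real
  have E: "iexp (\<theta> * total_spin N \<sigma>) = (\<Prod>i\<in>{1..N}. iexp (\<theta> * \<sigma> i))" for \<sigma>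
    by (simp add: total_spin_def sum_distrib_left exp_sum)
  have "spin_kernel \<beta> B N d (\<lambda>x. iexp (\<theta> * x)) w = (1 / c) *\<^sub>R (\<Sum>\<sigma>\<in>spin_configs N. \<Prod>i\<in>{1..N}. g i (\<sigma> i))"
    unfolding spin_kernel_def n c_def[symmetric] E g_def scaleR_sum_right
    by (intro sum.cong refl) (simp add: scaleR_conv_of_real prod.distrib)
  also have "(\<Sum>\<sigma>\<in>spin_configs N. \<Prod>i\<in>{1..N}. g i (\<sigma> i)) = (\<Prod>i\<in>{1..N}. g i 1 + g i (- 1))"
    by (rule sum_spin_configs_prod)
  also have "\<dots> = (\<Prod>i\<in>{1..N}. of_real (vertex_weight B (d i) w) * spin_char (vertex_mean B (d i) w) \<theta>)"
  proof (intro prod.cong refl)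
    fix i
    define x y where "x = exp B * (1 + w) ^ d i" and "y = exp (- B) * (1 - w) ^ d i"
    have xy: "x + y \<noteq> 0" using vertex_weight_eq(3)[OF w, of B "d i"] by (simp add: vertex_weight_def x_def y_def)
    have e: "iexp t = cis t" for t by (simp only: cis_conv_exp)
    have g: "g i 1 + g i (- 1) = x * cis \<theta> + y * cis (- \<theta>)"
      unfolding e[symmetric] by (simp add: g_def x_def y_def)
    define m where "m = (x - y) / (x + y)"
    have "x - y = (x + y) * m" using xy by (simp add: m_def)
    then have "x * sin \<theta> - y * sin \<theta> = (x + y) * (m * sin \<theta>)" by (metis left_diff_distrib mult.assoc)
    then have "x * cis \<theta> + y * cis (- \<theta>) = of_real (x + y) * spin_char m \<theta>"
      unfolding spin_char_def complex_eq_iff by (simp add: algebra_simps)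
    then show "g i 1 + g i (- 1) = of_real (vertex_weight B (d i) w) * spin_char (vertex_mean B (d i) w) \<theta>"
      unfolding g vertex_mean_def vertex_weight_def x_def[symmetric] y_def[symmetric] m_def[symmetric] .
  qed
  also have "\<dots> = (vertex_weight B 1 w * spin_char (vertex_mean B 1 w) \<theta>) ^ n1
      * (vertex_weight B 2 w * spin_char (vertex_mean B 2 w) \<theta>) ^ n2"
    by (rule prod)
  also have "(1 / c) *\<^sub>R \<dots> = (vertex_weight B 1 w ^ n1 * vertex_weight B 2 w ^ n2 / c) *\<^sub>R
      (spin_char (vertex_mean B 1 w) \<theta> ^ n1 * spin_char (vertex_mean B 2 w) \<theta> ^ n2)"
  proof -
    have "(1 / c) *\<^sub>R ((of_real x * u) ^ n1 * (of_real y * v) ^ n2) = (x ^ n1 * y ^ n2 / c) *\<^sub>R (u ^ n1 * v ^ n2)"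
      for x y :: real and u v :: complex
      by (simp add: scaleR_conv_of_real power_mult_distrib)
    then show ?thesis .
  qed
  finally show ?thesis unfolding vertex_weight_eq[OF w] c_def[symmetric] .
qed

lemma sum_spin_configs_total_spin:
  fixes g :: "nat \<Rightarrow> real \<Rightarrow> real"
  assumes "\<And>i. g i 1 + g i (- 1) > 0"
  shows "(\<Sum>\<sigma>\<in>spin_configs N. (\<Prod>i\<in>{1..N}. g i (\<sigma> i)) * total_spin N \<sigma>) =
    (\<Prod>i\<in>{1..N}. g i 1 + g i (- 1)) * (\<Sum>i\<in>{1..N}. (g i 1 - g i (- 1)) / (g i 1 + g i (- 1)))"
proof -
  have "(\<Sum>\<sigma>\<in>spin_configs N. (\<Prod>i\<in>{1..N}. g i (\<sigma> i)) * total_spin N \<sigma>)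
     = (\<Sum>\<sigma>\<in>spin_configs N. \<Sum>j\<in>{1..N}. (\<Prod>i\<in>{1..N}. g i (\<sigma> i)) * \<sigma> j)"
    by (simp add: total_spin_def sum_distrib_left)
  also have "\<dots> = (\<Sum>j\<in>{1..N}. \<Sum>\<sigma>\<in>spin_configs N. (\<Prod>i\<in>{1..N}. g i (\<sigma> i)) * \<sigma> j)"
    by (rule sum.swap)
  also have "\<dots> = (\<Sum>j\<in>{1..N}. (\<Prod>i\<in>{1..N}. g i 1 + g i (- 1)) * ((g j 1 - g j (- 1)) / (g j 1 + g j (- 1))))"
  proof (intro sum.cong refl)
    fix j assume j: "j \<in> {1..N}"
    define g' where "g' i s = g i s * (if i = j then s else 1)" for i s
    have fin: "finite {1..N}" by simp
    have rem: "(\<Prod>i\<in>{1..N}. f i) = f j * (\<Prod>i\<in>{1..N} - {j}. f i)" for f :: "nat \<Rightarrow> real"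
      by (rule prod.remove[OF fin j])
    have "(\<Prod>i\<in>{1..N}. g i (\<sigma> i)) * \<sigma> j = (\<Prod>i\<in>{1..N}. g' i (\<sigma> i))" for \<sigma>
      unfolding rem[of "\<lambda>i. g i (\<sigma> i)"] rem[of "\<lambda>i. g' i (\<sigma> i)"] by (simp add: g'_def)
    then have "(\<Sum>\<sigma>\<in>spin_configs N. (\<Prod>i\<in>{1..N}. g i (\<sigma> i)) * \<sigma> j) = (\<Sum>\<sigma>\<in>spin_configs N. \<Prod>i\<in>{1..N}. g' i (\<sigma> i))"
      by simp
    also have "\<dots> = (\<Prod>i\<in>{1..N}. g' i 1 + g' i (- 1))" by (rule sum_spin_configs_prod)
    also have "\<dots> = (\<Prod>i\<in>{1..N}. g i 1 + g i (- 1)) * ((g j 1 - g j (- 1)) / (g j 1 + g j (- 1)))"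
    proof -
      have "g j 1 + g j (- 1) \<noteq> 0" using assms[of j] by simp
      then show ?thesis unfolding rem[of "\<lambda>i. g i 1 + g i (- 1)"] rem[of "\<lambda>i. g' i 1 + g' i (- 1)"] by (simp add: g'_def)
    qed
    finally show "(\<Sum>\<sigma>\<in>spin_configs N. (\<Prod>i\<in>{1..N}. g i (\<sigma> i)) * \<sigma> j) = (\<Prod>i\<in>{1..N}. g i 1 + g i (- 1)) * ((g j 1 - g j (- 1)) / (g j 1 + g j (- 1)))" .
  qed
  finally show ?thesis by (simp add: sum_distrib_left)
qed

lemma spin_kernel_affine:
  assumes w: "\<bar>w\<bar> < 1" and n: "(\<Sum>i\<in>{1..N}. d i) div 2 = n"
    and prod: "\<And>f :: nat \<Rightarrow> real. (\<Prod>i\<in>{1..N}. f (d i)) = f 1 ^ n1 * f 2 ^ n2"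
    and sum: "\<And>f :: nat \<Rightarrow> real. (\<Sum>i\<in>{1..N}. f (d i)) = n1 * f 1 + n2 * f 2"
  shows "spin_kernel \<beta> B N d (\<lambda>x. a * x + b) w =
    (end_weight B w ^ n1 * bulk_weight B w ^ n2 / (tanh \<beta> + w\<^sup>2) ^ Suc n) *
      (a * (n1 * vertex_mean B 1 w + n2 * vertex_mean B 2 w) + b)"
proof -
  define c where "c = (tanh \<beta> + w\<^sup>2) ^ Suc n"
  define g where "g i s = exp (B * s) * (1 + s * w) ^ d i" for i :: nat and s :: real
  have g: "g i 1 + g i (- 1) = vertex_weight B (d i) w" for i
    by (simp add: g_def vertex_weight_def)
  have gm: "(g i 1 - g i (- 1)) / vertex_weight B (d i) w = vertex_mean B (d i) w" for i
    by (simp add: g_def vertex_mean_def)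
  have "spin_kernel \<beta> B N d (\<lambda>x. a * x + b) w
      = (a * (\<Sum>\<sigma>\<in>spin_configs N. (\<Prod>i\<in>{1..N}. g i (\<sigma> i)) * total_spin N \<sigma>)
        + b * (\<Sum>\<sigma>\<in>spin_configs N. (\<Prod>i\<in>{1..N}. g i (\<sigma> i)))) / c"
    unfolding spin_kernel_def n c_def[symmetric] g_def[symmetric] sum_distrib_left sum.distrib[symmetric] sum_divide_distrib
    by (intro sum.cong refl) (simp add: algebra_simps add_divide_distrib)
  also have "\<dots> = (\<Prod>i\<in>{1..N}. vertex_weight B (d i) w) * (a * (\<Sum>i\<in>{1..N}. vertex_mean B (d i) w) + b) / c"
    unfolding sum_spin_configs_prod
    by (subst sum_spin_configs_total_spin) (simp_all add: g gm vertex_weight_eq(3)[OF w] algebra_simps)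
  also have "\<dots> = (vertex_weight B 1 w ^ n1 * vertex_weight B 2 w ^ n2) * (a * (n1 * vertex_mean B 1 w + n2 * vertex_mean B 2 w) + b) / c"
    unfolding prod[of "\<lambda>j. vertex_weight B j w"] sum[of "\<lambda>j. vertex_mean B j w"] ..
  finally show ?thesis unfolding vertex_weight_eq[OF w] c_def[symmetric] by simp
qed

lemma borel_measurable_spin_kernel [measurable]:
  fixes F :: "real \<Rightarrow> 'b::{banach, second_countable_topology}"
  shows "spin_kernel \<beta> B N d F \<in> borel_measurable borel"
  unfolding spin_kernel_def[abs_def] by measurable

definition annealed_weight :: "real \<Rightarrow> real \<Rightarrow> real \<Rightarrow> nat \<Rightarrow> real \<Rightarrow> real" where
  "annealed_weight p \<beta> B N w =
     end_weight B w ^ (N - nat \<lfloor>p * N\<rfloor>) * bulk_weight B w ^ nat \<lfloor>p * N\<rfloor> /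
     (tanh \<beta> + w\<^sup>2) ^ Suc ((N + nat \<lfloor>p * N\<rfloor>) div 2)"

text \<open>For \<open>p \<ge> 0\<close> the fractional part of \<open>p N\<close>, by which the number of vertices of degree 2 falls short.\<close>

definition rounding :: "real \<Rightarrow> nat \<Rightarrow> real" where
  "rounding p N = p * N - real (nat \<lfloor>p * N\<rfloor>)"

lemma rounding_bounds:
  assumes "p \<ge> 0" shows "\<bar>rounding p N\<bar> \<le> 1"
proof -
  have "p * N \<ge> 0" using assms by simp
  then have "real (nat \<lfloor>p * N\<rfloor>) = of_int \<lfloor>p * N\<rfloor>" by simp
  then show ?thesis unfolding rounding_def by linarith
qed

lemma floor_mult_le:
  assumes "0 < p" "p < 1" shows "nat \<lfloor>p * real N\<rfloor> \<le> N"
proof -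
  have "p * real N \<le> 1 * real N" using assms by (intro mult_right_mono) auto
  then have "\<lfloor>p * real N\<rfloor> \<le> int N" by (simp add: floor_le_iff)
  then show ?thesis by simp
qed

lemma leaf_count_real:
  assumes "0 < p" "p < 1"
  shows "real (N - nat \<lfloor>p * N\<rfloor>) = (1 - p) * N + rounding p N" "real (nat \<lfloor>p * N\<rfloor>) = p * N - rounding p N"
  using floor_mult_le[OF assms, of N] by (simp_all add: rounding_def of_nat_diff algebra_simps)

text \<open>The degree sequence enters only through the two degree frequencies. The product is stated
  for an arbitrary monoid, as it is used with real and with complex weights.\<close>

lemma degree_counts:
  fixes p :: real and N :: nat
  defines "n2 \<equiv> nat \<lfloor>p * N\<rfloor>"
  defines "n1 \<equiv> N - n2" and "n \<equiv> (N + n2) div 2"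
  assumes cm: "CM12_degrees p N d"
  shows "card (half_edges N d) = 2 * n" and "n1 + 2 * n2 = 2 * n" and "(\<Sum>i\<in>{1..N}. d i) div 2 = n"
    and "\<And>f :: nat \<Rightarrow> 'x::comm_monoid_mult. (\<Prod>i\<in>{1..N}. f (d i)) = f 1 ^ n1 * f 2 ^ n2"
    and "\<And>f :: nat \<Rightarrow> real. (\<Sum>i\<in>{1..N}. f (d i)) = n1 * f 1 + n2 * f 2"
proof -
  define V1 V2 where "V1 = {i\<in>{1..N}. d i = 1}" and "V2 = {i\<in>{1..N}. d i = 2}"
  have V: "{1..N} = V1 \<union> V2" "V1 \<inter> V2 = {}" "finite V1" "finite V2"
    using cm unfolding CM12_degrees_def V1_def V2_def by auto
  have d: "d i = 1" if "i \<in> V1" for i using that by (simp add: V1_def)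
  have d': "d i = 2" if "i \<in> V2" for i using that by (simp add: V2_def)
  have c2: "card V2 = n2" using cm by (simp add: CM12_degrees_def V2_def n2_def)
  have "card V1 + card V2 = card {1..N}" unfolding V(1) by (rule card_Un_disjoint[OF V(3,4,2), symmetric])
  then have cN: "n1 + n2 = N" and c1: "card V1 = n1" using c2 by (simp_all add: n1_def)
  show sum: "(\<Sum>i\<in>{1..N}. f (d i)) = n1 * f 1 + n2 * f 2" for f :: "nat \<Rightarrow> real"
    unfolding V(1) by (subst sum.union_disjoint) (use V d d' c1 c2 in auto)
  show "(\<Prod>i\<in>{1..N}. f (d i)) = f 1 ^ n1 * f 2 ^ n2" for f :: "nat \<Rightarrow> 'x"
    unfolding V(1) by (subst prod.union_disjoint) (use V d d' c1 c2 in auto)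
  have "real (\<Sum>i\<in>{1..N}. d i) = real (n1 + 2 * n2)" using sum[of real] by simp
  then have deg: "(\<Sum>i\<in>{1..N}. d i) = n1 + 2 * n2" by linarith
  then have "even (n1 + 2 * n2)" using cm by (simp add: CM12_degrees_def)
  moreover have n: "n = (n1 + 2 * n2) div 2" using cN by (simp add: n_def)
  ultimately show "n1 + 2 * n2 = 2 * n" by simp
  then show "card (half_edges N d) = 2 * n" using deg by (simp add: card_half_edges)
  show "(\<Sum>i\<in>{1..N}. d i) div 2 = n" unfolding deg n ..
qed

lemma spin_kernel_facts:
  assumes p: "0 < p" "p < 1" and \<beta>: "\<beta> > 0" and cm: "CM12_degrees p N d"
  shows annealed_weight_eq: "annealed_weight p \<beta> B N w =
      exp (real N * exponent p \<beta> B w + rounding p N * correction \<beta> B w) * (1 / (tanh \<beta> + w\<^sup>2))"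
    and even_half_edges: "\<exists>n. card (half_edges N d) = 2 * n"
    and kernel_bound: "\<And>(F::real \<Rightarrow> 'b::real_normed_vector) C. (\<And>\<sigma>. \<sigma> \<in> spin_configs N \<Longrightarrow> norm (F (total_spin N \<sigma>)) \<le> C) \<Longrightarrow>
      norm (spin_kernel \<beta> B N d F w) \<le> C * annealed_weight p \<beta> B N w"
    and kernel_exp: "\<bar>w\<bar> < 1 \<Longrightarrow> spin_kernel \<beta> B N d (\<lambda>x. iexp (\<theta> * x)) w = annealed_weight p \<beta> B N w *\<^sub>R
      (spin_char (vertex_mean B 1 w) \<theta> ^ (N - nat \<lfloor>p * N\<rfloor>) *
       spin_char (vertex_mean B 2 w) \<theta> ^ nat \<lfloor>p * N\<rfloor>)"
    and kernel_affine: "\<bar>w\<bar> < 1 \<Longrightarrow> spin_kernel \<beta> B N d (\<lambda>x. a * x + b) w = annealed_weight p \<beta> B N w *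
      (a * ((N - nat \<lfloor>p * N\<rfloor>) * vertex_mean B 1 w + nat \<lfloor>p * N\<rfloor> * vertex_mean B 2 w) + b)"
proof -
  define n2 where "n2 = nat \<lfloor>p * N\<rfloor>"
  define n1 n where "n1 = N - n2" and "n = (N + n2) div 2"
  note counts = degree_counts[OF cm, folded n2_def, folded n1_def n_def]
  note cR = counts(1-3,5) counts(4)[where 'x=real] and cC = counts(1-3) counts(4)[where 'x=complex]
  show "annealed_weight p \<beta> B N w =
      exp (real N * exponent p \<beta> B w + rounding p N * correction \<beta> B w) * (1 / (tanh \<beta> + w\<^sup>2))"
    unfolding annealed_weight_def n1_def[symmetric] n2_def[symmetric] n_def[symmetric]
  proof (rule weight_eq_exp[OF \<beta>])
    show "n1 + 2 * n2 = 2 * n" using cR by blast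
    show "real n1 = (1 - p) * real N + rounding p N" "real n2 = p * real N - rounding p N"
      unfolding n1_def n2_def by (rule leaf_count_real[OF p])+
  qed
  show "\<exists>n. card (half_edges N d) = 2 * n" using cR by blast
  show "norm (spin_kernel \<beta> B N d F w) \<le> C * annealed_weight p \<beta> B N w"
    if "\<And>\<sigma>. \<sigma> \<in> spin_configs N \<Longrightarrow> norm (F (total_spin N \<sigma>)) \<le> C" for F :: "real \<Rightarrow> 'b" and C
    unfolding annealed_weight_def n1_def[symmetric] n2_def[symmetric] n_def[symmetric]
    by (rule norm_spin_kernel_le[OF \<beta>]) (use that cR in auto)
  show "spin_kernel \<beta> B N d (\<lambda>x. iexp (\<theta> * x)) w = annealed_weight p \<beta> B N w *\<^sub>R
      (spin_char (vertex_mean B 1 w) \<theta> ^ (N - nat \<lfloor>p * N\<rfloor>) *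
       spin_char (vertex_mean B 2 w) \<theta> ^ nat \<lfloor>p * N\<rfloor>)" if "\<bar>w\<bar> < 1"
    unfolding annealed_weight_def n1_def[symmetric] n2_def[symmetric] n_def[symmetric]
    by (rule spin_kernel_exp[OF that]) (use cC in auto)
  show "spin_kernel \<beta> B N d (\<lambda>x. a * x + b) w = annealed_weight p \<beta> B N w *
      (a * ((N - nat \<lfloor>p * N\<rfloor>) * vertex_mean B 1 w + nat \<lfloor>p * N\<rfloor> * vertex_mean B 2 w) + b)" if "\<bar>w\<bar> < 1"
    unfolding annealed_weight_def n1_def[symmetric] n2_def[symmetric] n_def[symmetric]
    by (rule spin_kernel_affine[OF that]) (use cR in auto)
qed

lemma saddle_curvature_pos:
  assumes p: "0 < p" "p < 1" and \<beta>: "\<beta> > 0"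
  shows "saddle_curvature p \<beta> B > 0"
  unfolding saddle_curvature_def
  by (intro divide_pos_pos stiffness_pos[OF assms] force_cavity_field[OF assms] zero_less_power one_minus_saddle_square)

lemma gaussian_integral: "(\<integral>x. exp (- x\<^sup>2 / 2) \<partial>lborel) = sqrt (2 * pi)"
proof -
  have "(\<integral>x. std_normal_density x \<partial>lborel) = 1"
    using prob_space.prob_space[OF prob_space_normal_density[of 1 0]]
      integral_std_normal_moment_even[of 0] by (simp add: has_bochner_integral_iff)
  moreover have "(\<integral>x. std_normal_density x \<partial>lborel) = (\<integral>x. exp (- x\<^sup>2 / 2) \<partial>lborel) / sqrt (2 * pi)"
    unfolding std_normal_density_def by simp
  ultimately show ?thesis by simp
qed

text \<open>Laplace's method applied to numerator and denominator of an annealed expectation: the mixing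
  variable becomes standard normal after centering and scaling, and \<open>\<phi>\<close> is the limit of the conditional
  expectations \<open>f\<close> given the mixing variable.\<close>

lemma annealed_expectation_limit:
  fixes p \<beta> B :: real and N :: "nat \<Rightarrow> nat" and d :: "nat \<Rightarrow> nat \<Rightarrow> nat"
    and F f :: "nat \<Rightarrow> real \<Rightarrow> 'b::{banach, second_countable_topology}" and \<phi> :: "real \<Rightarrow> 'b"
  defines "w0 \<equiv> saddle p \<beta> B" and "\<gamma> \<equiv> saddle_curvature p \<beta> B"
  assumes p: "0 < p" "p < 1" and \<beta>: "0 < \<beta>" and N: "strict_mono N"
    and cm: "\<And>k. CM12_degrees p (N k) (d k)"
    and C: "C \<ge> 0" and bound: "\<And>k \<sigma>. N k \<ge> 1 \<Longrightarrow> \<sigma> \<in> spin_configs (N k) \<Longrightarrow> norm (F k (total_spin (N k) \<sigma>)) \<le> C * sqrt (N k)"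
    and local: "\<And>k w. \<bar>w\<bar> < 1 \<Longrightarrow> spin_kernel \<beta> B (N k) (d k) (F k) w = annealed_weight p \<beta> B (N k) w *\<^sub>R f k w"
    and f: "\<exists>\<epsilon>>0. \<forall>k w. \<bar>w - w0\<bar> < \<epsilon> \<longrightarrow> norm (f k w) \<le> C * (1 + sqrt (N k) * \<bar>w - w0\<bar>)"
    and lim: "\<And>x. (\<lambda>k. f k (w0 + x / sqrt (\<gamma> * N k))) \<longlonglongrightarrow> \<phi> x"
    and \<phi>: "\<phi> \<in> borel_measurable borel"
  shows "(\<lambda>k. \<integral>\<sigma>. F k (total_spin (N k) \<sigma>) \<partial>annealed_measure \<beta> B (N k) (d k))
     \<longlonglongrightarrow> (\<integral>x. std_normal_density x *\<^sub>R \<phi> x \<partial>lborel)"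
proof -
  define \<omega> where "\<omega> w = 1 / (tanh \<beta> + w\<^sup>2)" for w :: real
  define T where "T k = real (N k)" for k
  define \<delta> where "\<delta> k = rounding p (N k)" for k
  have tpos: "tanh \<beta> + w\<^sup>2 > 0" for w :: real by (rule tanh_add_square_pos[OF \<beta>])
  have aw: "annealed_weight p \<beta> B (N k) w = exp (T k * exponent p \<beta> B w + \<delta> k * correction \<beta> B w) * \<omega> w" for k w
    unfolding T_def \<delta>_def \<omega>_def by (rule annealed_weight_eq[OF p \<beta> cm])
  have T: "filterlim T at_top sequentially"
    unfolding T_def using filterlim_subseq[OF N] filterlim_real_sequentially by (rule filterlim_compose[rotated])
  have T1: "\<forall>\<^sub>F k in sequentially. T k \<ge> 1" using T by (auto simp: filterlim_at_top)
  obtain CX where CX: "\<And>w. \<bar>correction \<beta> B w\<bar> \<le> CX" using abs_correction_le[OF \<beta>] by blast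
  have \<omega>: "\<And>w. \<omega> w \<ge> 0" "\<omega> w0 > 0" "isCont \<omega> w0" "integrable lborel \<omega>"
  proof -
    show "\<omega> w \<ge> 0" "\<omega> w0 > 0" for w using tpos by (simp_all add: \<omega>_def less_imp_le)
    show "isCont \<omega> w0" unfolding \<omega>_def using tpos[of w0] by (intro continuous_intros) auto
    show "integrable lborel \<omega>" unfolding \<omega>_def[abs_def] by (rule integrable_Cauchy_weight) (use \<beta> in simp)
  qed
  obtain \<epsilon> where \<epsilon>: "\<epsilon> > 0" "\<And>k w. \<bar>w - w0\<bar> < \<epsilon> \<Longrightarrow> norm (f k w) \<le> C * (1 + sqrt (N k) * \<bar>w - w0\<bar>)"
    using f by blast
  define \<epsilon>' where "\<epsilon>' = min \<epsilon> (min (1 - w0) (1 + w0))"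
  have w0: "- 1 < w0" "w0 < 1" using saddle_bounds by (simp_all add: w0_def)
  have \<epsilon>': "\<epsilon>' > 0" "\<epsilon>' \<le> \<epsilon>" using \<epsilon> w0 by (auto simp: \<epsilon>'_def)
  have inside: "\<bar>w\<bar> < 1" if "\<bar>w - w0\<bar> < \<epsilon>'" for w using that by (auto simp: \<epsilon>'_def abs_less_iff)
  note lap = laplace_method[where T=T and \<Psi>="exponent p \<beta> B" and \<delta>=\<delta> and X="correction \<beta> B" and \<omega>=\<omega> and ?w0.0=w0 and \<gamma>=\<gamma> and CX=CX,
      folded aw]
  have \<delta>: "\<bar>\<delta> k\<bar> \<le> 1" for k unfolding \<delta>_def by (rule rounding_bounds) (use p in simp)
  note common = T \<delta> CX continuous_correction[OF \<beta>] \<omega> saddle_curvature_pos[OF p \<beta>, of B, folded \<gamma>_def]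
    exponent_quadratic[OF p \<beta>, of B, folded w0_def \<gamma>_def] exponent_gap[OF p \<beta>, of _ B, folded w0_def]
  have Z1: "spin_kernel \<beta> B (N k) (d k) (\<lambda>_. 1::real) w = annealed_weight p \<beta> B (N k) w *\<^sub>R 1" if "\<bar>w\<bar> < 1" for k w
    using kernel_affine[OF p \<beta> cm that, of B k 0 1] by simp
  have awnn: "annealed_weight p \<beta> B (N k) w \<ge> 0" for k w
    unfolding aw using \<omega>(1) by simp
  have Z: "(\<lambda>k. (sqrt (\<gamma> * T k) / annealed_weight p \<beta> B (N k) w0) *\<^sub>R (\<integral>w. spin_kernel \<beta> B (N k) (d k) (\<lambda>_. 1::real) w \<partial>lborel))
      \<longlonglongrightarrow> (\<integral>x. exp (- x\<^sup>2 / 2) *\<^sub>R (1::real) \<partial>lborel)"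
  proof (rule lap[where C=1 and f="\<lambda>_ _. 1", OF common])
    show "\<forall>\<^sub>F k in sequentially. \<forall>w. norm (spin_kernel \<beta> B (N k) (d k) (\<lambda>_. 1::real) w) \<le> 1 * sqrt (T k) * annealed_weight p \<beta> B (N k) w"
      using T1
    proof (eventually_elim, intro allI)
      fix k w assume k: "1 \<le> T k"
      have "norm (spin_kernel \<beta> B (N k) (d k) (\<lambda>_. 1::real) w) \<le> 1 * annealed_weight p \<beta> B (N k) w"
        by (rule kernel_bound[OF p \<beta> cm]) simp
      also have "\<dots> \<le> (1 * sqrt (T k)) * annealed_weight p \<beta> B (N k) w"
        using k by (intro mult_right_mono awnn) simp
      finally show "norm (spin_kernel \<beta> B (N k) (d k) (\<lambda>_. 1::real) w) \<le> 1 * sqrt (T k) * annealed_weight p \<beta> B (N k) w" .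
    qed
    show "\<exists>\<epsilon>>0. \<forall>k w. \<bar>w - w0\<bar> < \<epsilon> \<longrightarrow> spin_kernel \<beta> B (N k) (d k) (\<lambda>_. 1::real) w = annealed_weight p \<beta> B (N k) w *\<^sub>R 1
        \<and> norm (1::real) \<le> 1 * (1 + sqrt (T k) * \<bar>w - w0\<bar>)"
      using \<epsilon>' inside Z1 by (intro exI[of _ \<epsilon>']) (auto simp: T_def)
  qed (auto simp: borel_measurable_spin_kernel)
  have K: "(\<lambda>k. (sqrt (\<gamma> * T k) / annealed_weight p \<beta> B (N k) w0) *\<^sub>R (\<integral>w. spin_kernel \<beta> B (N k) (d k) (F k) w \<partial>lborel))
      \<longlonglongrightarrow> (\<integral>x. exp (- x\<^sup>2 / 2) *\<^sub>R \<phi> x \<partial>lborel)"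
  proof (rule lap[where C=C and f=f, OF common])
    show "\<forall>\<^sub>F k in sequentially. \<forall>w. norm (spin_kernel \<beta> B (N k) (d k) (F k) w) \<le> C * sqrt (T k) * annealed_weight p \<beta> B (N k) w"
      using T1
    proof (eventually_elim, intro allI)
      fix k w assume "1 \<le> T k"
      then show "norm (spin_kernel \<beta> B (N k) (d k) (F k) w) \<le> C * sqrt (T k) * annealed_weight p \<beta> B (N k) w"
        unfolding T_def by (intro kernel_bound[OF p \<beta> cm] bound) auto
    qed
    show "\<exists>\<epsilon>>0. \<forall>k w. \<bar>w - w0\<bar> < \<epsilon> \<longrightarrow> spin_kernel \<beta> B (N k) (d k) (F k) w = annealed_weight p \<beta> B (N k) w *\<^sub>R f k w
        \<and> norm (f k w) \<le> C * (1 + sqrt (T k) * \<bar>w - w0\<bar>)"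
      using \<epsilon>' inside local \<epsilon>(2) unfolding T_def by (intro exI[of _ \<epsilon>']) (auto simp del: scaleR_conv_of_real)
  qed (use C lim \<phi> in \<open>auto simp: borel_measurable_spin_kernel T_def\<close>)
  define s where "s k = sqrt (\<gamma> * T k) / annealed_weight p \<beta> B (N k) w0" for k
  define z where "z k = (\<integral>w. spin_kernel \<beta> B (N k) (d k) (\<lambda>_. 1::real) w \<partial>lborel)" for k
  have Z': "(\<lambda>k. s k *\<^sub>R z k) \<longlonglongrightarrow> sqrt (2 * pi)"
    using Z by (simp only: s_def z_def real_scaleR_def mult_1_right gaussian_integral)
  have "(\<lambda>k. inverse (s k *\<^sub>R z k) *\<^sub>R (s k *\<^sub>R (\<integral>w. spin_kernel \<beta> B (N k) (d k) (F k) w \<partial>lborel)))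
     \<longlonglongrightarrow> inverse (sqrt (2 * pi)) *\<^sub>R (\<integral>x. exp (- x\<^sup>2 / 2) *\<^sub>R \<phi> x \<partial>lborel)"
    by (intro tendsto_scaleR tendsto_inverse) (use Z' K in \<open>simp_all only: s_def, simp\<close>)
  moreover have "\<forall>\<^sub>F k in sequentially. inverse (s k *\<^sub>R z k) *\<^sub>R (s k *\<^sub>R (\<integral>w. spin_kernel \<beta> B (N k) (d k) (F k) w \<partial>lborel))
      = (\<integral>\<sigma>. F k (total_spin (N k) \<sigma>) \<partial>annealed_measure \<beta> B (N k) (d k))"
    using T1
  proof eventually_elim
    case (elim k)
    have "annealed_weight p \<beta> B (N k) w0 > 0" unfolding aw using \<omega>(2) by simp
    then have "s k > 0" using elim saddle_curvature_pos[OF p \<beta>, of B] by (simp add: s_def \<gamma>_def)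
    moreover obtain n where "card (half_edges (N k) (d k)) = 2 * n" using even_half_edges[OF p \<beta> cm] by blast
    ultimately show ?case
      using expectation_total_spin[OF \<beta>, where N="N k" and d="d k" and n=n and F="F k" and B=B] by (simp add: z_def inverse_eq_divide)
  qed
  ultimately have "(\<lambda>k. \<integral>\<sigma>. F k (total_spin (N k) \<sigma>) \<partial>annealed_measure \<beta> B (N k) (d k))
     \<longlonglongrightarrow> inverse (sqrt (2 * pi)) *\<^sub>R (\<integral>x. exp (- x\<^sup>2 / 2) *\<^sub>R \<phi> x \<partial>lborel)"
    by (rule Lim_transform_eventually)
  also have "inverse (sqrt (2 * pi)) *\<^sub>R (\<integral>x. exp (- x\<^sup>2 / 2) *\<^sub>R \<phi> x \<partial>lborel) = (\<integral>x. std_normal_density x *\<^sub>R \<phi> x \<partial>lborel)"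
    unfolding integral_scaleR_right[symmetric] std_normal_density_def by (simp add: inverse_eq_divide)
  finally show ?thesis .
qed

section \<open>The central limit theorem\<close>

text \<open>Taylor expansion of the characteristic function of a centred two-point variable of variance
  \<open>1 - m\<^sup>2\<close>, with an error that is uniform in the mean; the means vary with the mixing variable.\<close>

lemma spin_char_expand:
  assumes m: "\<bar>m\<bar> \<le> 1"
  shows "cmod (spin_char m \<theta> * iexp (- (\<theta> * m)) - of_real (exp (- (\<theta>\<^sup>2 * (1 - m\<^sup>2) / 2)))) \<le> 4 / 3 * \<bar>\<theta>\<bar> ^ 3 + \<theta> ^ 4 / 4"
proof -
  define R where "R x = iexp x - (1 + \<i> * x - x\<^sup>2 / 2)" for x :: real
  have R: "cmod (R x) \<le> \<bar>x\<bar> ^ 3 / 6" for x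
  proof -
    have "(\<Sum>k\<le>2. (\<i> * x) ^ k / fact k) = 1 + \<i> * x - x\<^sup>2 / 2"
      by (simp add: numeral_2_eq_2 power_mult_distrib)
    then show ?thesis using iexp_approx1[of x 2] by (simp add: R_def numeral_eq_Suc fact_numeral)
  qed
  define a b where "a = (1 + m) / 2" and "b = (1 - m) / 2"
  have ab: "a \<ge> 0" "b \<ge> 0" "a + b = 1" using m by (auto simp: a_def b_def field_simps)
  define x y where "x = \<theta> * (1 - m)" and "y = - (\<theta> * (1 + m))"
  have s0: "a * x + b * y = 0" by (simp add: a_def b_def x_def y_def field_simps)
  have s2: "a * x\<^sup>2 + b * y\<^sup>2 = \<theta>\<^sup>2 * (1 - m\<^sup>2)"
    by (simp add: a_def b_def x_def y_def field_simps power2_eq_square)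
  have xy: "\<bar>x\<bar> ^ 3 / 6 \<le> 4 / 3 * \<bar>\<theta>\<bar> ^ 3" "\<bar>y\<bar> ^ 3 / 6 \<le> 4 / 3 * \<bar>\<theta>\<bar> ^ 3"
  proof -
    have "\<bar>x\<bar> \<le> \<bar>\<theta>\<bar> * 2" "\<bar>y\<bar> \<le> \<bar>\<theta>\<bar> * 2"
      using m unfolding x_def y_def abs_mult abs_minus_cancel by (intro mult_left_mono; simp)+
    then have "\<bar>x\<bar> ^ 3 \<le> (\<bar>\<theta>\<bar> * 2) ^ 3" "\<bar>y\<bar> ^ 3 \<le> (\<bar>\<theta>\<bar> * 2) ^ 3" by (intro power_mono; simp)+
    then show "\<bar>x\<bar> ^ 3 / 6 \<le> 4 / 3 * \<bar>\<theta>\<bar> ^ 3" "\<bar>y\<bar> ^ 3 / 6 \<le> 4 / 3 * \<bar>\<theta>\<bar> ^ 3"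
      by (simp_all add: power_mult_distrib)
  qed
  have "spin_char m \<theta> = a * cis \<theta> + b * cis (- \<theta>)"
    unfolding spin_char_def complex_eq_iff by (simp add: a_def b_def field_simps)
  moreover have "iexp t = cis t" for t by (simp only: cis_conv_exp)
  ultimately have "spin_char m \<theta> * iexp (- (\<theta> * m)) = a * iexp x + b * iexp y"
    by (simp only: distrib_right mult.assoc cis_mult) (simp add: x_def y_def algebra_simps)
  also have "\<dots> = a * R x + b * R y + ((a + b) + \<i> * (a * x + b * y) - (a * x\<^sup>2 + b * y\<^sup>2) / 2)"
    by (simp add: R_def algebra_simps add_divide_distrib)
  also have "\<dots> = a * R x + b * R y + of_real (1 - \<theta>\<^sup>2 * (1 - m\<^sup>2) / 2)"
    unfolding of_real_mult[symmetric] of_real_add[symmetric] of_real_power[symmetric] s0 s2 ab(3) by simp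
  finally have eq: "spin_char m \<theta> * iexp (- (\<theta> * m)) = a * R x + b * R y + of_real (1 - \<theta>\<^sup>2 * (1 - m\<^sup>2) / 2)" .
  define t where "t = \<theta>\<^sup>2 * (1 - m\<^sup>2) / 2"
  have m2: "0 \<le> 1 - m\<^sup>2" "1 - m\<^sup>2 \<le> 1" using m by (simp_all add: abs_square_le_1)
  have t: "0 \<le> t" "t \<le> \<theta>\<^sup>2 / 2" using m2 mult_left_mono[OF m2(2), of "\<theta>\<^sup>2"] by (simp_all add: t_def)
  \<comment> \<open>\<open>exp (- t) \<le> 1 / (1 + t) \<le> 1 - t + t\<^sup>2\<close> for \<open>t \<ge> 0\<close>.\<close>
  have "exp (- t) \<le> 1 / (1 + t)"
    using exp_ge_add_one_self[of t] t by (simp add: exp_minus inverse_eq_divide divide_left_mono)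
  also have "1 / (1 + t) \<le> 1 - t + t\<^sup>2"
  proof -
    have "(1 - t + t\<^sup>2) * (1 + t) = 1 + t ^ 3" by (simp add: algebra_simps power2_eq_square power3_eq_cube)
    then show ?thesis using t by (simp add: divide_le_eq)
  qed
  finally have "\<bar>(1 - t) - exp (- t)\<bar> \<le> t\<^sup>2" using exp_ge_add_one_self[of "- t"] by (simp add: abs_le_iff)
  also have "t\<^sup>2 \<le> (\<theta>\<^sup>2 / 2)\<^sup>2" using t by (intro power_mono)
  also have "\<dots> = \<theta> ^ 4 / 4" by (simp add: power_divide)
  finally have e: "\<bar>(1 - t) - exp (- t)\<bar> \<le> \<theta> ^ 4 / 4" .
  have "cmod (a * R x + b * R y) \<le> a * cmod (R x) + b * cmod (R y)"
    using norm_triangle_ineq[of "a * R x" "b * R y"] ab by (simp add: norm_mult)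
  also have "\<dots> \<le> a * (4 / 3 * \<bar>\<theta>\<bar> ^ 3) + b * (4 / 3 * \<bar>\<theta>\<bar> ^ 3)"
    using ab R[of x] R[of y] xy by (intro add_mono mult_left_mono) auto
  also have "\<dots> = 4 / 3 * \<bar>\<theta>\<bar> ^ 3" unfolding distrib_right[symmetric] ab(3) by simp
  finally have r: "cmod (a * R x + b * R y) \<le> 4 / 3 * \<bar>\<theta>\<bar> ^ 3" .
  have "spin_char m \<theta> * iexp (- (\<theta> * m)) - of_real (exp (- t)) = (a * R x + b * R y) + of_real ((1 - t) - exp (- t))"
    unfolding eq t_def by simp
  then have "cmod (spin_char m \<theta> * iexp (- (\<theta> * m)) - of_real (exp (- t))) \<le> cmod (a * R x + b * R y) + \<bar>(1 - t) - exp (- t)\<bar>"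
    by (metis norm_of_real norm_triangle_ineq)
  then show ?thesis using r e unfolding t_def by linarith
qed

lemma norm_spin_char_le:
  assumes "\<bar>m\<bar> \<le> 1" shows "cmod (spin_char m \<theta>) \<le> 1"
proof -
  have "m\<^sup>2 * (sin \<theta>)\<^sup>2 \<le> 1 * (sin \<theta>)\<^sup>2" using assms by (intro mult_right_mono) (auto simp: abs_square_le_1)
  then have "(cos \<theta>)\<^sup>2 + (m * sin \<theta>)\<^sup>2 \<le> 1" by (simp add: cos_squared_eq power_mult_distrib)
  then show ?thesis unfolding spin_char_def complex_norm by simp
qed

lemma spin_char_power_limit:
  fixes n :: "nat \<Rightarrow> nat" and \<theta> m :: "nat \<Rightarrow> real"
  assumes n: "(\<lambda>k. n k * (\<theta> k)\<^sup>2) \<longlonglongrightarrow> a" and \<theta>: "\<theta> \<longlonglongrightarrow> 0" and m: "m \<longlonglongrightarrow> m0"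
    and m1: "\<forall>\<^sub>F k in sequentially. \<bar>m k\<bar> \<le> 1"
  shows "(\<lambda>k. (spin_char (m k) (\<theta> k) * iexp (- (\<theta> k * m k))) ^ n k) \<longlonglongrightarrow> of_real (exp (- (a * (1 - m0\<^sup>2) / 2)))"
proof -
  define z where "z k = spin_char (m k) (\<theta> k) * iexp (- (\<theta> k * m k))" for k
  define e where "e k = exp (- ((\<theta> k)\<^sup>2 * (1 - (m k)\<^sup>2) / 2))" for k
  have "(\<lambda>k. z k ^ n k - of_real (e k) ^ n k) \<longlonglongrightarrow> 0"
  proof (rule Lim_null_comparison)
    show "\<forall>\<^sub>F k in sequentially. cmod (z k ^ n k - of_real (e k) ^ n k) \<le> (n k * (\<theta> k)\<^sup>2) * (4 / 3 * \<bar>\<theta> k\<bar> + (\<theta> k)\<^sup>2 / 4)"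
      using m1
    proof eventually_elim
      case (elim k)
      have "cmod (z k) \<le> 1" unfolding z_def norm_mult using norm_spin_char_le[OF elim] by simp
      moreover have "cmod (of_real (e k)) \<le> 1" using elim by (simp add: e_def abs_square_le_1)
      ultimately have "cmod (z k ^ n k - of_real (e k) ^ n k) \<le> n k * cmod (z k - of_real (e k))"
        by (rule norm_power_diff)
      also have "\<dots> \<le> n k * (4 / 3 * \<bar>\<theta> k\<bar> ^ 3 + \<theta> k ^ 4 / 4)"
        unfolding z_def e_def by (intro mult_left_mono spin_char_expand elim) auto
      also have "\<dots> = (n k * (\<theta> k)\<^sup>2) * (4 / 3 * \<bar>\<theta> k\<bar> + (\<theta> k)\<^sup>2 / 4)"
      proof -
        have "\<bar>\<theta> k\<bar> ^ 3 = (\<theta> k)\<^sup>2 * \<bar>\<theta> k\<bar>" by (simp add: power3_eq_cube power2_eq_square abs_mult_self_eq)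
        moreover have "\<theta> k ^ 4 = (\<theta> k)\<^sup>2 * (\<theta> k)\<^sup>2" by (simp flip: power_add)
        ultimately show ?thesis by (simp only:) (simp add: algebra_simps)
      qed
      finally show ?case .
    qed
    have "(\<lambda>k. (n k * (\<theta> k)\<^sup>2) * (4 / 3 * \<bar>\<theta> k\<bar> + (\<theta> k)\<^sup>2 / 4)) \<longlonglongrightarrow> a * (4 / 3 * \<bar>0\<bar> + 0\<^sup>2 / 4)"
      by (intro tendsto_intros n \<theta>) auto
    then show "(\<lambda>k. (n k * (\<theta> k)\<^sup>2) * (4 / 3 * \<bar>\<theta> k\<bar> + (\<theta> k)\<^sup>2 / 4)) \<longlonglongrightarrow> 0" by simp
  qed
  moreover have "(\<lambda>k. of_real (e k) ^ n k :: complex) \<longlonglongrightarrow> of_real (exp (- (a * (1 - m0\<^sup>2) / 2)))"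
  proof -
    have "(\<lambda>k. exp (- ((n k * (\<theta> k)\<^sup>2) * (1 - (m k)\<^sup>2) / 2))) \<longlonglongrightarrow> exp (- (a * (1 - m0\<^sup>2) / 2))"
      by (intro tendsto_intros n m) auto
    moreover have "exp (- ((n k * (\<theta> k)\<^sup>2) * (1 - (m k)\<^sup>2) / 2)) = e k ^ n k" for k
      by (simp add: e_def exp_of_nat_mult[symmetric] mult_ac)
    ultimately have "(\<lambda>k. e k ^ n k) \<longlonglongrightarrow> exp (- (a * (1 - m0\<^sup>2) / 2))" by simp
    from tendsto_of_real[OF this] show ?thesis by simp
  qed
  ultimately have "(\<lambda>k. (z k ^ n k - of_real (e k) ^ n k) + of_real (e k) ^ n k) \<longlonglongrightarrow> 0 + of_real (exp (- (a * (1 - m0\<^sup>2) / 2)))"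
    by (rule tendsto_add)
  then show ?thesis by (simp add: z_def)
qed

text \<open>The deviation of the conditional mean of the total spin, given \<open>w\<close>, from its value at the maximum of
  the free energy, on the scale of the central limit theorem.\<close>

definition fluctuation :: "real \<Rightarrow> real \<Rightarrow> real \<Rightarrow> nat \<Rightarrow> real \<Rightarrow> real" where
  "fluctuation p \<beta> B N w =
     ((N - nat \<lfloor>p * N\<rfloor>) * vertex_mean B 1 w + nat \<lfloor>p * N\<rfloor> * vertex_mean B 2 w
        - N * spin_density p B (cavity_field p \<beta> B)) / sqrt N"

text \<open>The derivative at the saddle of the mean spin per vertex as a function of \<open>w\<close>.\<close>

definition saddle_slope :: "real \<Rightarrow> real \<Rightarrow> real \<Rightarrow> real" where
  "saddle_slope p \<beta> B = susceptibility p B (cavity_field p \<beta> B) / (1 - (saddle p \<beta> B)\<^sup>2)"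

lemma vertex_mean_deriv_saddle:
  fixes p \<beta> B :: real
  defines "w0 \<equiv> saddle p \<beta> B" and "h0 \<equiv> cavity_field p \<beta> B"
  shows "(vertex_mean B 1 has_real_derivative (1 - (tanh (B + h0))\<^sup>2) / (1 - w0\<^sup>2)) (at w0)"
    and "(vertex_mean B 2 has_real_derivative 2 * (1 - (tanh (B + 2 * h0))\<^sup>2) / (1 - w0\<^sup>2)) (at w0)"
proof -
  have w0: "w0 \<in> {- 1<..<1}" using saddle_bounds by (simp add: w0_def)
  have a: "(artanh has_real_derivative 1 / (1 - w0\<^sup>2)) (at w0)" unfolding w0_def by (rule artanh_deriv_saddle)
  have h: "artanh w0 = h0" by (simp add: w0_def h0_def artanh_saddle)
  have "((\<lambda>w. tanh (B + artanh w)) has_real_derivative (1 - (tanh (B + h0))\<^sup>2) / (1 - w0\<^sup>2)) (at w0)"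
    using w0 by (auto intro!: derivative_eq_intros a simp: cosh_neq_0_real h abs_less_iff)
  then show "(vertex_mean B 1 has_real_derivative (1 - (tanh (B + h0))\<^sup>2) / (1 - w0\<^sup>2)) (at w0)"
  proof (rule has_field_derivative_transform_within_open[OF _ open_greaterThanLessThan w0])
    fix x :: real assume "x \<in> {- 1<..<1}"
    then show "tanh (B + artanh x) = vertex_mean B 1 x"
      using vertex_mean_tanh(1)[of B "artanh x"] tanh_artanh_real[of x] by simp
  qed
  have "((\<lambda>w. tanh (B + 2 * artanh w)) has_real_derivative 2 * (1 - (tanh (B + 2 * h0))\<^sup>2) / (1 - w0\<^sup>2)) (at w0)"
    using w0 by (auto intro!: derivative_eq_intros a simp: cosh_neq_0_real h abs_less_iff)
  then show "(vertex_mean B 2 has_real_derivative 2 * (1 - (tanh (B + 2 * h0))\<^sup>2) / (1 - w0\<^sup>2)) (at w0)"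
  proof (rule has_field_derivative_transform_within_open[OF _ open_greaterThanLessThan w0])
    fix x :: real assume "x \<in> {- 1<..<1}"
    then show "tanh (B + 2 * artanh x) = vertex_mean B 2 x"
      using vertex_mean_tanh(2)[of B "artanh x"] tanh_artanh_real[of x] by simp
  qed
qed

text \<open>The conditional mean is differentiable in \<open>w\<close> at the saddle, so it fluctuates linearly with the
  mixing variable; the rounding of \<open>p N\<close> contributes \<open>O(N\<^sup>-\<^sup>1\<^sup>/\<^sup>2)\<close>.\<close>

lemma fluctuation_properties:
  fixes p \<beta> B \<gamma> :: real and N :: "nat \<Rightarrow> nat"
  defines "w0 \<equiv> saddle p \<beta> B"
  assumes p: "0 < p" "p < 1" and \<gamma>: "\<gamma> > 0" and N: "strict_mono N"
  shows fluctuation_bound: "\<exists>\<epsilon>>0. \<exists>C\<ge>0. \<forall>n w. \<bar>w - w0\<bar> < \<epsilon> \<longrightarrow> \<bar>fluctuation p \<beta> B n w\<bar> \<le> C * (1 + sqrt n * \<bar>w - w0\<bar>)"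
    and fluctuation_limit: "\<And>x. (\<lambda>k. fluctuation p \<beta> B (N k) (w0 + x / sqrt (\<gamma> * N k))) \<longlonglongrightarrow> saddle_slope p \<beta> B / sqrt \<gamma> * x"
    and vertex_mean_limit: "\<And>x. (\<lambda>k. vertex_mean B 1 (w0 + x / sqrt (\<gamma> * N k))) \<longlonglongrightarrow> tanh (B + cavity_field p \<beta> B)"
      "\<And>x. (\<lambda>k. vertex_mean B 2 (w0 + x / sqrt (\<gamma> * N k))) \<longlonglongrightarrow> tanh (B + 2 * cavity_field p \<beta> B)"
    and inside_limit: "\<And>x. \<forall>\<^sub>F k in sequentially. \<bar>w0 + x / sqrt (\<gamma> * N k)\<bar> < 1"
proof -
  define h0 where "h0 = cavity_field p \<beta> B"
  define c where "c = saddle_slope p \<beta> B"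
  define G where "G w = (1 - p) * vertex_mean B 1 w + p * vertex_mean B 2 w" for w
  have w0: "- 1 < w0" "w0 < 1" using saddle_bounds by (simp_all add: w0_def)
  have M0: "vertex_mean B 1 w0 = tanh (B + h0)" "vertex_mean B 2 w0 = tanh (B + 2 * h0)"
    unfolding w0_def saddle_def h0_def by (rule vertex_mean_tanh)+
  have G0: "G w0 = spin_density p B h0" unfolding G_def M0 spin_density_def ..
  note dM = vertex_mean_deriv_saddle[of B p \<beta>, folded w0_def h0_def]
  have "(G has_real_derivative (1 - p) * ((1 - (tanh (B + h0))\<^sup>2) / (1 - w0\<^sup>2)) + p * (2 * (1 - (tanh (B + 2 * h0))\<^sup>2) / (1 - w0\<^sup>2))) (at w0)"
    unfolding G_def[abs_def] by (intro DERIV_add DERIV_cmult dM)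
  also have "(1 - p) * ((1 - (tanh (B + h0))\<^sup>2) / (1 - w0\<^sup>2)) + p * (2 * (1 - (tanh (B + 2 * h0))\<^sup>2) / (1 - w0\<^sup>2)) = c"
    unfolding c_def saddle_slope_def w0_def[symmetric] susceptibility_def h0_def[symmetric]
    by (simp add: add_divide_distrib mult_ac)
  finally have dG: "(G has_real_derivative c) (at w0)" .
  \<comment> \<open>For \<open>n = 0\<close> both sides are 0 because of the division by \<open>sqrt 0\<close>.\<close>
  have fl: "fluctuation p \<beta> B n w = sqrt n * (G w - G w0) + rounding p n * (vertex_mean B 1 w - vertex_mean B 2 w) / sqrt n" for n w
  proof (cases "n = 0")
    case False
    then have s: "real n = sqrt n * sqrt n" "sqrt n > 0" by simp_all
    have "(N - nat \<lfloor>p * N\<rfloor>) * vertex_mean B 1 w + nat \<lfloor>p * N\<rfloor> * vertex_mean B 2 w - N * spin_density p B h0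
      = N * (G w - G w0) + rounding p N * (vertex_mean B 1 w - vertex_mean B 2 w)" for N :: nat
      unfolding leaf_count_real[OF p, of N] G0 unfolding G_def by (simp add: algebra_simps)
    then have "fluctuation p \<beta> B n w = (n * (G w - G w0) + rounding p n * (vertex_mean B 1 w - vertex_mean B 2 w)) / sqrt n"
      unfolding fluctuation_def h0_def by simp
    also have "\<dots> = n / sqrt n * (G w - G w0) + rounding p n * (vertex_mean B 1 w - vertex_mean B 2 w) / sqrt n"
      by (simp add: add_divide_distrib)
    also have "n / sqrt n = sqrt n" by (simp add: real_div_sqrt)
    finally show ?thesis .
  qed (simp add: fluctuation_def)
  have rd: "\<bar>rounding p n\<bar> \<le> 1" for n by (rule rounding_bounds) (use p in simp)
  show "\<exists>\<epsilon>>0. \<exists>C\<ge>0. \<forall>n w. \<bar>w - w0\<bar> < \<epsilon> \<longrightarrow> \<bar>fluctuation p \<beta> B n w\<bar> \<le> C * (1 + sqrt n * \<bar>w - w0\<bar>)"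
  proof -
    have "((\<lambda>w. (G w - G w0) / (w - w0)) \<longlongrightarrow> c) (at w0)" using dG by (simp add: has_field_derivative_iff)
    then have "((\<lambda>w. \<bar>(G w - G w0) / (w - w0)\<bar>) \<longlongrightarrow> \<bar>c\<bar>) (at w0)" by (rule tendsto_rabs)
    then have "\<forall>\<^sub>F w in at w0. \<bar>(G w - G w0) / (w - w0)\<bar> < \<bar>c\<bar> + 1" by (rule order_tendstoD) simp
    then obtain e where e: "e > 0" "\<And>w. w \<noteq> w0 \<Longrightarrow> \<bar>w - w0\<bar> < e \<Longrightarrow> \<bar>(G w - G w0) / (w - w0)\<bar> < \<bar>c\<bar> + 1"
      unfolding eventually_at dist_real_def by auto
    have Gle: "\<bar>G w - G w0\<bar> \<le> (\<bar>c\<bar> + 1) * \<bar>w - w0\<bar>" if "\<bar>w - w0\<bar> < e" for w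
    proof (cases "w = w0")
      case False
      then show ?thesis using e(2)[OF False that] by (simp add: abs_divide divide_less_eq)
    qed simp
    define \<epsilon> where "\<epsilon> = min e (min (1 - w0) (1 + w0))"
    have \<epsilon>: "\<epsilon> > 0" using e w0 by (simp add: \<epsilon>_def)
    have "\<bar>fluctuation p \<beta> B n w\<bar> \<le> (\<bar>c\<bar> + 2) * (1 + sqrt n * \<bar>w - w0\<bar>)" if w: "\<bar>w - w0\<bar> < \<epsilon>" for n w
    proof (cases "n = 0")
      case False
      have w1: "\<bar>w\<bar> < 1" using w by (auto simp: \<epsilon>_def abs_less_iff)
      have "\<bar>vertex_mean B 1 w - vertex_mean B 2 w\<bar> \<le> 2"
        using vertex_mean_le[OF w1, of B 1] vertex_mean_le[OF w1, of B 2] by linarith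
      then have "\<bar>rounding p n * (vertex_mean B 1 w - vertex_mean B 2 w)\<bar> \<le> 1 * 2"
        unfolding abs_mult using rd[of n] by (intro mult_mono) auto
      moreover have "sqrt n \<ge> 1" using False by simp
      ultimately have 1: "\<bar>rounding p n * (vertex_mean B 1 w - vertex_mean B 2 w) / sqrt n\<bar> \<le> 2"
        using frac_le[of 2 "\<bar>rounding p n * (vertex_mean B 1 w - vertex_mean B 2 w)\<bar>" 1 "sqrt n"]
        unfolding abs_divide by simp
      have "\<bar>sqrt n * (G w - G w0)\<bar> \<le> sqrt n * ((\<bar>c\<bar> + 1) * \<bar>w - w0\<bar>)"
        unfolding abs_mult using Gle[of w] w by (intro mult_mono) (auto simp: \<epsilon>_def)
      then have "\<bar>fluctuation p \<beta> B n w\<bar> \<le> 2 + (\<bar>c\<bar> + 1) * (sqrt n * \<bar>w - w0\<bar>)"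
        unfolding fl using 1 abs_triangle_ineq[of "sqrt n * (G w - G w0)"] by (smt (verit) mult.left_commute)
      also have "\<dots> \<le> (\<bar>c\<bar> + 2) + (\<bar>c\<bar> + 2) * (sqrt n * \<bar>w - w0\<bar>)"
        by (intro add_mono mult_right_mono) auto
      finally show ?thesis by (simp add: distrib_left)
    qed (simp add: fluctuation_def)
    then show ?thesis using \<epsilon> by (intro exI[of _ \<epsilon>] conjI exI[of _ "\<bar>c\<bar> + 2"]) auto
  qed
  have Nlim: "filterlim (\<lambda>k. real (N k)) at_top sequentially"
    using filterlim_subseq[OF N] filterlim_real_sequentially by (rule filterlim_compose[rotated])
  have slim: "filterlim (\<lambda>k. sqrt (\<gamma> * N k)) at_top sequentially"
    by (intro filterlim_compose[OF sqrt_at_top] filterlim_tendsto_pos_mult_at_top[OF tendsto_const] \<gamma> Nlim)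
  have x0: "(\<lambda>k. x / sqrt (\<gamma> * N k)) \<longlonglongrightarrow> 0" for x
    by (rule tendsto_divide_0[OF tendsto_const filterlim_at_top_imp_at_infinity[OF slim]])
  have wl: "(\<lambda>k. w0 + x / sqrt (\<gamma> * N k)) \<longlonglongrightarrow> w0" for x
    using tendsto_add[OF tendsto_const x0[of x], of w0] by simp
  have "isCont (vertex_mean B 1) w0" "isCont (vertex_mean B 2) w0" using dM DERIV_isCont by blast+
  from this[THEN isCont_tendsto_compose, OF wl, unfolded M0 h0_def]
  show M1: "(\<lambda>k. vertex_mean B 1 (w0 + x / sqrt (\<gamma> * N k))) \<longlonglongrightarrow> tanh (B + cavity_field p \<beta> B)"
    and M2: "(\<lambda>k. vertex_mean B 2 (w0 + x / sqrt (\<gamma> * N k))) \<longlonglongrightarrow> tanh (B + 2 * cavity_field p \<beta> B)" for x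
    .
  show "\<forall>\<^sub>F k in sequentially. \<bar>w0 + x / sqrt (\<gamma> * N k)\<bar> < 1" for x
    using tendsto_rabs[OF wl[of x]] by (rule order_tendstoD(2)) (use w0 in \<open>auto simp: abs_less_iff\<close>)
  show "(\<lambda>k. fluctuation p \<beta> B (N k) (w0 + x / sqrt (\<gamma> * N k))) \<longlonglongrightarrow> saddle_slope p \<beta> B / sqrt \<gamma> * x" for x
  proof -
    define w where "w k = w0 + x / sqrt (\<gamma> * N k)" for k
    have N1: "\<forall>\<^sub>F k in sequentially. real (N k) \<ge> 1" using Nlim unfolding filterlim_at_top by blast
    have 1: "(\<lambda>k. sqrt (N k) * (G (w k) - G w0)) \<longlonglongrightarrow> c / sqrt \<gamma> * x"
    proof (cases "x = 0")
      case False
      have "filterlim w (at w0) sequentially"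
        unfolding filterlim_at
      proof (intro conjI)
        show "w \<longlonglongrightarrow> w0" unfolding w_def[abs_def] by (rule wl)
        show "\<forall>\<^sub>F k in sequentially. w k \<in> UNIV \<and> w k \<noteq> w0"
          using N1 by eventually_elim (use False \<gamma> in \<open>auto simp: w_def\<close>)
      qed
      then have "(\<lambda>k. (G (w k) - G w0) / (w k - w0) * (x / sqrt \<gamma>)) \<longlonglongrightarrow> c * (x / sqrt \<gamma>)"
        using dG unfolding has_field_derivative_iff by (intro tendsto_mult tendsto_const) (rule filterlim_compose)
      moreover have "\<forall>\<^sub>F k in sequentially. (G (w k) - G w0) / (w k - w0) * (x / sqrt \<gamma>) = sqrt (N k) * (G (w k) - G w0)"
        using N1 by eventually_elim (use False \<gamma> in \<open>simp add: w_def real_sqrt_mult field_simps\<close>)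
      ultimately show ?thesis by (simp add: tendsto_cong)
    qed (simp add: w_def)
    have 2: "(\<lambda>k. rounding p (N k) * (vertex_mean B 1 (w k) - vertex_mean B 2 (w k)) / sqrt (N k)) \<longlonglongrightarrow> 0"
    proof (rule Lim_null_comparison)
      show "\<forall>\<^sub>F k in sequentially. norm (rounding p (N k) * (vertex_mean B 1 (w k) - vertex_mean B 2 (w k)) / sqrt (N k))
         \<le> \<bar>vertex_mean B 1 (w k) - vertex_mean B 2 (w k)\<bar> / sqrt (N k)"
        by (intro always_eventually allI) (use rd in \<open>simp add: abs_mult mult_left_le_one_le divide_right_mono\<close>)
      have "(\<lambda>k. \<bar>vertex_mean B 1 (w k) - vertex_mean B 2 (w k)\<bar>) \<longlonglongrightarrow> \<bar>tanh (B + cavity_field p \<beta> B) - tanh (B + 2 * cavity_field p \<beta> B)\<bar>"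
        unfolding w_def by (intro tendsto_intros M1 M2)
      then show "(\<lambda>k. \<bar>vertex_mean B 1 (w k) - vertex_mean B 2 (w k)\<bar> / sqrt (N k)) \<longlonglongrightarrow> 0"
        by (rule tendsto_divide_0[OF _ filterlim_at_top_imp_at_infinity[OF filterlim_compose[OF sqrt_at_top Nlim]]])
    qed
    show ?thesis using tendsto_add[OF 1 2] unfolding fl w_def c_def by simp
  qed
qed

text \<open>The centering by the exact mean may be replaced by \<open>N\<close> times the limiting density. To leading order the
  deviation is linear in the Gaussian mixing variable, whose mean is 0.\<close>

lemma annealed_mean_limit:
  fixes p \<beta> B :: real and N :: "nat \<Rightarrow> nat" and d :: "nat \<Rightarrow> nat \<Rightarrow> nat"
  assumes p: "0 < p" "p < 1" and \<beta>: "0 < \<beta>" and N: "strict_mono N"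
    and cm: "\<And>k. CM12_degrees p (N k) (d k)"
  shows "(\<lambda>k. ((\<integral>\<sigma>. total_spin (N k) \<sigma> \<partial>annealed_measure \<beta> B (N k) (d k))
      - N k * spin_density p B (cavity_field p \<beta> B)) / sqrt (N k)) \<longlonglongrightarrow> 0"
proof -
  define m0 where "m0 = spin_density p B (cavity_field p \<beta> B)"
  define w0 \<gamma> where "w0 = saddle p \<beta> B" and "\<gamma> = saddle_curvature p \<beta> B"
  have \<gamma>: "\<gamma> > 0" unfolding \<gamma>_def by (rule saddle_curvature_pos[OF p \<beta>])
  define c where "c = saddle_slope p \<beta> B / sqrt \<gamma>"
  define F where "F k x = (1 / sqrt (N k)) * x + - (N k * m0 / sqrt (N k))" for k x
  obtain \<epsilon> C where \<epsilon>: "\<epsilon> > 0" "C \<ge> 0" "\<And>n w. \<bar>w - w0\<bar> < \<epsilon> \<Longrightarrow> \<bar>fluctuation p \<beta> B n w\<bar> \<le> C * (1 + sqrt n * \<bar>w - w0\<bar>)"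
    using fluctuation_bound[OF p \<gamma> N, of \<beta> B] unfolding w0_def by blast
  have m0: "\<bar>m0\<bar> \<le> 1"
  proof -
    have "\<bar>(1 - p) * tanh x + p * tanh y\<bar> \<le> (1 - p) * 1 + p * 1" for x y :: real
    proof -
      have "\<bar>(1 - p) * tanh x + p * tanh y\<bar> \<le> \<bar>(1 - p) * tanh x\<bar> + \<bar>p * tanh y\<bar>" by (rule abs_triangle_ineq)
      also have "\<dots> \<le> (1 - p) * 1 + p * 1"
        unfolding abs_mult using p tanh_real_bounds[of x] tanh_real_bounds[of y]
        by (intro add_mono mult_mono) (auto simp: abs_le_iff)
      finally show ?thesis .
    qed
    then show ?thesis unfolding m0_def spin_density_def by simp
  qed
  have "(\<lambda>k. \<integral>\<sigma>. F k (total_spin (N k) \<sigma>) \<partial>annealed_measure \<beta> B (N k) (d k))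
     \<longlonglongrightarrow> (\<integral>x. std_normal_density x *\<^sub>R (c * x) \<partial>lborel)"
  proof (rule annealed_expectation_limit[OF p \<beta> N cm, where C="C + 2" and f="\<lambda>k w. fluctuation p \<beta> B (N k) w" and \<phi>="\<lambda>x. c * x"])
    show "C + 2 \<ge> 0" using \<epsilon> by simp
    show "norm (F k (total_spin (N k) \<sigma>)) \<le> (C + 2) * sqrt (N k)" if k: "N k \<ge> 1" and \<sigma>: "\<sigma> \<in> spin_configs (N k)" for k \<sigma>
    proof -
      have "\<bar>total_spin (N k) \<sigma>\<bar> \<le> (\<Sum>i\<in>{1..N k}. 1)"
        unfolding total_spin_def
        by (rule order_trans[OF sum_abs sum_mono]) (use \<sigma> in \<open>auto simp: spin_configs_def PiE_def Pi_def\<close>)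
      then have "\<bar>total_spin (N k) \<sigma>\<bar> \<le> N k" by simp
      moreover have "\<bar>N k * m0\<bar> \<le> N k" using m0 by (simp add: abs_mult mult_left_le)
      ultimately have "\<bar>total_spin (N k) \<sigma> - N k * m0\<bar> \<le> 2 * N k" by linarith
      then have "\<bar>total_spin (N k) \<sigma> - N k * m0\<bar> / sqrt (N k) \<le> 2 * N k / sqrt (N k)" by (rule divide_right_mono) simp
      also have "2 * N k / sqrt (N k) = 2 * sqrt (N k)" using real_div_sqrt[of "real (N k)"] by simp
      also have "\<dots> \<le> (C + 2) * sqrt (N k)" using \<epsilon> by (intro mult_right_mono) auto
      finally show ?thesis by (simp add: F_def diff_divide_distrib[symmetric] abs_divide)
    qed
    show "spin_kernel \<beta> B (N k) (d k) (F k) w = annealed_weight p \<beta> B (N k) w *\<^sub>R fluctuation p \<beta> B (N k) w" if "\<bar>w\<bar> < 1" for k w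
      unfolding F_def kernel_affine[OF p \<beta> cm that] fluctuation_def m0_def by (simp add: diff_divide_distrib)
    show "\<exists>\<epsilon>>0. \<forall>k w. \<bar>w - saddle p \<beta> B\<bar> < \<epsilon> \<longrightarrow> norm (fluctuation p \<beta> B (N k) w) \<le> (C + 2) * (1 + sqrt (N k) * \<bar>w - saddle p \<beta> B\<bar>)"
    proof (intro exI[of _ \<epsilon>] conjI allI impI)
      fix k w assume "\<bar>w - saddle p \<beta> B\<bar> < \<epsilon>"
      then have "\<bar>fluctuation p \<beta> B (N k) w\<bar> \<le> C * (1 + sqrt (N k) * \<bar>w - w0\<bar>)" using \<epsilon>(3) by (simp add: w0_def)
      also have "\<dots> \<le> (C + 2) * (1 + sqrt (N k) * \<bar>w - w0\<bar>)" by (intro mult_right_mono) auto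
      finally show "norm (fluctuation p \<beta> B (N k) w) \<le> (C + 2) * (1 + sqrt (N k) * \<bar>w - saddle p \<beta> B\<bar>)" by (simp add: w0_def)
    qed (rule \<epsilon>)
    show "(\<lambda>k. fluctuation p \<beta> B (N k) (saddle p \<beta> B + x / sqrt (saddle_curvature p \<beta> B * N k))) \<longlonglongrightarrow> c * x" for x
      using fluctuation_limit[OF p \<gamma> N, of \<beta> B x] by (simp add: c_def \<gamma>_def)
  qed measurable
  also have "(\<integral>x. std_normal_density x *\<^sub>R (c * x) \<partial>lborel) = 0"
  proof -
    have "(\<integral>x. std_normal_density x * x ^ (2 * 0 + 1) \<partial>lborel) = 0"
      by (rule integral_std_normal_moment_odd)
    moreover have "(\<integral>x. std_normal_density x *\<^sub>R (c * x) \<partial>lborel) = c * (\<integral>x. std_normal_density x * x \<partial>lborel)"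
      unfolding integral_mult_right_zero[symmetric] by (simp add: mult_ac)
    ultimately show ?thesis by simp
  qed
  finally have "(\<lambda>k. \<integral>\<sigma>. F k (total_spin (N k) \<sigma>) \<partial>annealed_measure \<beta> B (N k) (d k)) \<longlonglongrightarrow> 0" .
  moreover have "(\<integral>\<sigma>. F k (total_spin (N k) \<sigma>) \<partial>annealed_measure \<beta> B (N k) (d k))
     = ((\<integral>\<sigma>. total_spin (N k) \<sigma> \<partial>annealed_measure \<beta> B (N k) (d k)) - N k * m0) / sqrt (N k)" for k
  proof -
    obtain n where n: "card (half_edges (N k) (d k)) = 2 * n" using even_half_edges[OF p \<beta> cm] by blast
    have "(\<integral>\<sigma>. F k (total_spin (N k) \<sigma>) \<partial>annealed_measure \<beta> B (N k) (d k))
       = (1 / sqrt (N k)) * (\<Sum>\<sigma>\<in>spin_configs (N k). annealed_prob \<beta> B (N k) (d k) \<sigma> * total_spin (N k) \<sigma>)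
         + - (N k * m0 / sqrt (N k)) * (\<Sum>\<sigma>\<in>spin_configs (N k). annealed_prob \<beta> B (N k) (d k) \<sigma>)"
      unfolding integral_annealed_measure[OF n] F_def sum_distrib_left sum.distrib[symmetric]
      by (intro sum.cong refl) (simp add: algebra_simps)
    then show ?thesis
      unfolding annealed_prob_nonneg_sum(2)[OF n] integral_annealed_measure[OF n] by (simp add: diff_divide_distrib)
  qed
  ultimately show ?thesis by (simp add: m0_def)
qed

lemma spin_kernel_mult_right:
  fixes F :: "real \<Rightarrow> complex"
  shows "spin_kernel \<beta> B N d (\<lambda>x. F x * c) w = spin_kernel \<beta> B N d F w * c"
  unfolding spin_kernel_def sum_distrib_right by simp

lemma std_normal_char: "(\<integral>x. std_normal_density x *\<^sub>R iexp (t * x) \<partial>lborel) = of_real (exp (- t\<^sup>2 / 2))"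
proof -
  have "char std_normal_distribution t = (\<integral>x. std_normal_density x *\<^sub>R iexp (t * x) \<partial>lborel)"
    unfolding char_def by (subst integral_density) auto
  then show ?thesis by (simp add: char_std_normal_distribution)
qed

text \<open>Given the mixing variable, the characteristic function factorises over the vertices. Centering each
  factor at its conditional mean leaves the Gaussian factor of the conditional variance and a phase that is
  linear in the mixing variable; integrating the phase yields the second part of \<open>limit_variance\<close>.\<close>

lemma annealed_char_limit:
  fixes p \<beta> B u :: real and N :: "nat \<Rightarrow> nat" and d :: "nat \<Rightarrow> nat \<Rightarrow> nat"
  assumes p: "0 < p" "p < 1" and \<beta>: "0 < \<beta>" and N: "strict_mono N"
    and cm: "\<And>k. CM12_degrees p (N k) (d k)"
  shows "(\<lambda>k. \<integral>\<sigma>. iexp (u / sqrt (N k) * (total_spin (N k) \<sigma> - N k * spin_density p B (cavity_field p \<beta> B)))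
       \<partial>annealed_measure \<beta> B (N k) (d k)) \<longlonglongrightarrow> of_real (exp (- (limit_variance p \<beta> B * u\<^sup>2 / 2)))"
proof -
  define h0 where "h0 = cavity_field p \<beta> B"
  define m0 where "m0 = spin_density p B h0"
  define w0 \<gamma> where "w0 = saddle p \<beta> B" and "\<gamma> = saddle_curvature p \<beta> B"
  have \<gamma>: "\<gamma> > 0" unfolding \<gamma>_def by (rule saddle_curvature_pos[OF p \<beta>])
  have w0: "- 1 < w0" "w0 < 1" using saddle_bounds by (simp_all add: w0_def)
  define c where "c = saddle_slope p \<beta> B / sqrt \<gamma>"
  define v where "v = spin_variance p B h0"
  define \<theta> where "\<theta> k = u / sqrt (N k)" for k
  define n1 n2 where "n1 k = N k - nat \<lfloor>p * N k\<rfloor>" and "n2 k = nat \<lfloor>p * N k\<rfloor>" for k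
  define F where "F k x = iexp (\<theta> k * x) * iexp (- (\<theta> k * (N k * m0)))" for k and x :: real
  define f where "f k w = spin_char (vertex_mean B 1 w) (\<theta> k) ^ n1 k * spin_char (vertex_mean B 2 w) (\<theta> k) ^ n2 k
      * iexp (- (\<theta> k * (N k * m0)))" for k w
  define \<phi> where "\<phi> x = of_real (exp (- (u\<^sup>2 * v / 2))) * iexp (u * (c * x))" for x
  have f1: "cmod (f k w) \<le> 1" if "\<bar>w\<bar> < 1" for k w
  proof -
    have "cmod (spin_char (vertex_mean B j w) (\<theta> k)) \<le> 1" for j by (intro norm_spin_char_le vertex_mean_le that)
    then show ?thesis unfolding f_def by (simp add: norm_mult norm_power power_le_one mult_le_one)
  qed
  \<comment> \<open>The phase is distributed over the vertices so that each factor becomes centred; what is left over is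
    the phase of the fluctuation.\<close>
  have split: "f k w = (spin_char (vertex_mean B 1 w) (\<theta> k) * iexp (- (\<theta> k * vertex_mean B 1 w))) ^ n1 k
      * (spin_char (vertex_mean B 2 w) (\<theta> k) * iexp (- (\<theta> k * vertex_mean B 2 w))) ^ n2 k
      * iexp (u * fluctuation p \<beta> B (N k) w)" for k w
  proof -
    have e: "iexp x ^ n = iexp (n * x)" for x :: real and n :: nat
      by (simp add: exp_of_nat_mult[symmetric] mult_ac)
    have m: "iexp x * iexp y = iexp (x + y)" for x y :: real by (simp add: exp_add[symmetric] distrib_left)
    have "iexp (- (\<theta> k * vertex_mean B 1 w)) ^ n1 k * iexp (- (\<theta> k * vertex_mean B 2 w)) ^ n2 k * iexp (u * fluctuation p \<beta> B (N k) w)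
      = iexp (- (\<theta> k * (N k * m0)))"
      unfolding e m by (rule arg_cong[where f="\<lambda>x. iexp x"])
        (simp add: \<theta>_def fluctuation_def n1_def n2_def m0_def h0_def diff_divide_distrib add_divide_distrib algebra_simps)
    then have "f k w = spin_char (vertex_mean B 1 w) (\<theta> k) ^ n1 k * spin_char (vertex_mean B 2 w) (\<theta> k) ^ n2 k *
      (iexp (- (\<theta> k * vertex_mean B 1 w)) ^ n1 k * iexp (- (\<theta> k * vertex_mean B 2 w)) ^ n2 k * iexp (u * fluctuation p \<beta> B (N k) w))"
      by (simp only: f_def)
    then show ?thesis by (simp only: power_mult_distrib mult_ac)
  qed
  have Nlim: "filterlim (\<lambda>k. real (N k)) at_top sequentially"
    using filterlim_subseq[OF N] filterlim_real_sequentially by (rule filterlim_compose[rotated])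
  have N1: "\<forall>\<^sub>F k in sequentially. real (N k) \<ge> 1" using Nlim unfolding filterlim_at_top by blast
  have \<theta>0: "\<theta> \<longlonglongrightarrow> 0"
    unfolding \<theta>_def[abs_def]
    by (rule tendsto_divide_0[OF tendsto_const filterlim_at_top_imp_at_infinity[OF filterlim_compose[OF sqrt_at_top Nlim]]])
  have rN: "(\<lambda>k. rounding p (N k) / N k) \<longlonglongrightarrow> 0"
  proof (rule Lim_null_comparison)
    show "\<forall>\<^sub>F k in sequentially. norm (rounding p (N k) / N k) \<le> 1 / N k"
      by (intro always_eventually allI) (use rounding_bounds[of p] p in \<open>auto simp: divide_right_mono\<close>)
    show "(\<lambda>k. 1 / real (N k)) \<longlonglongrightarrow> 0"
      by (rule tendsto_divide_0[OF tendsto_const filterlim_at_top_imp_at_infinity[OF Nlim]])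
  qed
  have n1: "(\<lambda>k. n1 k * (\<theta> k)\<^sup>2) \<longlonglongrightarrow> (1 - p) * u\<^sup>2"
  proof -
    have "(\<lambda>k. ((1 - p) + rounding p (N k) / N k) * u\<^sup>2) \<longlonglongrightarrow> ((1 - p) + 0) * u\<^sup>2" by (intro tendsto_intros rN)
    moreover have "\<forall>\<^sub>F k in sequentially. ((1 - p) + rounding p (N k) / N k) * u\<^sup>2 = n1 k * (\<theta> k)\<^sup>2"
      using N1 by eventually_elim
        (simp add: n1_def leaf_count_real[OF p] \<theta>_def power_divide field_simps del: of_nat_diff)
    ultimately show ?thesis by (simp add: tendsto_cong)
  qed
  have n2: "(\<lambda>k. n2 k * (\<theta> k)\<^sup>2) \<longlonglongrightarrow> p * u\<^sup>2"
  proof -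
    have "(\<lambda>k. (p - rounding p (N k) / N k) * u\<^sup>2) \<longlonglongrightarrow> (p - 0) * u\<^sup>2" by (intro tendsto_intros rN)
    moreover have "\<forall>\<^sub>F k in sequentially. (p - rounding p (N k) / N k) * u\<^sup>2 = n2 k * (\<theta> k)\<^sup>2"
      using N1 by eventually_elim
        (simp add: n2_def leaf_count_real[OF p] \<theta>_def power_divide field_simps del: of_nat_nat)
    ultimately show ?thesis by (simp add: tendsto_cong)
  qed
  have lim: "(\<lambda>k. f k (w0 + x / sqrt (\<gamma> * N k))) \<longlonglongrightarrow> \<phi> x" for x
  proof -
    define w where "w k = w0 + x / sqrt (\<gamma> * N k)" for k
    have M: "(\<lambda>k. vertex_mean B 1 (w k)) \<longlonglongrightarrow> tanh (B + h0)" "(\<lambda>k. vertex_mean B 2 (w k)) \<longlonglongrightarrow> tanh (B + 2 * h0)"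
      unfolding w_def w0_def h0_def by (rule vertex_mean_limit[OF p \<gamma> N])+
    have in1: "\<forall>\<^sub>F k in sequentially. \<bar>vertex_mean B j (w k)\<bar> \<le> 1" for j
      using inside_limit[OF p \<gamma> N, of \<beta> B x] unfolding w_def[symmetric] w0_def[symmetric]
      by eventually_elim (rule vertex_mean_le, simp add: w_def)
    have fl: "(\<lambda>k. fluctuation p \<beta> B (N k) (w k)) \<longlonglongrightarrow> c * x"
      unfolding w_def w0_def c_def by (rule fluctuation_limit[OF p \<gamma> N])
    have "(\<lambda>k. f k (w k)) \<longlonglongrightarrow> of_real (exp (- ((1 - p) * u\<^sup>2 * (1 - (tanh (B + h0))\<^sup>2) / 2)))
       * of_real (exp (- (p * u\<^sup>2 * (1 - (tanh (B + 2 * h0))\<^sup>2) / 2))) * iexp (u * (c * x))"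
      unfolding split by (intro tendsto_mult spin_char_power_limit n1 n2 \<theta>0 M in1 tendsto_exp tendsto_of_real tendsto_const fl)
    also have "of_real (exp (- ((1 - p) * u\<^sup>2 * (1 - (tanh (B + h0))\<^sup>2) / 2)))
       * of_real (exp (- (p * u\<^sup>2 * (1 - (tanh (B + 2 * h0))\<^sup>2) / 2))) * iexp (u * (c * x)) = \<phi> x"
    proof -
      have "- ((1 - p) * u\<^sup>2 * (1 - (tanh (B + h0))\<^sup>2) / 2) + - (p * u\<^sup>2 * (1 - (tanh (B + 2 * h0))\<^sup>2) / 2) = - (u\<^sup>2 * v / 2)"
        by (simp add: v_def spin_variance_def field_simps)
      then show ?thesis unfolding \<phi>_def of_real_mult[symmetric] exp_add[symmetric] by simp
    qed
    finally show ?thesis by (simp add: w_def)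
  qed
  have "(\<lambda>k. \<integral>\<sigma>. F k (total_spin (N k) \<sigma>) \<partial>annealed_measure \<beta> B (N k) (d k))
     \<longlonglongrightarrow> (\<integral>x. std_normal_density x *\<^sub>R \<phi> x \<partial>lborel)"
  proof (rule annealed_expectation_limit[OF p \<beta> N cm, where C=1 and f=f])
    show "norm (F k (total_spin (N k) \<sigma>)) \<le> 1 * sqrt (N k)" if "N k \<ge> 1" for k \<sigma>
      using that unfolding F_def norm_mult by simp
    show "spin_kernel \<beta> B (N k) (d k) (F k) w = annealed_weight p \<beta> B (N k) w *\<^sub>R f k w" if "\<bar>w\<bar> < 1" for k w
      unfolding F_def spin_kernel_mult_right kernel_exp[OF p \<beta> cm that] f_def n1_def n2_def by simp
    show "\<exists>\<epsilon>>0. \<forall>k w. \<bar>w - saddle p \<beta> B\<bar> < \<epsilon> \<longrightarrow> norm (f k w) \<le> 1 * (1 + sqrt (N k) * \<bar>w - saddle p \<beta> B\<bar>)"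
    proof (intro exI[of _ "min (1 - w0) (1 + w0)"] conjI allI impI)
      show "min (1 - w0) (1 + w0) > 0" using w0 by simp
      fix k w assume "\<bar>w - saddle p \<beta> B\<bar> < min (1 - w0) (1 + w0)"
      then have "\<bar>w\<bar> < 1" by (auto simp: w0_def abs_less_iff)
      then have "norm (f k w) \<le> 1" by (rule f1)
      then show "norm (f k w) \<le> 1 * (1 + sqrt (N k) * \<bar>w - saddle p \<beta> B\<bar>)"
        by (rule order_trans) simp
    qed
    show "(\<lambda>k. f k (saddle p \<beta> B + x / sqrt (saddle_curvature p \<beta> B * N k))) \<longlonglongrightarrow> \<phi> x" for x
      using lim[of x] by (simp add: w0_def \<gamma>_def)
    show "\<phi> \<in> borel_measurable borel" unfolding \<phi>_def[abs_def] by measurable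
  qed simp
  also have "(\<integral>x. std_normal_density x *\<^sub>R \<phi> x \<partial>lborel) = of_real (exp (- (u\<^sup>2 * v / 2))) * (\<integral>x. std_normal_density x *\<^sub>R iexp ((u * c) * x) \<partial>lborel)"
    unfolding integral_mult_right_zero[symmetric] \<phi>_def by (simp add: mult_ac)
  also have "\<dots> = of_real (exp (- (u\<^sup>2 * v / 2)) * exp (- (u * c)\<^sup>2 / 2))"
    unfolding std_normal_char by simp
  also have "exp (- (u\<^sup>2 * v / 2)) * exp (- (u * c)\<^sup>2 / 2) = exp (- (limit_variance p \<beta> B * u\<^sup>2 / 2))"
  proof -
    define D where "D = 1 - (saddle p \<beta> B)\<^sup>2"
    have D: "D > 0" unfolding D_def by (rule one_minus_saddle_square)
    have st: "stiffness p \<beta> B h0 > 0"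
      using stiffness_pos[OF p \<beta>] force_cavity_field[OF p \<beta>] by (simp add: h0_def)
    have "c\<^sup>2 = (saddle_slope p \<beta> B)\<^sup>2 / \<gamma>" using \<gamma> by (simp add: c_def power_divide)
    also have "\<dots> = (susceptibility p B h0)\<^sup>2 / stiffness p \<beta> B h0"
      unfolding saddle_slope_def \<gamma>_def saddle_curvature_def D_def[symmetric] h0_def[symmetric] power_divide
      using D st by simp
    finally have "limit_variance p \<beta> B = v + c\<^sup>2" by (simp add: limit_variance_def v_def h0_def Let_def)
    then show ?thesis unfolding exp_add[symmetric] by (simp add: field_simps power_mult_distrib)
  qed
  finally show ?thesis
    unfolding F_def \<theta>_def m0_def h0_def exp_add[symmetric] by (simp add: algebra_simps diff_divide_distrib)
qed

lemma char_centered_normal: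
  assumes "v > 0"
  shows "char (centered_normal v) u = of_real (exp (- (v * u\<^sup>2 / 2)))" and "real_distribution (centered_normal v)"
proof -
  define s where "s = sqrt v"
  have s: "s > 0" "s\<^sup>2 = v" using assms by (simp_all add: s_def)
  have cn: "centered_normal v = density lborel (\<lambda>x. ennreal (normal_density 0 s x))"
    using assms by (simp add: centered_normal_def s_def)
  have "char (centered_normal v) u = (\<integral>x. normal_density 0 s x *\<^sub>R iexp (u * x) \<partial>lborel)"
    unfolding char_def cn by (subst integral_density) auto
  also have "\<dots> = s *\<^sub>R (\<integral>x. normal_density 0 s (0 + s * x) *\<^sub>R iexp (u * (0 + s * x)) \<partial>lborel)"
    using lborel_integral_real_affine[of s "\<lambda>x. normal_density 0 s x *\<^sub>R iexp (u * x)" 0] s by simp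
  also have "\<dots> = (\<integral>x. std_normal_density x *\<^sub>R iexp ((u * s) * x) \<partial>lborel)"
    unfolding integral_scaleR_right[symmetric]
  proof (rule Bochner_Integration.integral_cong[OF refl])
    fix x
    have "s * normal_density 0 s (0 + s * x) = std_normal_density x"
      using s(1) by (simp add: normal_density_def std_normal_density_def real_sqrt_mult power_mult_distrib)
    then show "s *\<^sub>R normal_density 0 s (0 + s * x) *\<^sub>R iexp (u * (0 + s * x)) = std_normal_density x *\<^sub>R iexp ((u * s) * x)"
      unfolding scaleR_scaleR by (simp add: mult_ac)
  qed
  also have "\<dots> = of_real (exp (- (u * s)\<^sup>2 / 2))" by (rule std_normal_char)
  finally show "char (centered_normal v) u = of_real (exp (- (v * u\<^sup>2 / 2)))"
    using s(2) by (simp add: power_mult_distrib mult.commute)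
  have "prob_space (centered_normal v)" unfolding cn by (rule prob_space_normal_density[OF s(1)])
  then show "real_distribution (centered_normal v)"
    unfolding real_distribution_def real_distribution_axioms_def by (simp add: cn)
qed

text \<open>By \<open>annealed_mean_limit\<close> the exact centering changes the characteristic functions of
  \<open>annealed_char_limit\<close> by a phase that tends to 1; Levy's continuity theorem concludes.\<close>

theorem annealed_central_limit:
  fixes p \<beta> B :: real and N :: "nat \<Rightarrow> nat" and d :: "nat \<Rightarrow> nat \<Rightarrow> nat"
  assumes p: "0 < p" "p < 1" and \<beta>: "0 < \<beta>" and N: "strict_mono N"
    and cm: "\<And>k. CM12_degrees p (N k) (d k)"
  shows "weak_conv_m (\<lambda>k. distr (annealed_measure \<beta> B (N k) (d k)) borel (rescaled_spin \<beta> B (N k) (d k)))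
     (centered_normal (limit_variance p \<beta> B))"
proof (rule levy_continuity)
  let ?M = "\<lambda>k. annealed_measure \<beta> B (N k) (d k)"
  have v: "limit_variance p \<beta> B > 0" by (rule limit_variance_pos[OF p \<beta>])
  have n: "\<exists>n. card (half_edges (N k) (d k)) = 2 * n" for k by (rule even_half_edges[OF p \<beta> cm])
  have meas: "g \<in> borel_measurable (?M k)" for g :: "(nat \<Rightarrow> real) \<Rightarrow> real" and k
    by (simp add: annealed_measure_def measurable_point_measure_eq1)
  show "real_distribution (distr (?M k) borel (rescaled_spin \<beta> B (N k) (d k)))" for k
    using n[of k] by (auto intro!: prob_space.real_distribution_distr prob_space_annealed_measure meas)
  show "real_distribution (centered_normal (limit_variance p \<beta> B))" by (rule char_centered_normal(2)[OF v])
  fix u :: real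
  define m0 where "m0 = spin_density p B (cavity_field p \<beta> B)"
  define b where "b k = ((\<integral>\<sigma>. total_spin (N k) \<sigma> \<partial>?M k) - N k * m0) / sqrt (N k)" for k
  have "char (distr (?M k) borel (rescaled_spin \<beta> B (N k) (d k))) u =
      (\<integral>\<sigma>. iexp (u / sqrt (N k) * (total_spin (N k) \<sigma> - N k * m0)) \<partial>?M k) * iexp (- (u * b k))" for k
  proof -
    have "char (distr (?M k) borel (rescaled_spin \<beta> B (N k) (d k))) u = (\<integral>\<sigma>. iexp (u * rescaled_spin \<beta> B (N k) (d k) \<sigma>) \<partial>?M k)"
      unfolding char_def by (subst integral_distr) (auto intro: meas)
    also have "\<dots> = (\<integral>\<sigma>. iexp (u / sqrt (N k) * (total_spin (N k) \<sigma> - N k * m0)) * iexp (- (u * b k)) \<partial>?M k)"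
    proof (rule Bochner_Integration.integral_cong[OF refl])
      fix \<sigma>
      have "u * rescaled_spin \<beta> B (N k) (d k) \<sigma> = u / sqrt (N k) * (total_spin (N k) \<sigma> - N k * m0) + - (u * b k)"
        unfolding rescaled_spin_def b_def by (simp add: diff_divide_distrib algebra_simps)
      then show "iexp (u * rescaled_spin \<beta> B (N k) (d k) \<sigma>) = iexp (u / sqrt (N k) * (total_spin (N k) \<sigma> - N k * m0)) * iexp (- (u * b k))"
        by (simp only: exp_add[symmetric] of_real_add distrib_left)
    qed
    also have "\<dots> = (\<integral>\<sigma>. iexp (u / sqrt (N k) * (total_spin (N k) \<sigma> - N k * m0)) \<partial>?M k) * iexp (- (u * b k))"
      by (rule integral_mult_left_zero)
    finally show ?thesis .
  qed
  moreover have "(\<lambda>k. (\<integral>\<sigma>. iexp (u / sqrt (N k) * (total_spin (N k) \<sigma> - N k * m0)) \<partial>?M k) * iexp (- (u * b k)))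
     \<longlonglongrightarrow> of_real (exp (- (limit_variance p \<beta> B * u\<^sup>2 / 2))) * iexp (- (u * 0))"
    unfolding b_def m0_def
    by (intro tendsto_mult annealed_char_limit[OF p \<beta> N cm] tendsto_exp tendsto_of_real tendsto_minus tendsto_const
        annealed_mean_limit[OF p \<beta> N cm])
  ultimately show "(\<lambda>k. char (distr (?M k) borel (rescaled_spin \<beta> B (N k) (d k))) u) \<longlonglongrightarrow> char (centered_normal (limit_variance p \<beta> B)) u"
    unfolding char_centered_normal(1)[OF v] by simp
qed

section \<open>The limiting variance as a second derivative\<close>

definition twice_differentiable :: "(real \<Rightarrow> real) \<Rightarrow> bool" where
  "twice_differentiable f \<longleftrightarrow>
     (\<exists>f' f''. \<forall>x. (f has_real_derivative f' x) (at x) \<and> (f' has_real_derivative f'' x) (at x))"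

lemma twice_differentiableI:
  assumes "\<And>x. (f has_real_derivative f' x) (at x)" "\<And>x. (f' has_real_derivative f'' x) (at x)"
  shows "twice_differentiable f"
  using assms unfolding twice_differentiable_def by blast

lemma twice_differentiable_const: "twice_differentiable (\<lambda>x. c)"
  by (rule twice_differentiableI[where f'="\<lambda>_. 0" and f''="\<lambda>_. 0"]) auto

lemma twice_differentiable_ident: "twice_differentiable (\<lambda>x. x)"
  by (rule twice_differentiableI[where f'="\<lambda>_. 1" and f''="\<lambda>_. 0"]) auto

lemma twice_differentiable_add:
  assumes "twice_differentiable f" "twice_differentiable g"
  shows "twice_differentiable (\<lambda>x. f x + g x)"
proof -
  obtain f' f'' g' g'' where
    "\<And>x. (f has_real_derivative f' x) (at x)" "\<And>x. (f' has_real_derivative f'' x) (at x)"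
    "\<And>x. (g has_real_derivative g' x) (at x)" "\<And>x. (g' has_real_derivative g'' x) (at x)"
    using assms unfolding twice_differentiable_def by blast
  then show ?thesis
    by (intro twice_differentiableI[where f'="\<lambda>x. f' x + g' x" and f''="\<lambda>x. f'' x + g'' x"] DERIV_add)
qed

lemma twice_differentiable_mult:
  assumes "twice_differentiable f" "twice_differentiable g"
  shows "twice_differentiable (\<lambda>x. f x * g x)"
proof -
  obtain f' f'' g' g'' where d:
    "\<And>x. (f has_real_derivative f' x) (at x)" "\<And>x. (f' has_real_derivative f'' x) (at x)"
    "\<And>x. (g has_real_derivative g' x) (at x)" "\<And>x. (g' has_real_derivative g'' x) (at x)"
    using assms unfolding twice_differentiable_def by blast
  show ?thesis
    by (rule twice_differentiableI[where f'="\<lambda>x. f' x * g x + g' x * f x"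
          and f''="\<lambda>x. (f'' x * g x + g' x * f' x) + (g'' x * f x + f' x * g' x)"])
       (intro DERIV_add DERIV_mult d)+
qed

lemma twice_differentiable_exp:
  assumes "twice_differentiable f"
  shows "twice_differentiable (\<lambda>x. exp (f x))"
proof -
  obtain f' f'' where d: "\<And>x. (f has_real_derivative f' x) (at x)" "\<And>x. (f' has_real_derivative f'' x) (at x)"
    using assms unfolding twice_differentiable_def by blast
  show ?thesis
    by (rule twice_differentiableI[where f'="\<lambda>x. exp (f x) * f' x"])
       (auto intro!: derivative_eq_intros d refl)
qed

lemma twice_differentiable_ln:
  assumes "twice_differentiable f" and pos: "\<And>x. f x > 0"
  shows "twice_differentiable (\<lambda>x. ln (f x))"
proof -
  obtain f' f'' where d: "\<And>x. (f has_real_derivative f' x) (at x)" "\<And>x. (f' has_real_derivative f'' x) (at x)"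
    using assms unfolding twice_differentiable_def by blast
  have nz: "f x \<noteq> 0" for x using pos[of x] by simp
  have "((\<lambda>x. f' x / f x) has_real_derivative (f'' x * f x - f' x * f' x) / (f x * f x)) (at x)" for x
    by (rule DERIV_divide[OF d(2) d(1) nz])
  then show ?thesis
    using DERIV_chain2[OF DERIV_ln_divide[OF pos] d(1)]
    by (intro twice_differentiableI[where f'="\<lambda>x. f' x / f x"]) simp_all
qed

lemma twice_differentiable_minus:
  "twice_differentiable f \<Longrightarrow> twice_differentiable (\<lambda>x. - f x)"
  using twice_differentiable_mult[OF twice_differentiable_const[of "- 1"]] by simp

lemma twice_differentiable_diff:
  "twice_differentiable f \<Longrightarrow> twice_differentiable g \<Longrightarrow> twice_differentiable (\<lambda>x. f x - g x)"
  using twice_differentiable_add[OF _ twice_differentiable_minus] by fastforce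

lemma twice_differentiable_power2:
  "twice_differentiable f \<Longrightarrow> twice_differentiable (\<lambda>x. (f x)\<^sup>2)"
  unfolding power2_eq_square by (rule twice_differentiable_mult)

text \<open>The square root is written as \<open>exp (ln f / 2)\<close>, so that the rules for the exponential and the
  logarithm suffice.\<close>

lemma twice_differentiable_sqrt:
  assumes "twice_differentiable f" and pos: "\<And>x. f x > 0"
  shows "twice_differentiable (\<lambda>x. sqrt (f x))"
proof -
  have "sqrt (f x) = exp (1 / 2 * ln (f x))" for x
  proof -
    have "sqrt (f x) = exp (ln (sqrt (f x)))" using pos[of x] by simp
    then show ?thesis using pos[of x] by (simp add: ln_sqrt)
  qed
  then show ?thesis
    using assms by (simp only:) (intro twice_differentiable_exp twice_differentiable_mult twice_differentiable_const twice_differentiable_ln)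
qed

lemmas twice_differentiable_intros =
  twice_differentiable_const twice_differentiable_ident twice_differentiable_add twice_differentiable_mult
  twice_differentiable_exp twice_differentiable_ln twice_differentiable_minus twice_differentiable_diff
  twice_differentiable_power2 twice_differentiable_sqrt

lemma second_deriv_shift:
  assumes f: "\<And>x. (f has_real_derivative f' x) (at x)" "\<And>x. (f' has_real_derivative f'' x) (at x)"
  shows "twice_differentiable_at (\<lambda>t. f (B + t)) 0" and "(deriv ^^ 2) (\<lambda>t. f (B + t)) 0 = f'' B"
proof -
  have shift: "((\<lambda>t. B + t) has_real_derivative 1) (at t)" for t
    by (auto intro!: derivative_eq_intros)
  have 1: "((\<lambda>t. f (B + t)) has_real_derivative f' (B + t)) (at t)" for t
    using DERIV_chain2[OF f(1) shift] by simp
  have 2: "((\<lambda>t. f' (B + t)) has_real_derivative f'' (B + t)) (at t)" for t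
    using DERIV_chain2[OF f(2) shift] by simp
  have d: "deriv (\<lambda>t. f (B + t)) = (\<lambda>t. f' (B + t))" using 1 by (intro ext DERIV_imp_deriv)
  show "twice_differentiable_at (\<lambda>t. f (B + t)) 0"
    unfolding twice_differentiable_at_def d field_differentiable_def using 1 2
    by (intro conjI always_eventually allI) blast+
  show "(deriv ^^ 2) (\<lambda>t. f (B + t)) 0 = f'' B"
    using DERIV_imp_deriv[OF 2[of 0]] by (simp add: numeral_2_eq_2 d)
qed

lemma twice_differentiable_lambda_plus: "twice_differentiable (lambda_plus \<beta>)"
proof -
  have s: "sinh x = 1 / 2 * exp x - 1 / 2 * exp (- x)" for x :: real by (simp add: sinh_def)
  have c: "cosh x = 1 / 2 * exp x + 1 / 2 * exp (- x)" for x :: real by (simp add: cosh_def)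
  show ?thesis
    unfolding lambda_plus_def[abs_def] s c
    by (intro twice_differentiable_intros) (simp add: add_nonneg_pos)
qed

lemma twice_differentiable_ln_A_plus:
  assumes "\<beta> > 0"
  shows "twice_differentiable (\<lambda>B. ln (A_plus \<beta> B))"
proof -
  define x where "x B = lambda_plus \<beta> B - exp (\<beta> + B)" for B
  define num where "num B = exp (-2 * \<beta>) * exp B + (x B)\<^sup>2 * exp (- B) + 2 * exp (- \<beta>) * x B" for B
  define den where "den B = (exp (-2 * \<beta>) + (x B)\<^sup>2) * lambda_plus \<beta> B" for B
  have x: "x B > 0" for B using lambda_plus_gt[OF assms, of B] by (simp add: x_def)
  have num: "num B > 0" for B unfolding num_def using x[of B] by (intro add_pos_nonneg) auto
  have den: "den B > 0" for B
    unfolding den_def using lambda_plus_pos[OF assms] by (intro mult_pos_pos add_pos_nonneg) auto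
  have tx: "twice_differentiable x"
    unfolding x_def[abs_def] by (intro twice_differentiable_intros twice_differentiable_lambda_plus)
  have "twice_differentiable (\<lambda>B. ln (num B) - ln (den B))"
    unfolding num_def den_def
    by (intro twice_differentiable_intros tx twice_differentiable_lambda_plus)
       (use num den in \<open>simp_all add: num_def den_def\<close>)
  moreover have "ln (num B) - ln (den B) = ln (A_plus \<beta> B)" for B
  proof -
    have "A_plus \<beta> B = num B / den B" by (simp only: A_plus_def num_def den_def x_def)
    then show ?thesis using num[of B] den[of B] by (simp only: ln_divide_pos)
  qed
  ultimately show ?thesis by simp
qed

theorem theorem1p9:
  fixes p \<beta> B :: real and N :: "nat \<Rightarrow> nat" and d :: "nat \<Rightarrow> nat \<Rightarrow> nat"
  assumes "0 < p" and "p < 1" and "0 < \<beta>"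
    and "strict_mono N"
    and "\<And>k. CM12_degrees p (N k) (d (N k))"
  shows "twice_differentiable_at (\<lambda>t. ln (lambda_plus \<beta> (B + t))) 0 \<and>
         twice_differentiable_at (\<lambda>t. ln (A_plus \<beta> (B + t))) 0 \<and>
         twice_differentiable_at (\<lambda>t. I_fun p \<beta> (B + t)) 0 \<and>
         0 \<le> sigma2_sq p \<beta> B \<and>
         weak_conv_m
           (\<lambda>k. distr (annealed_measure \<beta> B (N k) (d (N k))) borel
                  (rescaled_spin \<beta> B (N k) (d (N k))))
           (centered_normal (sigma2_sq p \<beta> B))"
proof -
  have "twice_differentiable (\<lambda>B. ln (lambda_plus \<beta> B))"
    by (intro twice_differentiable_ln twice_differentiable_lambda_plus lambda_plus_pos assms)
  then obtain l l' where l: "\<And>x. ((\<lambda>B. ln (lambda_plus \<beta> B)) has_real_derivative l x) (at x)"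
    "\<And>x. (l has_real_derivative l' x) (at x)"
    unfolding twice_differentiable_def by blast
  obtain a a' where a: "\<And>x. ((\<lambda>B. ln (A_plus \<beta> B)) has_real_derivative a x) (at x)"
    "\<And>x. (a has_real_derivative a' x) (at x)"
    using twice_differentiable_ln_A_plus[OF assms(3)] unfolding twice_differentiable_def by blast
  define m where "m B = spin_density p B (cavity_field p \<beta> B)" for B
  have i1: "(I_fun p \<beta> has_real_derivative m x - l x - (1 - p) / 2 * a x) (at x)" for x
  proof -
    have "((\<lambda>B. pressure p \<beta> B - ln (lambda_plus \<beta> B) - (1 - p) / 2 * ln (A_plus \<beta> B)
       + ((1 - p) / 2 * ln 2 - (1 + p) / 2 * ln (exp \<beta> / ((exp \<beta>)\<^sup>2 - (exp (- \<beta>))\<^sup>2))))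
      has_real_derivative m x - l x - (1 - p) / 2 * a x + 0) (at x)"
      unfolding m_def by (intro DERIV_add DERIV_diff DERIV_cmult DERIV_const l a pressure_deriv assms)
    then show ?thesis by (simp add: I_fun_eq_pressure[OF assms(1-3), abs_def])
  qed
  have i2: "((\<lambda>x. m x - l x - (1 - p) / 2 * a x) has_real_derivative
      limit_variance p \<beta> x - l' x - (1 - p) / 2 * a' x) (at x)" for x
    unfolding m_def by (intro DERIV_diff DERIV_cmult l a pressure_deriv2 assms)
  have \<sigma>: "sigma2_sq p \<beta> B = limit_variance p \<beta> B"
    unfolding sigma2_sq_def second_deriv_shift(2)[OF l] second_deriv_shift(2)[OF a] second_deriv_shift(2)[OF i1 i2] by simp
  have "0 \<le> sigma2_sq p \<beta> B"
    unfolding \<sigma> using limit_variance_pos[OF assms(1-3), of B] by simp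
  then show ?thesis
    using second_deriv_shift(1)[OF l] second_deriv_shift(1)[OF a] second_deriv_shift(1)[OF i1 i2]
      annealed_central_limit[OF assms(1-4), of "\<lambda>k. d (N k)" B] assms(5)
    unfolding \<sigma> by blast
qed

end
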